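(* Let $\Omega\subset\mathbb{R}^N$ be a bounded open connected set and $h\in C(\Omega)$ with $h\ge0$ on $\Omega$. Then the map $\Theta(x):=\{(r,A)\in\mathcal{Q}:(-r)^{N+2}\det A\ge h(x)\}$ is a Hausdorff continuous proper elliptic map and $\partial\Theta(x)\subset\{(r,A)\in\mathbb{R}\times\mathcal{S}(N):(-r)^{N+2}\det A=h(x)\}$ for all $x\in\Omega$. Moreover, if $u\in\mathrm{USC}(\overline\Omega)$ restricts to a $\mathcal{Q}$-admissible viscosity subsolution and $v\in\mathrm{LSC}(\overline\Omega)$ restricts to a $\mathcal{Q}$-admissible viscosity supersolution of $[-u(x)]^{N+2}\det D^2u(x)=h(x)$ in $\Omega$, then $u\le v$ on $\partial\Omega$ implies $u\le v$ in $\Omega$.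
   Context: $\mathcal{S}(N)$: real symmetric $N\times N$ matrices with usual partial order, eigenvalues $\lambda_i(A)$. $\mathcal{Q}:=\{(s,P)\in\mathbb{R}\times\mathcal{S}(N): s\le0,\ P\ge0\}$. A proper elliptic map assigns to each $x\in\Omega$ a closed, nonempty set $\subsetneq\mathbb{R}\times\mathcal{S}(N)$ invariant under adding elements of $\mathcal Q$. Hausdorff continuity: with norm $\|(r,A)\|=\max\{|r|,\max_i|\lambda_i(A)|\}$ and the Hausdorff distance $d_{\mathcal H}$ (possibly $+\infty$), for all $x\in\Omega,\eta>0$ there is $\delta>0$ with $d_{\mathcal H}(\Theta(x),\Theta(y))<\eta$ for $y\in\Omega$, $|x-y|<\delta$. Let $F(x,r,A):=(-r)^{N+2}\det A-h(x)$. $J^+_{x_0}u:=\{(\varphi(x_0),D^2\varphi(x_0)):\varphi$ is $C^2$ near $x_0$, $u\le\varphi$ near $x_0$, $u(x_0)=\varphi(x_0)\}$, $J^-_{x_0}u$ likewise with $u\ge\varphi$. $u\in\mathrm{USC}(\Omega)$ is a $\mathcal Q$-admissible viscosity subsolution if for all $x_0\in\Omega$, $(r,A)\in J^+_{x_0}u$: $F(x_0,r,A)\ge0$ and $(r,A)\in\mathcal Q$. $v\in\mathrm{LSC}(\Omega)$ is a $\mathcal Q$-admissible viscosity supersolution if for all $x_0$, $(r,A)\in J^-_{x_0}v$: $F(x_0,r,A)\le0$ or $(r,A)\notin\mathcal Q^\circ$. *)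

theory Defs
  imports "HOL-Analysis.Analysis"
begin

definition SymMat :: "(real^'n^'n) set" where
  "SymMat = {A. transpose A = A}"

definition RS :: "(real \<times> (real^'n^'n)) set" where
  "RS = UNIV \<times> SymMat"

definition psd :: "real^'n^'n \<Rightarrow> bool" where
  "psd P \<longleftrightarrow> (\<forall>v. v \<bullet> (P *v v) \<ge> 0)"

definition mat_le :: "real^'n^'n \<Rightarrow> real^'n^'n \<Rightarrow> bool" where
  "mat_le A B \<longleftrightarrow> psd (B - A)"

definition Qcone :: "(real \<times> (real^'n^'n)) set" where
  "Qcone = {(s, P). s \<le> 0 \<and> P \<in> SymMat \<and> mat_le 0 P}"

definition eigenvalues :: "real^'n^'n \<Rightarrow> real set" where
  "eigenvalues A = {c. \<exists>v. v \<noteq> 0 \<and> A *v v = c *\<^sub>R v}"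

definition pnorm :: "real \<times> (real^'n^'n) \<Rightarrow> real" where
  "pnorm z = max \<bar>fst z\<bar> (Max (abs ` eigenvalues (snd z)))"

definition hdist :: "(real \<times> (real^'n^'n)) set \<Rightarrow> (real \<times> (real^'n^'n)) set \<Rightarrow> ereal" where
  "hdist X Y = max (SUP x\<in>X. INF y\<in>Y. ereal (pnorm (x - y)))
                   (SUP y\<in>Y. INF x\<in>X. ereal (pnorm (x - y)))"

definition proper_elliptic_map ::
  "(real^'n) set \<Rightarrow> (real^'n \<Rightarrow> (real \<times> (real^'n^'n)) set) \<Rightarrow> bool" where
  "proper_elliptic_map \<Omega> \<Theta> \<longleftrightarrow>
     (\<forall>x\<in>\<Omega>. closed (\<Theta> x) \<and> \<Theta> x \<noteq> {} \<and> \<Theta> x \<subset> RS \<and>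
              (\<forall>z\<in>\<Theta> x. \<forall>q\<in>Qcone. z + q \<in> \<Theta> x))"

definition hausdorff_continuous ::
  "(real^'n) set \<Rightarrow> (real^'n \<Rightarrow> (real \<times> (real^'n^'n)) set) \<Rightarrow> bool" where
  "hausdorff_continuous \<Omega> \<Theta> \<longleftrightarrow>
     (\<forall>x\<in>\<Omega>. \<forall>\<eta>>0. \<exists>\<delta>>0. \<forall>y\<in>\<Omega>. dist x y < \<delta> \<longrightarrow> hdist (\<Theta> x) (\<Theta> y) < ereal \<eta>)"

definition Fop :: "(real^'n \<Rightarrow> real) \<Rightarrow> real^'n \<Rightarrow> real \<Rightarrow> real^'n^'n \<Rightarrow> real" where
  "Fop h x r A = (- r) ^ (CARD('n) + 2) * det A - h x"

definition Theta :: "(real^'n \<Rightarrow> real) \<Rightarrow> real^'n \<Rightarrow> (real \<times> (real^'n^'n)) set" where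
  "Theta h x = {(r, A). (r, A) \<in> Qcone \<and> (- r) ^ (CARD('n) + 2) * det A \<ge> h x}"

definition C2_on_ball ::
  "(real^'n \<Rightarrow> real) \<Rightarrow> real^'n \<Rightarrow> real \<Rightarrow> (real^'n \<Rightarrow> real^'n) \<Rightarrow> (real^'n \<Rightarrow> real^'n^'n) \<Rightarrow> bool" where
  "C2_on_ball \<phi> x0 e g H \<longleftrightarrow>
     (\<forall>y\<in>ball x0 e. (\<phi> has_derivative (\<lambda>k. g y \<bullet> k)) (at y) \<and>
                    (g has_derivative (\<lambda>k. H y *v k)) (at y)) \<and>
     continuous_on (ball x0 e) H"

definition superjet :: "(real^'n \<Rightarrow> real) \<Rightarrow> real^'n \<Rightarrow> (real \<times> (real^'n^'n)) set" where
  "superjet u x0 = {(\<phi> x0, H x0) | \<phi> e g H. e > 0 \<and> C2_on_ball \<phi> x0 e g H \<and>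
       (\<forall>y\<in>ball x0 e. u y \<le> \<phi> y) \<and> u x0 = \<phi> x0}"

definition subjet :: "(real^'n \<Rightarrow> real) \<Rightarrow> real^'n \<Rightarrow> (real \<times> (real^'n^'n)) set" where
  "subjet u x0 = {(\<phi> x0, H x0) | \<phi> e g H. e > 0 \<and> C2_on_ball \<phi> x0 e g H \<and>
       (\<forall>y\<in>ball x0 e. u y \<ge> \<phi> y) \<and> u x0 = \<phi> x0}"

definition usc_on :: "(real^'n) set \<Rightarrow> (real^'n \<Rightarrow> real) \<Rightarrow> bool" where
  "usc_on S u \<longleftrightarrow> (\<forall>x\<in>S. \<forall>t. u x < t \<longrightarrow> (\<exists>d>0. \<forall>y\<in>S. dist y x < d \<longrightarrow> u y < t))"

definition lsc_on :: "(real^'n) set \<Rightarrow> (real^'n \<Rightarrow> real) \<Rightarrow> bool" where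
  "lsc_on S v \<longleftrightarrow> (\<forall>x\<in>S. \<forall>t. t < v x \<longrightarrow> (\<exists>d>0. \<forall>y\<in>S. dist y x < d \<longrightarrow> t < v y))"

definition Q_subsolution :: "(real^'n) set \<Rightarrow> (real^'n \<Rightarrow> real) \<Rightarrow> (real^'n \<Rightarrow> real) \<Rightarrow> bool" where
  "Q_subsolution \<Omega> h u \<longleftrightarrow> usc_on \<Omega> u \<and>
     (\<forall>x0\<in>\<Omega>. \<forall>(r, A)\<in>superjet u x0. Fop h x0 r A \<ge> 0 \<and> (r, A) \<in> Qcone)"

definition Q_supersolution :: "(real^'n) set \<Rightarrow> (real^'n \<Rightarrow> real) \<Rightarrow> (real^'n \<Rightarrow> real) \<Rightarrow> bool" where
  "Q_supersolution \<Omega> h v \<longleftrightarrow> lsc_on \<Omega> v \<and>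
     (\<forall>x0\<in>\<Omega>. \<forall>(r, A)\<in>subjet v x0.
        Fop h x0 r A \<le> 0 \<or> (r, A) \<notin> (top_of_set RS interior_of Qcone))"

end

theory Submission
  imports Defs
begin

text \<open>
  The properties of \<open>\<Theta>\<close> follow from \<open>det (A + \<epsilon>I) \<ge> det A + \<epsilon>\<^sup>N\<close> for \<open>A \<ge> 0\<close>.

  For the comparison principle, adding a small convex quadratic to \<open>u\<close> makes it a strict subsolution \<open>w\<close>
  such that \<open>w - v\<close> has a strict positive maximum at an interior point. Near that point \<open>w\<close> satisfies
  \<open>det D\<^sup>2w \<ge> c\<^sup>N\<close> in the viscosity sense with a constant \<open>c\<close>, which is equivalent to the linear inequalities
  \<open>tr (B D\<^sup>2w) \<ge> N c\<close> for all positive definite \<open>B\<close> with \<open>det B = 1\<close>. Linear inequalities with constant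
  coefficients survive mollification: a viscosity subsolution lies below its averages along the random walk
  with covariance \<open>B\<close> (up to the expected error), by a discrete maximum principle in which the iterates serve
  as test functions, and this is inherited by convolutions. Hence \<open>w\<close> may be replaced by a smooth strict
  subsolution, which is an admissible test function for \<open>v\<close>. This avoids Alexandrov's theorem and the
  theorem on sums.
\<close>

section \<open>Symmetric matrices\<close>

text \<open>Three obstacles shape the comparison proof. First, the equation contains the factor
  \<open>(- u) ^ (N + 2)\<close> and a varying \<open>h\<close>, whereas the linear inequalities
  need one constant. Let M be the maximum of w - v, attained at x0. Where w \<ge> w x0 - M / 2 one
  gets - u \<le> b, and where v \<le> v x0 + M / 2 one gets - v \<ge> b, with the same b = M / 2 - w
  x0; the gain of the determinant from the added Hessian \<epsilon> I pays for the oscillation of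
  \<open>h\<close>. Second, walks and convolutions are nonlocal while the information on w is local:
  w is replaced by its maximum with a paraboloid that is itself a subsolution and dominates away
  from x0. Third, w is only upper semicontinuous, so a sup-convolution makes it Lipschitz before it
  is mollified; as the linear inequalities have constant coefficients, it does not matter at which
  point the supremum is attained. No limit of the walks is taken: a fixed total time \<tau> and
  finitely many steps already contradict a Hessian that violates the inequality.\<close>

definition diagm :: "('n \<Rightarrow> real) \<Rightarrow> real^'n^'n" where
  "diagm d = (\<chi> i j. if i = j then d i else 0)"

lemma det_diagm: "det (diagm d :: real^'n^'n) = (\<Prod>i\<in>UNIV. d i)"
  by (subst det_diagonal) (auto simp: diagm_def)

lemma transpose_diagm [simp]: "transpose (diagm d) = diagm d"
  by (auto simp: diagm_def transpose_def vec_eq_iff)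

lemma diagm_add: "diagm d + diagm e = diagm (\<lambda>i. d i + e i)"
  by (auto simp: diagm_def vec_eq_iff)

lemma diagm_mult: "diagm d ** diagm e = diagm (\<lambda>i. d i * e i)"
  by (auto simp: diagm_def matrix_matrix_mult_def vec_eq_iff if_distrib[of "\<lambda>x. _ * x"]
      if_distrib[of "\<lambda>x. x * _"] cong: if_cong)

lemma mat_eq_diagm: "mat e = diagm (\<lambda>i. e)"
  by (auto simp: diagm_def mat_def vec_eq_iff)

lemma diagm_mult_vec: "(diagm d *v x) $ i = d i * x $ i"
  by (simp add: diagm_def matrix_vector_mult_def if_distrib[of "\<lambda>x. x * _"] cong: if_cong)

lemma mat_mult_vec: "mat e *v x = e *\<^sub>R (x::real^'n)"
  by (simp add: vec_eq_iff mat_eq_diagm diagm_mult_vec)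

lemma det_mat: "det (mat e :: real^'n^'n) = e ^ CARD('n)"
  by (simp add: mat_eq_diagm det_diagm)

section \<open>Symmetry, congruence and positive semidefiniteness\<close>

lemma inner_symmetric_matrix:
  assumes "A \<in> SymMat" shows "x \<bullet> (A *v y) = (A *v x) \<bullet> y"
  using assms by (simp add: SymMat_def dot_lmul_matrix[symmetric] vector_transpose_matrix
      flip: transpose_matrix_vector)

lemma SymMat_add: "A \<in> SymMat \<Longrightarrow> B \<in> SymMat \<Longrightarrow> A + B \<in> SymMat"
  by (auto simp: SymMat_def transpose_def vec_eq_iff)

lemma SymMat_mat: "mat e \<in> SymMat"
  by (simp add: SymMat_def transpose_mat)

lemma SymMat_congruence: "A \<in> SymMat \<Longrightarrow> transpose S ** A ** S \<in> SymMat"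
  by (simp add: SymMat_def matrix_transpose_mul matrix_mul_assoc)

lemma inner_congruence: "x \<bullet> ((transpose S ** A ** S) *v x) = (S *v x) \<bullet> (A *v (S *v (x::real^'n)))"
proof -
  have "x \<bullet> ((transpose S ** A ** S) *v x) = x \<bullet> (transpose S *v (A *v (S *v x)))"
    by (simp add: matrix_vector_mul_assoc matrix_mul_assoc)
  also have "\<dots> = (S *v x) \<bullet> (A *v (S *v x))"
    by (metis dot_lmul_matrix inner_commute transpose_matrix_vector)
  finally show ?thesis .
qed

lemma psd_congruence: "psd A \<Longrightarrow> psd (transpose S ** A ** S)"
  by (auto simp: psd_def inner_congruence)

lemma psd_add: "psd A \<Longrightarrow> psd B \<Longrightarrow> psd (A + B)"
  by (auto simp: psd_def matrix_vector_mult_add_rdistrib inner_right_distrib)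

lemma psd_mat: "0 \<le> e \<Longrightarrow> psd (mat e)"
  by (auto simp: psd_def mat_mult_vec)

text \<open>A maximiser of the quadratic form on the unit sphere of V is an eigenvector. Working in
  an invariant subspace is what allows an induction over orthogonal complements.\<close>

lemma symmetric_matrix_eigenvector_in_subspace:
  fixes A :: "real^'n^'n"
  assumes A: "A \<in> SymMat" and V: "subspace V" "\<exists>x\<in>V. x \<noteq> 0"
    and inv: "\<And>x. x \<in> V \<Longrightarrow> A *v x \<in> V"
  obtains v c where "v \<in> V" "norm v = 1" "A *v v = c *\<^sub>R v"
proof -
  let ?K = "V \<inter> sphere 0 1"
  obtain x where x: "x \<in> V" "x \<noteq> 0" using V by auto
  have "(1 / norm x) *\<^sub>R x \<in> ?K"
    using x V by (auto simp: subspace_scale)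
  hence ne: "?K \<noteq> {}" by blast
  have cpt: "compact ?K"
    by (intro closed_Int_compact closed_subspace V compact_sphere)
  have "continuous_on ?K (\<lambda>x. x \<bullet> (A *v x))"
    by (intro continuous_intros matrix_vector_mult_linear_continuous_on)
  then obtain v where v: "v \<in> ?K" "\<And>y. y \<in> ?K \<Longrightarrow> y \<bullet> (A *v y) \<le> v \<bullet> (A *v v)"
    using continuous_attains_sup[OF cpt ne] by blast
  define c where "c = v \<bullet> (A *v v)"
  have vv: "v \<bullet> v = 1" "v \<in> V" using v by (auto simp: norm_eq_1)
  have Q: "y \<bullet> (A *v y) \<le> c * (y \<bullet> y)" if "y \<in> V" for y
  proof (cases "y = 0")
    case False
    let ?z = "(1 / norm y) *\<^sub>R y"
    have "?z \<in> ?K" using False that V by (auto simp: subspace_scale)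
    from v(2)[OF this] have "(y \<bullet> (A *v y)) / (norm y)^2 \<le> c"
      by (simp add: c_def matrix_vector_mult_scaleR power2_eq_square)
    thus ?thesis using False by (simp add: field_simps power2_norm_eq_inner)
  qed simp
  \<comment> \<open>The residual of the eigenvalue equation serves as direction of variation: the
    first-order term of \<open>Q\<close> along \<open>v + t *\<^sub>R y\<close> is exactly
    \<open>2 * t * (y \<bullet> y)\<close>, so a small negative t violates \<open>ineq\<close>
    unless y = 0.\<close>
  define y where "y = c *\<^sub>R v - A *v v"
  have yV: "y \<in> V" unfolding y_def using vv inv V by (auto intro!: subspace_diff subspace_scale)
  have ineq: "0 \<le> 2 * t * (y \<bullet> y) + t\<^sup>2 * (c * (y \<bullet> y) - y \<bullet> (A *v y))" for t
  proof -
    have "v + t *\<^sub>R y \<in> V" using vv yV V by (auto intro!: subspace_add subspace_scale)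
    from Q[OF this]
    have "c * (1 + 2 * t * (v \<bullet> y) + t\<^sup>2 * (y \<bullet> y)) - (c + t * (v \<bullet> (A *v y)) + t * (y \<bullet> (A *v v)) + t\<^sup>2 * (y \<bullet> (A *v y))) \<ge> 0"
      using vv by (simp add: c_def[symmetric] matrix_vector_mult_scaleR matrix_vector_right_distrib
        inner_left_distrib inner_right_distrib power2_eq_square inner_commute algebra_simps)
    moreover have "v \<bullet> (A *v y) = y \<bullet> (A *v v)"
      using inner_symmetric_matrix[OF A] by (metis inner_commute)
    moreover have "y \<bullet> y = c * (v \<bullet> y) - y \<bullet> (A *v v)"
      by (subst (2) y_def) (simp add: inner_diff_right inner_commute)
    moreover have "c * (1 + 2 * t * p + t\<^sup>2 * z) - (c + t * q + t * q + t\<^sup>2 * s) =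
        2 * t * (c * p - q) + t\<^sup>2 * (c * z - s)" for p q s z
      by (simp add: algebra_simps)
    ultimately show ?thesis by metis
  qed
  have "y \<bullet> y = 0"
  proof (rule ccontr)
    assume "y \<bullet> y \<noteq> 0"
    hence pos: "y \<bullet> y > 0" by (simp add: inner_gt_zero_iff)
    define q where "q = c * (y \<bullet> y) - y \<bullet> (A *v y)"
    have q: "q \<ge> 0" using Q[OF yV] by (simp add: q_def)
    define t where "t = - (y \<bullet> y) / (q + 1)"
    have "t * (2 * (y \<bullet> y) + t * q) \<ge> 0" using ineq[of t] by (simp add: q_def power2_eq_square algebra_simps)
    moreover have "t < 0" using pos q by (simp add: t_def divide_neg_pos)
    ultimately have "2 * (y \<bullet> y) + t * q \<le> 0"
      by (simp add: zero_le_mult_iff)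
    moreover have "t * q \<ge> - (y \<bullet> y)" using pos q by (simp add: t_def field_simps)
    ultimately show False using pos by simp
  qed
  hence "A *v v = c *\<^sub>R v" by (simp add: y_def)
  thus ?thesis using that vv v by auto
qed

text \<open>By symmetry the orthogonal complement of a set of eigenvectors is invariant under A, so
  it contains a further eigenvector as long as the dimension is not exhausted.\<close>

lemma orthonormal_eigenvectors_exist:
  fixes A :: "real^'n^'n"
  assumes A: "A \<in> SymMat" and "k \<le> CARD('n)"
  shows "\<exists>B. finite B \<and> card B = k \<and> pairwise orthogonal B \<and>
    (\<forall>b\<in>B. norm b = 1 \<and> (\<exists>c. A *v b = c *\<^sub>R b))"
  using assms(2)
proof (induction k)
  case 0
  show ?case by (rule exI[of _ "{}"]) auto
next
  case (Suc k)
  then obtain B where B: "finite B" "card B = k" "pairwise orthogonal B"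
    "\<And>b. b \<in> B \<Longrightarrow> norm b = 1 \<and> (\<exists>c. A *v b = c *\<^sub>R b)" by auto
  define V where "V = {x. \<forall>b\<in>B. orthogonal b x}"
  have sub: "subspace V"
    by (auto simp: V_def subspace_def orthogonal_def inner_right_distrib)
  have "dim B < DIM(real^'n)"
    using dim_le_card'[of B] B Suc by auto
  then obtain x where x: "x \<noteq> 0" "\<And>y. y \<in> span B \<Longrightarrow> orthogonal x y"
    by (rule orthogonal_to_subspace_exists) auto
  have "x \<in> V"
    using x(2)[OF span_base] by (simp add: V_def orthogonal_commute)
  with x(1) have ne: "\<exists>x\<in>V. x \<noteq> 0" by blast
  have inv: "A *v x \<in> V" if "x \<in> V" for x
  proof -
    have "b \<bullet> (A *v x) = 0" if b: "b \<in> B" for b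
    proof -
      obtain c where "A *v b = c *\<^sub>R b" using B b by blast
      thus ?thesis using \<open>x \<in> V\<close> b by (simp add: inner_symmetric_matrix[OF A] V_def orthogonal_def)
    qed
    thus ?thesis by (auto simp: V_def orthogonal_def)
  qed
  obtain v c where v: "v \<in> V" "norm v = 1" "A *v v = c *\<^sub>R v"
    using symmetric_matrix_eigenvector_in_subspace[OF A sub ne inv] by blast
  have "v \<notin> B" using v by (auto simp: V_def orthogonal_def norm_eq_1)
  moreover have "pairwise orthogonal (insert v B)"
    using B v by (auto simp: pairwise_insert V_def orthogonal_commute)
  ultimately show ?case using B v by (intro exI[of _ "insert v B"]) auto
qed

theorem symmetric_matrix_diagonalization:
  fixes A :: "real^'n^'n"
  assumes A: "A \<in> SymMat"
  obtains P d where "orthogonal_matrix P" "A = P ** diagm d ** transpose P"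
proof -
  obtain B where B: "finite B" "card B = CARD('n)" "pairwise orthogonal B"
    "\<And>b. b \<in> B \<Longrightarrow> norm b = 1 \<and> (\<exists>c. A *v b = c *\<^sub>R b)"
    using orthonormal_eigenvectors_exist[OF A order_refl] by auto
  obtain f :: "'n \<Rightarrow> real^'n" where f: "bij_betw f UNIV B"
    using B by (metis finite_class.finite_UNIV finite_same_card_bij)
  have fB: "f i \<in> B" for i using f by (auto simp: bij_betw_def)
  have finj: "f i = f j \<longleftrightarrow> i = j" for i j using f by (auto simp: bij_betw_def inj_def)
  define P :: "real^'n^'n" where "P = (\<chi> i j. f j $ i)"
  have col: "column i P = f i" for i by (simp add: P_def column_def vec_eq_iff)
  have oP: "orthogonal_matrix P"
    unfolding orthogonal_matrix_orthonormal_columns col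
    using B(3,4) fB finj by (auto simp: pairwise_def)
  obtain d where d: "\<And>i. A *v f i = d i *\<^sub>R f i" using B(4)[OF fB] by metis
  have "A ** P = P ** diagm d"
  proof -
    have "(A ** P) $ i $ j = (A *v f j) $ i" for i j
      by (simp add: matrix_matrix_mult_def matrix_vector_mult_def P_def)
    moreover have "(P ** diagm d) $ i $ j = f j $ i * d j" for i j
      by (simp add: matrix_matrix_mult_def diagm_def P_def if_distrib[of "\<lambda>x. _ * x"] cong: if_cong)
    ultimately show ?thesis by (simp add: vec_eq_iff d)
  qed
  hence "A = P ** diagm d ** transpose P"
    using oP by (metis matrix_mul_assoc matrix_mul_rid orthogonal_matrix orthogonal_matrix_def)
  thus ?thesis using oP that by blast
qed

text \<open>AM-GM by Polya's argument: \<open>1 + s \<le> exp s\<close> is applied to each x i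
  divided by the mean, and the exponents add up to 0.\<close>

lemma prod_le_mean_power:
  fixes x :: "'n::finite \<Rightarrow> real"
  assumes "\<And>i. 0 \<le> x i"
  shows "(\<Prod>i\<in>UNIV. x i) \<le> ((\<Sum>i\<in>UNIV. x i) / CARD('n)) ^ CARD('n)"
proof (cases "(\<Sum>i\<in>UNIV. x i) = 0")
  case True
  hence "\<And>i. x i = 0" using assms by (simp add: sum_nonneg_eq_0_iff)
  thus ?thesis by simp
next
  case False
  define a where "a = (\<Sum>i\<in>UNIV. x i) / CARD('n)"
  have "(\<Sum>i\<in>UNIV. x i) > 0" using False assms by (simp add: sum_nonneg order_less_le)
  hence a: "a > 0" by (simp add: a_def)
  have "(\<Prod>i\<in>UNIV. x i / a) \<le> (\<Prod>i\<in>UNIV. exp (x i / a - 1))"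
    using assms a exp_ge_add_one_self[of "x _ / a - 1"] by (intro prod_mono) auto
  also have "\<dots> = exp ((\<Sum>i\<in>UNIV. x i) / a - CARD('n))"
    by (simp add: exp_sum[symmetric] sum_subtractf sum_divide_distrib)
  also have "\<dots> = 1" using False by (simp add: a_def)
  finally show ?thesis using a by (simp add: prod_dividef a_def[symmetric] divide_le_eq)
qed

section \<open>Determinant inequalities on the cone of positive semidefinite matrices\<close>

lemma matrix_add_rdistrib: "(A + B) ** C = A ** C + B ** (C::real^'n^'m)"
  by (simp add: matrix_matrix_mult_def vec_eq_iff distrib_right sum.distrib)

lemma det_orthogonal_conj:
  assumes "orthogonal_matrix (P::real^'n^'n)"
  shows "det (P ** A ** transpose P) = det A"
  using det_orthogonal_matrix[OF assms] by (auto simp: det_mul)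

lemma psd_diagonalization:
  fixes A :: "real^'n^'n"
  assumes A: "A \<in> SymMat" "psd A"
  obtains P d where "orthogonal_matrix P" "A = P ** diagm d ** transpose P" "\<And>i. 0 \<le> d i"
proof -
  obtain P d where P: "orthogonal_matrix P" "A = P ** diagm d ** transpose P"
    using symmetric_matrix_diagonalization[OF A(1)] by blast
  have "diagm d = transpose P ** A ** P"
    using P by (metis matrix_mul_assoc matrix_mul_lid matrix_mul_rid orthogonal_matrix_def)
  hence "psd (diagm d)" using psd_congruence A by metis
  hence "0 \<le> axis i 1 \<bullet> (diagm d *v axis i 1)" for i by (simp add: psd_def)
  hence "0 \<le> d i" for i by (simp add: inner_axis' diagm_mult_vec)
  thus ?thesis using P that by blast
qed

lemma psd_det_nonneg: "A \<in> SymMat \<Longrightarrow> psd A \<Longrightarrow> 0 \<le> det (A::real^'n^'n)"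
  by (erule (1) psd_diagonalization) (auto simp: det_orthogonal_conj det_diagm intro: prod_nonneg)

text \<open>The mixed terms of the expanded product are nonnegative. For empty I the claim would
  read 2 \<le> 1.\<close>

lemma prod_add_ge:
  fixes x y :: "'a \<Rightarrow> real"
  assumes "finite I" "I \<noteq> {}" "\<And>i. i \<in> I \<Longrightarrow> 0 \<le> x i" "\<And>i. i \<in> I \<Longrightarrow> 0 \<le> y i"
  shows "prod x I + prod y I \<le> (\<Prod>i\<in>I. x i + y i)"
  using assms
proof (induction I rule: finite_ne_induct)
  case (insert i I)
  have "x i * prod x I + y i * prod y I \<le> (x i + y i) * (prod x I + prod y I)"
    using insert.prems by (simp add: algebra_simps prod_nonneg)
  also have "\<dots> \<le> (x i + y i) * (\<Prod>i\<in>I. x i + y i)"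
    using insert by (intro mult_left_mono) auto
  finally show ?case using insert by simp
qed simp

text \<open>Adding \<open>mat e\<close> shifts every eigenvalue by e. This gain controls the
  Hausdorff distance of the sets \<open>Theta\<close> and makes the perturbed subsolution
  strict.\<close>

lemma psd_det_add_mat:
  fixes A :: "real^'n^'n"
  assumes A: "A \<in> SymMat" "psd A" and e: "0 \<le> e"
  shows "det A + e ^ CARD('n) \<le> det (A + mat e)"
proof -
  obtain P d where P: "orthogonal_matrix P" "A = P ** diagm d ** transpose P" "\<And>i. 0 \<le> d i"
    using psd_diagonalization[OF A] by blast
  have "mat e = P ** mat e ** transpose P"
  proof -
    have "mat e = e *\<^sub>R (mat 1 :: real^'n^'n)" by (simp add: mat_def vec_eq_iff)
    moreover have "P ** (e *\<^sub>R mat 1) ** transpose P = e *\<^sub>R (P ** transpose P)"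
      by (simp add: matrix_scalar_ac scalar_matrix_assoc)
    ultimately show ?thesis using P(1) by (simp add: orthogonal_matrix_def)
  qed
  hence "A + mat e = P ** (diagm d + mat e) ** transpose P"
    using P by (metis matrix_add_ldistrib matrix_add_rdistrib)
  hence "det (A + mat e) = (\<Prod>i\<in>UNIV. d i + e)"
    using P by (simp add: det_orthogonal_conj mat_eq_diagm diagm_add det_diagm)
  moreover have "det A = (\<Prod>i\<in>UNIV. d i)" using P by (simp add: det_orthogonal_conj det_diagm)
  moreover have "(\<Prod>i\<in>UNIV. d i) + (\<Prod>i::'n\<in>UNIV. e) \<le> (\<Prod>i\<in>UNIV. d i + e)"
    using P e by (intro prod_add_ge) auto
  ultimately show ?thesis by simp
qed

lemma psd_det_mono:
  fixes A :: "real^'n^'n"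
  assumes A: "A \<in> SymMat" "psd A" and B: "B \<in> SymMat" "psd B"
  shows "det A \<le> det (A + B)"
proof (cases "det A = 0")
  case True
  thus ?thesis using psd_det_nonneg[OF SymMat_add[OF A(1) B(1)] psd_add[OF A(2) B(2)]] by simp
next
  case False
  obtain P d where P: "orthogonal_matrix P" "A = P ** diagm d ** transpose P" "\<And>i. 0 \<le> d i"
    using psd_diagonalization[OF A] by blast
  have dA: "det A = (\<Prod>i\<in>UNIV. d i)" using P by (simp add: det_orthogonal_conj det_diagm)
  have d: "d i > 0" for i using P(3)[of i] False dA by (auto simp: order_less_le)
  \<comment> \<open>Congruence by this S turns A into \<open>mat 1\<close> and multiplies both
    determinants by \<open>(det S)\<^sup>2\<close>, which reduces the claim to A = I.\<close>
  define S where "S = P ** diagm (\<lambda>i. 1 / sqrt (d i))"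
  have "transpose S ** A ** S = diagm (\<lambda>i. 1 / sqrt (d i)) ** (transpose P ** P) ** diagm d ** (transpose P ** P) ** diagm (\<lambda>i. 1 / sqrt (d i))"
    by (simp add: S_def P(2) matrix_transpose_mul matrix_mul_assoc)
  also have "\<dots> = mat 1"
    using P(1) d by (simp add: orthogonal_matrix_def diagm_mult mat_eq_diagm[of 1] real_div_sqrt less_imp_le
        d[THEN less_imp_neq, symmetric])
  finally have SAS: "transpose S ** A ** S = mat 1" .
  have "det (transpose S ** A ** S) + 0 \<le> det (mat 1 + transpose S ** B ** S)"
    using psd_det_add_mat[OF SymMat_congruence[OF B(1)] psd_congruence[OF B(2)], of 1 S]
      psd_det_nonneg[OF SymMat_congruence[OF B(1)] psd_congruence[OF B(2)], of S]
    by (simp add: SAS add.commute)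
  also have "mat 1 + transpose S ** B ** S = transpose S ** (A + B) ** S"
    by (simp add: SAS[symmetric] matrix_add_ldistrib matrix_add_rdistrib)
  finally have "(det S)\<^sup>2 * det A \<le> (det S)\<^sup>2 * det (A + B)" by (simp add: det_mul power2_eq_square algebra_simps)
  moreover have "det S \<noteq> 0"
    using SAS by (metis det_I det_mul mult_zero_right zero_neq_one)
  ultimately show ?thesis by simp
qed

text \<open>\<open>quad_sum S A\<close> is the trace of \<open>S S\<^sup>T A\<close>. By the matrix AM-GM inequality, \<open>A\<close> is positive definite with
  \<open>det A \<ge> c\<^sup>N\<close> if and only if \<open>quad_sum S A \<ge> N c\<close> for all \<open>S\<close> with \<open>\<bar>det S\<bar> = 1\<close>: this turns the
  Monge-Ampere inequality into a family of linear ones.\<close>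

definition quad_sum :: "real^'n^'n \<Rightarrow> real^'n^'n \<Rightarrow> real" where
  "quad_sum S A = (\<Sum>i\<in>UNIV. column i S \<bullet> (A *v column i S))"

lemma quad_sum_add: "quad_sum S (A + B) = quad_sum S A + quad_sum S B"
  by (simp add: quad_sum_def matrix_vector_mult_add_rdistrib inner_right_distrib sum.distrib)

lemma quad_sum_scaleR: "quad_sum S (c *\<^sub>R A) = c * quad_sum S A"
  by (simp add: quad_sum_def scaleR_matrix_vector_assoc[symmetric] sum_distrib_left)

lemma linear_quad_sum: "linear (quad_sum S)"
  by (rule linearI) (auto simp: quad_sum_add quad_sum_scaleR)

lemma quad_sum_eq_trace: "quad_sum S A = trace (transpose S ** A ** S)"
proof -
  have "column i S = S *v axis i 1" for i by (simp add: matrix_vector_mult_basis)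
  hence "column i S \<bullet> (A *v column i S) = (transpose S ** A ** S) $ i $ i" for i
    using inner_congruence[of "axis i 1" S A]
    by (simp add: inner_axis' matrix_vector_mult_basis column_def)
  thus ?thesis by (simp add: quad_sum_def trace_def)
qed

text \<open>Because \<bar>det S\<bar> = 1, the matrix \<open>transpose S ** A ** S\<close> has the
  determinant of A; AM-GM for its eigenvalues bounds its trace, which is
  \<open>quad_sum S A\<close>.\<close>

lemma psd_quad_sum_ge:
  fixes A :: "real^'n^'n" and c :: real
  assumes A: "A \<in> SymMat" "psd A" and S: "\<bar>det S\<bar> = 1" and c: "0 \<le> c" "c ^ CARD('n) \<le> det A"
  shows "CARD('n) * c \<le> quad_sum S A"
proof -
  define M where "M = transpose S ** A ** S"
  have M: "M \<in> SymMat" "psd M" using A by (auto simp: M_def SymMat_congruence psd_congruence)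
  obtain P d where P: "orthogonal_matrix P" "M = P ** diagm d ** transpose P" "\<And>i. 0 \<le> d i"
    using psd_diagonalization[OF M] by blast
  have "trace M = trace (diagm d ** (transpose P ** P))"
    by (metis P(2) trace_mul_sym matrix_mul_assoc)
  hence tr: "trace M = sum d UNIV"
    using P by (simp add: orthogonal_matrix_def) (simp add: trace_def diagm_def)
  have "det M = (det S)\<^sup>2 * det A" by (simp add: M_def det_mul power2_eq_square)
  hence "det M = det A" using S by (metis mult_1 one_power2 power2_abs)
  moreover have "det M = prod d UNIV" using P by (simp add: det_orthogonal_conj det_diagm)
  ultimately have "c ^ CARD('n) \<le> (sum d UNIV / CARD('n)) ^ CARD('n)"
    using c prod_le_mean_power[of d, OF P(3)] by simp
  hence "c \<le> sum d UNIV / CARD('n)"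
    using P(3) by (auto intro: power_le_imp_le_base[where n = "CARD('n) - 1"] simp: sum_nonneg)
  thus ?thesis by (simp add: quad_sum_eq_trace M_def[symmetric] tr field_simps)
qed

lemma quad_sum_diag:
  assumes "orthogonal_matrix P"
  shows "quad_sum (P ** diagm b) (P ** diagm d ** transpose P) = (\<Sum>i\<in>UNIV. (b i)\<^sup>2 * d i)"
proof -
  have "transpose (P ** diagm b) ** (P ** diagm d ** transpose P) ** (P ** diagm b)
      = diagm b ** (transpose P ** P) ** diagm d ** (transpose P ** P) ** diagm b"
    by (simp add: matrix_transpose_mul matrix_mul_assoc)
  also have "\<dots> = diagm (\<lambda>i. b i * d i * b i)"
    using assms by (simp add: orthogonal_matrix_def diagm_mult)
  finally show ?thesis by (simp add: quad_sum_eq_trace trace_def diagm_def power2_eq_square mult_ac)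
qed

text \<open>In an eigenbasis of H, test matrices S = P diag b with product of b equal to 1 turn
  \<open>quad_sum S H\<close> into a weighted sum of eigenvalues; two choices of b give positivity
  and the determinant bound.\<close>

lemma quad_sum_ge_imp_pos_def:
  fixes H :: "real^'n^'n" and c :: real
  assumes H: "H \<in> SymMat" and c: "0 < c"
    and ge: "\<And>S. \<bar>det S\<bar> = 1 \<Longrightarrow> CARD('n) * c \<le> quad_sum S H"
  shows "psd H" "c ^ CARD('n) \<le> det H"
proof -
  let ?N = "CARD('n)"
  obtain P d where P: "orthogonal_matrix P" "H = P ** diagm d ** transpose P"
    using symmetric_matrix_diagonalization[OF H] by blast
  have ge': "?N * c \<le> (\<Sum>i\<in>UNIV. (b i)\<^sup>2 * d i)" if b: "prod b UNIV = 1" for b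
  proof -
    have "\<bar>det (P ** diagm b)\<bar> = 1"
      using det_orthogonal_matrix[OF P(1)] b by (auto simp: det_mul det_diagm)
    from ge[OF this] show ?thesis using P by (simp add: quad_sum_diag)
  qed
  have dpos: "d j > 0" for j
  proof (rule ccontr)
    assume "\<not> d j > 0"
    define D where "D = \<bar>\<Sum>i\<in>UNIV - {j}. d i\<bar> + 1"
    define t where "t = sqrt (?N * c / (2 * D))"
    have Dpos: "D > 0" by (simp add: D_def)
    have t: "t > 0" "t\<^sup>2 = ?N * c / (2 * D)" using c Dpos by (auto simp: t_def)
    define b where "b = (\<lambda>i. if i = j then 1 / t ^ (?N - 1) else t)"
    have "prod b UNIV = b j * prod b (UNIV - {j})" by (simp add: prod.remove)
    also have "prod b (UNIV - {j}) = t ^ (?N - 1)" by (simp add: b_def)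
    finally have "prod b UNIV = 1" using t by (simp add: b_def)
    from ge'[OF this] have "?N * c \<le> (\<Sum>i\<in>UNIV. (b i)\<^sup>2 * d i)" .
    also have "\<dots> = (b j)\<^sup>2 * d j + (\<Sum>i\<in>UNIV-{j}. (b i)\<^sup>2 * d i)" by (simp add: sum.remove)
    also have "(\<Sum>i\<in>UNIV-{j}. (b i)\<^sup>2 * d i) = t\<^sup>2 * (\<Sum>i\<in>UNIV-{j}. d i)"
      by (simp add: b_def sum_distrib_left)
    also have "(b j)\<^sup>2 * d j + \<dots> \<le> t\<^sup>2 * D"
    proof -
      have "(b j)\<^sup>2 * d j \<le> 0" using \<open>\<not> d j > 0\<close> by (simp add: mult_le_0_iff)
      moreover have "t\<^sup>2 * (\<Sum>i\<in>UNIV-{j}. d i) \<le> t\<^sup>2 * D"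
        by (rule mult_left_mono) (auto simp: D_def)
      ultimately show ?thesis by linarith
    qed
    also have "\<dots> = ?N * c / 2" using t Dpos by simp
    finally show False using c by simp
  qed
  define \<gamma> where "\<gamma> = root ?N (prod d UNIV)"
  have \<gamma>: "\<gamma> > 0" "\<gamma> ^ ?N = prod d UNIV"
    using dpos by (auto simp: \<gamma>_def prod_pos real_root_pow_pos)
  \<comment> \<open>The equality case of AM-GM: with these weights every term equals the geometric
    mean \<gamma>, so the linear inequality becomes c \<le> \<gamma>.\<close>
  define b where "b = (\<lambda>i. sqrt (\<gamma> / d i))"
  have b2: "(b i)\<^sup>2 * d i = \<gamma>" for i using \<gamma> dpos[of i] by (simp add: b_def)
  have "(prod b UNIV)\<^sup>2 * prod d UNIV = (\<Prod>i\<in>UNIV. (b i)\<^sup>2 * d i)"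
    by (simp add: prod.distrib prod_power_distrib)
  also have "\<dots> = prod d UNIV" using \<gamma> by (simp add: b2)
  finally have "(prod b UNIV)\<^sup>2 = 1" using \<gamma> by (metis mult_cancel_right1 power_eq_0_iff less_irrefl)
  moreover have "prod b UNIV \<ge> 0" using \<gamma> dpos by (auto simp: b_def less_imp_le intro!: prod_nonneg)
  ultimately have "prod b UNIV = 1" by (simp add: power2_eq_1_iff)
  from ge'[OF this] have "c \<le> \<gamma>" by (simp add: b2)
  hence "c ^ ?N \<le> \<gamma> ^ ?N" using c by (intro power_mono) auto
  thus "c ^ CARD('n) \<le> det H" using P \<gamma> by (simp add: det_orthogonal_conj det_diagm)
  have "psd (diagm d)"
    unfolding psd_def inner_vec_def diagm_mult_vec
  proof (intro allI sum_nonneg)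
    fix v :: "real^'n" and i
    have "0 \<le> d i * (v $ i * v $ i)" using dpos[of i] by simp
    thus "0 \<le> v $ i \<bullet> (d i * v $ i)" by (simp add: mult_ac)
  qed
  hence "psd (transpose (transpose P) ** diagm d ** transpose P)" by (rule psd_congruence)
  thus "psd H" by (simp add: P(2))
qed

lemma psd_det_pos_imp_coercive:
  fixes A :: "real^'n^'n"
  assumes A: "A \<in> SymMat" "psd A" and "det A > 0"
  obtains l where "l > 0" "\<And>x. l * (x \<bullet> x) \<le> x \<bullet> (A *v x)"
proof -
  obtain P d where P: "orthogonal_matrix P" "A = P ** diagm d ** transpose P" "\<And>i. 0 \<le> d i"
    using psd_diagonalization[OF A] by blast
  have "det A = (\<Prod>i\<in>UNIV. d i)" using P by (simp add: det_orthogonal_conj det_diagm)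
  hence "prod d UNIV \<noteq> 0" using \<open>det A > 0\<close> by (metis less_irrefl)
  hence "d i \<noteq> 0" for i by simp
  hence d: "d i > 0" for i using P(3)[of i] by (simp add: order_less_le)
  define l where "l = Min (range d)"
  have l: "l > 0" "\<And>i. l \<le> d i" using d by (auto simp: l_def)
  have "l * (x \<bullet> x) \<le> x \<bullet> (A *v x)" for x
  proof -
    define y where "y = transpose P *v x"
    have "y \<bullet> y = x \<bullet> x"
      using P(1) inner_congruence[of x "transpose P" "mat 1"]
      by (simp add: y_def orthogonal_matrix_def)
    moreover have "x \<bullet> (A *v x) = y \<bullet> (diagm d *v y)"
      using inner_congruence[of x "transpose P" "diagm d"] by (simp add: P(2) y_def)
    moreover have "l * (y \<bullet> y) \<le> y \<bullet> (diagm d *v y)"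
      unfolding inner_vec_def diagm_mult_vec sum_distrib_left
    proof (rule sum_mono)
      fix i
      have "l * (y $ i * y $ i) \<le> d i * (y $ i * y $ i)" by (intro mult_right_mono l) auto
      thus "l * (y $ i \<bullet> y $ i) \<le> y $ i \<bullet> (d i * y $ i)" by (simp add: mult_ac)
    qed
    ultimately show ?thesis by simp
  qed
  thus ?thesis using l that by blast
qed

section \<open>The map \<open>\<Theta>\<close>\<close>

lemma mem_Qcone: "(r, A) \<in> Qcone \<longleftrightarrow> r \<le> 0 \<and> A \<in> SymMat \<and> psd A"
  by (simp add: Qcone_def mat_le_def)

lemma mem_Theta:
  "(r, A) \<in> Theta h x \<longleftrightarrow> r \<le> 0 \<and> A \<in> SymMat \<and> psd A \<and> h x \<le> (- r) ^ (CARD('n) + 2) * det (A :: real^'n^'n)"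
  by (simp add: Theta_def mem_Qcone)

lemma continuous_on_matrix_vector_mult_left:
  "continuous_on S (\<lambda>A. (A::real^'n^'m) *v x)"
  unfolding matrix_vector_mult_def by (intro continuous_intros)

lemma continuous_on_det:
  fixes f :: "'a::topological_space \<Rightarrow> real^'n^'n"
  assumes "continuous_on S f" shows "continuous_on S (\<lambda>x. det (f x))"
  unfolding det_def using assms by (intro continuous_intros)

lemma closed_Qcone: "closed (Qcone :: (real \<times> (real^'n^'n)) set)"
proof -
  have "closed (SymMat :: (real^'n^'n) set)"
  proof -
    have "SymMat = {A :: real^'n^'n. \<forall>i j. A $ i $ j = A $ j $ i}"
      by (auto simp: SymMat_def transpose_def vec_eq_iff)
    moreover have "closed {A :: real^'n^'n. \<forall>i j. A $ i $ j = A $ j $ i}"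
      by (intro closed_Collect_all closed_Collect_eq continuous_intros)
    ultimately show ?thesis by simp
  qed
  moreover have "closed {A :: real^'n^'n. psd A}"
    unfolding psd_def
    by (intro closed_Collect_all closed_Collect_le continuous_intros continuous_on_matrix_vector_mult_left)
  ultimately have "closed ({..0::real} \<times> (SymMat \<inter> {A :: real^'n^'n. psd A}))"
    by (intro closed_Times closed_Int) auto
  moreover have "Qcone = {..0::real} \<times> (SymMat \<inter> {A :: real^'n^'n. psd A})"
    by (auto simp: mem_Qcone)
  ultimately show ?thesis by simp
qed

lemma closed_Theta: "closed (Theta h x :: (real \<times> (real^'n^'n)) set)"
proof -
  have "Theta h x = Qcone \<inter> {z :: real \<times> (real^'n^'n). h x \<le> (- fst z) ^ (CARD('n) + 2) * det (snd z)}"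
    by (auto simp: Theta_def)
  moreover have "closed {z :: real \<times> (real^'n^'n). h x \<le> (- fst z) ^ (CARD('n) + 2) * det (snd z)}"
    by (intro closed_Collect_le continuous_intros continuous_on_det)
  ultimately show ?thesis using closed_Qcone by auto
qed

lemma proper_elliptic_map_Theta:
  fixes h :: "real^'n \<Rightarrow> real"
  shows "proper_elliptic_map \<Omega> (Theta h)"
  unfolding proper_elliptic_map_def
proof (intro ballI conjI)
  fix x :: "real^'n"
  show "closed (Theta h x)" by (rule closed_Theta)
  \<comment> \<open>For the witness (-1, t I) the factor is 1 and the determinant is
    \<open>t ^ N\<close>; t \<ge> 1 gives \<open>t ^ N \<ge> t \<ge> h x\<close>.\<close>
  define t where "t = max 1 (h x)"
  have t: "1 \<le> t" "h x \<le> t" by (auto simp: t_def)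
  have "t ^ 1 \<le> t ^ CARD('n)" using t by (intro power_increasing) (auto simp: Suc_leI)
  hence "(-1, mat t) \<in> Theta h x" using t by (auto simp: mem_Theta SymMat_mat psd_mat det_mat)
  thus "Theta h x \<noteq> {}" by blast
  have "(1, mat 1 :: real^'n^'n) \<in> RS - Theta h x" by (auto simp: mem_Theta RS_def SymMat_mat)
  moreover have "Theta h x \<subseteq> RS" by (auto simp: mem_Theta RS_def)
  ultimately show "Theta h x \<subset> RS" by blast
  fix z q assume "z \<in> Theta h x" "q \<in> (Qcone :: (real \<times> (real^'n^'n)) set)"
  moreover obtain r A s P where [simp]: "z = (r, A)" "q = (s, P)" by (cases z, cases q)
  ultimately have z: "r \<le> 0" "A \<in> SymMat" "psd A" "h x \<le> (- r) ^ (CARD('n) + 2) * det A"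
    and q: "s \<le> 0" "P \<in> SymMat" "psd P"
    by (auto simp: mem_Theta mem_Qcone)
  have "(- r) ^ (CARD('n) + 2) * det A \<le> (- (r + s)) ^ (CARD('n) + 2) * det (A + P)"
    using z q psd_det_nonneg[of A] psd_det_mono[of A P] by (intro mult_mono power_mono) auto
  thus "z + q \<in> Theta h x" using z q by (auto simp: mem_Theta SymMat_add psd_add)
qed

lemma pnorm_mat: "pnorm (a, mat e :: real^'n^'n) = max \<bar>a\<bar> \<bar>e\<bar>"
proof -
  have "\<exists>v :: real^'n. v \<noteq> 0" by (intro exI[of _ "axis undefined 1"]) (simp add: axis_eq_0_iff)
  hence "eigenvalues (mat e :: real^'n^'n) = {e}"
    by (auto simp: eigenvalues_def mat_mult_vec)
  thus ?thesis by (simp add: pnorm_def)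
qed

text \<open>The displacement (-e, e I) has \<open>pnorm\<close> e and raises both factors
  superadditively, so their product gains at least \<open>e ^ (N + 2) * e ^ N\<close>. This absorbs
  a variation of h of that size.\<close>

lemma Theta_shift:
  fixes h :: "real^'n \<Rightarrow> real"
  assumes z: "(r, A) \<in> Theta h x" and e: "0 \<le> e" and hxy: "h y \<le> h x + e ^ (2 * CARD('n) + 2)"
  shows "(r - e, A + mat e) \<in> Theta h y"
proof -
  have z: "r \<le> 0" "A \<in> SymMat" "psd A" "h x \<le> (- r) ^ (CARD('n) + 2) * det A"
    using z by (auto simp: mem_Theta)
  have "(- r) ^ (CARD('n) + 2) + e ^ (CARD('n) + 2) \<le> (- r + e) ^ (CARD('n) + 2)"
    using prod_add_ge[of "{..<CARD('n) + 2}" "\<lambda>_. -r" "\<lambda>_. e"] z e by (auto simp: lessThan_empty_iff)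
  hence "((- r) ^ (CARD('n) + 2) + e ^ (CARD('n) + 2)) * (det A + e ^ CARD('n))
      \<le> (- r + e) ^ (CARD('n) + 2) * det (A + mat e)"
    using z e psd_det_nonneg[of A] psd_det_add_mat[of A e] by (intro mult_mono) auto
  moreover have "(- r) ^ (CARD('n) + 2) * det A + e ^ (CARD('n) + 2) * e ^ CARD('n)
      \<le> ((- r) ^ (CARD('n) + 2) + e ^ (CARD('n) + 2)) * (det A + e ^ CARD('n))"
    using z e psd_det_nonneg[of A] by (simp only: distrib_left distrib_right) (simp del: power_Suc)
  moreover have "e ^ (CARD('n) + 2) * e ^ CARD('n) = e ^ (2 * CARD('n) + 2)"
    by (simp only: mult_2 flip: power_add) (simp only: add_ac)
  ultimately have "h y \<le> (- r + e) ^ (CARD('n) + 2) * det (A + mat e)"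
    using z(4) hxy by linarith
  thus ?thesis using z e by (simp add: mem_Theta SymMat_add SymMat_mat psd_add psd_mat add.commute)
qed

lemma hausdorff_continuous_Theta:
  fixes h :: "real^'n \<Rightarrow> real"
  assumes "continuous_on \<Omega> h"
  shows "hausdorff_continuous \<Omega> (Theta h)"
  unfolding hausdorff_continuous_def
proof (intro ballI allI impI)
  fix x :: "real^'n" and \<eta> :: real assume x: "x \<in> \<Omega>" and \<eta>: "\<eta> > 0"
  \<comment> \<open>Suprema of distances are only bounded by \<le> e, whereas continuity asks for a
    strict inequality; hence the half.\<close>
  define e where "e = \<eta> / 2"
  have e: "e > 0" "e < \<eta>" using \<eta> by (auto simp: e_def)
  obtain \<delta> where \<delta>: "\<delta> > 0" "\<And>y. y \<in> \<Omega> \<Longrightarrow> dist y x < \<delta> \<Longrightarrow> dist (h y) (h x) < e ^ (2 * CARD('n) + 2)"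
    using assms x e by (metis continuous_on_iff zero_less_power)
  \<comment> \<open>An arbitrary N stands for \<open>pnorm\<close> because the second half of
    \<open>hdist\<close> contains the differences with opposite sign; there N is
    \<open>pnorm\<close> after negation.\<close>
  have sup_le: "(SUP z\<in>Theta h a. INF w\<in>Theta h b. ereal (N (z - w))) \<le> ereal e"
    if "h b \<le> h a + e ^ (2 * CARD('n) + 2)" and N: "N (e, mat (- e)) = e" for a b and N :: "real \<times> (real^'n^'n) \<Rightarrow> real"
  proof (rule SUP_least)
    fix z assume z: "z \<in> Theta h a"
    obtain r A where [simp]: "z = (r, A)" by (cases z)
    have "(r - e, A + mat e) \<in> Theta h b" using Theta_shift[of r A h a e b] z that e by auto
    hence "(INF w\<in>Theta h b. ereal (N (z - w))) \<le> ereal (N (z - (r - e, A + mat e)))"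
      by (rule INF_lower)
    also have "z - (r - e, A + mat e) = (e, mat (- e))" by (simp add: mat_def vec_eq_iff)
    finally show "(INF w\<in>Theta h b. ereal (N (z - w))) \<le> ereal e" using N by simp
  qed
  show "\<exists>\<delta>>0. \<forall>y\<in>\<Omega>. dist x y < \<delta> \<longrightarrow> hdist (Theta h x) (Theta h y) < ereal \<eta>"
  proof (intro exI conjI ballI impI)
    fix y assume y: "y \<in> \<Omega>" "dist x y < \<delta>"
    hence "\<bar>h y - h x\<bar> < e ^ (2 * CARD('n) + 2)" using \<delta>(2)[of y] by (simp add: dist_commute dist_real_def)
    hence *: "h y \<le> h x + e ^ (2 * CARD('n) + 2)" "h x \<le> h y + e ^ (2 * CARD('n) + 2)" by linarith+
    have neg: "- (e, mat (- e) :: real^'n^'n) = (- e, mat e)" by (simp add: mat_def vec_eq_iff)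
    have "hdist (Theta h x) (Theta h y) \<le> ereal e"
      unfolding hdist_def
    proof (rule max.boundedI)
      show "(SUP z\<in>Theta h x. INF w\<in>Theta h y. ereal (pnorm (z - w))) \<le> ereal e"
        by (rule sup_le[OF *(1)]) (use e in \<open>simp add: pnorm_mat\<close>)
      have "(SUP w\<in>Theta h y. INF z\<in>Theta h x. ereal (pnorm (- (w - z)))) \<le> ereal e"
        by (rule sup_le[OF *(2), of "\<lambda>z. pnorm (- z)"]) (use e neg in \<open>simp add: pnorm_mat\<close>)
      thus "(SUP w\<in>Theta h y. INF z\<in>Theta h x. ereal (pnorm (z - w))) \<le> ereal e" by simp
    qed
    thus "hdist (Theta h x) (Theta h y) < ereal \<eta>" using e by (meson ereal_less_eq(3) less_ereal.simps(1) order_le_less_trans)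
  qed (use \<delta> in auto)
qed

section \<open>Relative interiors and the boundary of \<open>Theta\<close>\<close>

lemma quadratic_form_le:
  fixes M :: "real^'n^'n"
  shows "\<bar>x \<bullet> (M *v x)\<bar> \<le> (CARD('n))\<^sup>2 * norm M * (x \<bullet> x)"
proof -
  have ent: "\<bar>M $ i $ j\<bar> \<le> norm M" for i j
    using component_le_norm_cart[of "M $ i" j] Finite_Cartesian_Product.norm_nth_le[of M i] by linarith
  have "\<bar>x \<bullet> (M *v x)\<bar> = \<bar>\<Sum>i\<in>UNIV. \<Sum>j\<in>UNIV. x $ i * (M $ i $ j * x $ j)\<bar>"
    by (simp add: inner_vec_def matrix_vector_mult_def sum_distrib_left)
  also have "\<dots> \<le> (\<Sum>i\<in>(UNIV::'n set). \<Sum>j\<in>(UNIV::'n set). norm x * (norm M * norm x))"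
    by (intro order_trans[OF sum_abs] sum_mono) (auto simp: abs_mult intro!: mult_mono component_le_norm_cart ent)
  also have "\<dots> = (CARD('n))\<^sup>2 * norm M * (x \<bullet> x)"
    by (simp add: power2_eq_square dot_square_norm)
  finally show ?thesis .
qed

lemma psd_perturbation:
  fixes A :: "real^'n^'n"
  assumes "A \<in> SymMat" "psd A" "det A > 0"
  obtains d where "d > 0" "\<And>B. dist B A < d \<Longrightarrow> psd B"
proof -
  obtain l where l: "l > 0" "\<And>x. l * (x \<bullet> x) \<le> x \<bullet> (A *v x)"
    using psd_det_pos_imp_coercive[OF assms] by blast
  have "psd B" if "dist B A < l / (CARD('n))\<^sup>2" for B
    unfolding psd_def
  proof
    fix x :: "real^'n"
    have "\<bar>x \<bullet> ((B - A) *v x)\<bar> \<le> (CARD('n))\<^sup>2 * norm (B - A) * (x \<bullet> x)" by (rule quadratic_form_le)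
    also have "\<dots> \<le> l * (x \<bullet> x)"
      using that by (intro mult_right_mono) (auto simp: dist_norm field_simps)
    finally have "x \<bullet> ((B - A) *v x) \<ge> - (l * (x \<bullet> x))" by linarith
    thus "0 \<le> x \<bullet> (B *v x)" using l(2)[of x]
      by (simp add: matrix_vector_mult_diff_rdistrib inner_diff_right)
  qed
  thus ?thesis using that[of "l / (CARD('n))\<^sup>2"] l by simp
qed

text \<open>Interiors are taken relative to \<open>RS\<close>, since for N \<ge> 2 sets of symmetric
  matrices have empty interior among all matrices.\<close>

lemma mem_interior_of_RS:
  fixes X :: "(real \<times> (real^'n^'n)) set"
  assumes "z \<in> RS" "open U" "z \<in> U" "U \<inter> RS \<subseteq> X"
  shows "z \<in> top_of_set RS interior_of X"
proof -
  have "openin (top_of_set RS) (RS \<inter> U)" using assms by (auto simp: openin_open)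
  thus ?thesis using assms unfolding interior_of_def by blast
qed

lemma mem_interior_Qcone:
  fixes A :: "real^'n^'n"
  assumes "r < 0" "A \<in> SymMat" "psd A" "det A > 0"
  shows "(r, A) \<in> top_of_set RS interior_of Qcone"
proof -
  obtain d where d: "d > 0" "\<And>B. dist B A < d \<Longrightarrow> psd B"
    using psd_perturbation[OF assms(2-4)] by blast
  show ?thesis
    by (rule mem_interior_of_RS[where U = "{..<0} \<times> ball A d"])
      (use assms d in \<open>auto simp: RS_def mem_Qcone open_Times dist_commute\<close>)
qed

text \<open>Where the inequality is strict, h x \<ge> 0 forces r < 0 and det A > 0. All constraints
  then persist nearby, so the point is interior.\<close>

lemma frontier_Theta:
  fixes h :: "real^'n \<Rightarrow> real"
  assumes "h x \<ge> 0"
  shows "top_of_set RS frontier_of (Theta h x) \<subseteq>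
       {(r, A). (r, A) \<in> RS \<and> (- r) ^ (CARD('n) + 2) * det A = h x}"
proof (rule subsetI)
  fix z assume z: "z \<in> top_of_set RS frontier_of (Theta h x)"
  obtain r A where [simp]: "z = (r, A)" by (cases z)
  have "closedin (top_of_set RS) (Theta h x)"
    using closed_Theta[of h x] by (auto simp: closedin_closed mem_Theta RS_def)
  hence "z \<in> Theta h x" using z frontier_of_subset_closedin by blast
  hence T: "r \<le> 0" "A \<in> SymMat" "psd A" "h x \<le> (- r) ^ (CARD('n) + 2) * det A"
    by (auto simp: mem_Theta)
  have "\<not> h x < (- r) ^ (CARD('n) + 2) * det A"
  proof
    assume less: "h x < (- r) ^ (CARD('n) + 2) * det A"
    hence "(- r) ^ (CARD('n) + 2) * det A > 0" using assms by linarith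
    hence "r \<noteq> 0" "det A \<noteq> 0" by auto
    hence rA: "r < 0" "det A > 0" using T psd_det_nonneg[of A] by auto
    obtain d where d: "d > 0" "\<And>B. dist B A < d \<Longrightarrow> psd B"
      using psd_perturbation[OF T(2,3) rA(2)] by blast
    define U where "U = ({..<0::real} \<times> ball A d) \<inter> {z. h x < (- fst z) ^ (CARD('n) + 2) * det (snd z)}"
    have "open U" unfolding U_def
      by (intro open_Int open_Times open_Collect_less continuous_intros continuous_on_det) auto
    moreover have "z \<in> U" using rA d less by (auto simp: U_def)
    moreover have "U \<inter> RS \<subseteq> Theta h x" using d by (auto simp: U_def RS_def mem_Theta dist_commute)
    ultimately have "z \<in> top_of_set RS interior_of (Theta h x)"
      using T by (intro mem_interior_of_RS) (auto simp: RS_def)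
    thus False using z by (simp add: frontier_of_def)
  qed
  thus "z \<in> {(r, A). (r, A) \<in> RS \<and> (- r) ^ (CARD('n) + 2) * det A = h x}"
    using T by (auto simp: RS_def)
qed

section \<open>Twice differentiable functions and random walks\<close>

text \<open>A global form of \<open>C2_on_ball\<close>, because walks and convolutions evaluate test
  functions away from the contact point. Gradient and Hessian are carried along explicitly.\<close>

definition C2 :: "(real^'n \<Rightarrow> real) \<Rightarrow> (real^'n \<Rightarrow> real^'n) \<Rightarrow> (real^'n \<Rightarrow> real^'n^'n) \<Rightarrow> bool" where
  "C2 \<phi> g H \<longleftrightarrow>
     (\<forall>y. (\<phi> has_derivative (\<lambda>k. g y \<bullet> k)) (at y) \<and> (g has_derivative (\<lambda>k. H y *v k)) (at y)) \<and>
     continuous_on UNIV H"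

lemma C2_imp_C2_on_ball: "C2 \<phi> g H \<Longrightarrow> C2_on_ball \<phi> x e g H"
  by (auto simp: C2_def C2_on_ball_def intro: continuous_on_subset)

lemma C2_imp_continuous_on: "C2 \<phi> g H \<Longrightarrow> continuous_on S \<phi>"
  by (auto simp: C2_def intro!: has_derivative_continuous continuous_at_imp_continuous_on)

lemma C2_on_ball_mono:
  "C2_on_ball \<phi> x e g H \<Longrightarrow> d \<le> e \<Longrightarrow> C2_on_ball \<phi> x d g H"
  unfolding C2_on_ball_def by (auto intro: continuous_on_subset)

lemma C2_on_ball_add:
  assumes "C2_on_ball \<phi> x e g H" "C2_on_ball \<psi> x e g' H'"
  shows "C2_on_ball (\<lambda>y. \<phi> y + \<psi> y) x e (\<lambda>y. g y + g' y) (\<lambda>y. H y + H' y)"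
  using assms unfolding C2_on_ball_def
  by (auto intro!: continuous_intros derivative_eq_intros simp: inner_add_left algebra_simps)

lemma C2_add:
  assumes "C2 \<phi> g H" "C2 \<psi> g' H'"
  shows "C2 (\<lambda>y. \<phi> y + \<psi> y) (\<lambda>y. g y + g' y) (\<lambda>y. H y + H' y)"
  using assms unfolding C2_def
  by (auto intro!: continuous_intros derivative_eq_intros simp: inner_add_left algebra_simps)

lemma C2_scaleR:
  assumes "C2 \<phi> g H"
  shows "C2 (\<lambda>y. c *\<^sub>R \<phi> y) (\<lambda>y. c *\<^sub>R g y) (\<lambda>y. c *\<^sub>R H y)"
  using assms unfolding C2_def
  by (auto intro!: continuous_intros derivative_eq_intros simp: scaleR_matrix_vector_assoc)

lemma C2_const: "C2 (\<lambda>y. c) (\<lambda>y. 0) (\<lambda>y. 0)"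
  unfolding C2_def by (auto intro!: continuous_intros derivative_eq_intros)

lemma C2_sum:
  assumes "\<And>i. i \<in> I \<Longrightarrow> C2 (\<phi> i) (g i) (H i)"
  shows "C2 (\<lambda>y. \<Sum>i\<in>I. \<phi> i y) (\<lambda>y. \<Sum>i\<in>I. g i y) (\<lambda>y. \<Sum>i\<in>I. H i y)"
  using assms by (induction I rule: infinite_finite_induct) (auto intro: C2_add C2_const)

lemma has_derivative_shift:
  assumes "(f has_derivative f') (at (y + a))"
  shows "((\<lambda>y. f (y + a)) has_derivative f') (at y)"
proof -
  have "((\<lambda>y. y + a) has_derivative (\<lambda>k. k)) (at y)" by (auto intro!: derivative_eq_intros)
  from has_derivative_compose[OF this assms] show ?thesis .
qed

lemma C2_on_ball_shift:
  assumes "C2_on_ball \<phi> x e g H"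
  shows "C2_on_ball (\<lambda>y. \<phi> (y + a)) (x - a) e (\<lambda>y. g (y + a)) (\<lambda>y. H (y + a))"
proof -
  have b: "y + a \<in> ball x e" if "y \<in> ball (x - a) e" for y
    using that by (simp add: dist_norm algebra_simps)
  have D: "\<forall>y\<in>ball x e. (\<phi> has_derivative (\<lambda>k. g y \<bullet> k)) (at y) \<and> (g has_derivative (\<lambda>k. H y *v k)) (at y)"
    and H: "continuous_on (ball x e) H"
    using assms by (auto simp: C2_on_ball_def)
  show ?thesis unfolding C2_on_ball_def
  proof (intro conjI ballI)
    show "continuous_on (ball (x - a) e) (\<lambda>y. H (y + a))"
      by (rule continuous_on_compose2[OF H, of _ "\<lambda>y. y + a"]) (use b in \<open>auto intro: continuous_intros\<close>)
  next
    fix y assume "y \<in> ball (x - a) e"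
    from bspec[OF D b[OF this]]
    show "((\<lambda>y. \<phi> (y + a)) has_derivative (\<lambda>k. g (y + a) \<bullet> k)) (at y)"
      "((\<lambda>y. g (y + a)) has_derivative (\<lambda>k. H (y + a) *v k)) (at y)"
      by (auto intro: has_derivative_shift)
  qed
qed

lemma C2_shift:
  assumes "C2 \<phi> g H"
  shows "C2 (\<lambda>y. \<phi> (y + a)) (\<lambda>y. g (y + a)) (\<lambda>y. H (y + a))"
  using assms unfolding C2_def
  by (auto intro!: continuous_on_compose2[of UNIV H] continuous_intros has_derivative_shift)

text \<open>The even function sending \<tau> to the sum of \<phi> at x + \<tau> s and x - \<tau> s
  has derivative 0 at 0, so Taylor's formula of order two leaves only the second derivative at one
  intermediate \<tau>.\<close>

lemma C2_second_difference:
  assumes C: "C2_on_ball \<phi> x e g H" and t: "0 < t" "t * norm s < e"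
  obtains \<tau> where "0 < \<tau>" "\<tau> < t"
    "\<phi> (x + t *\<^sub>R s) + \<phi> (x - t *\<^sub>R s) - 2 * \<phi> x =
      t\<^sup>2 / 2 * (s \<bullet> (H (x + \<tau> *\<^sub>R s) *v s) + s \<bullet> (H (x - \<tau> *\<^sub>R s) *v s))"
proof -
  define df where "df = (\<lambda>m::nat. \<lambda>\<tau>. if m = 0 then \<phi> (x + \<tau> *\<^sub>R s) + \<phi> (x - \<tau> *\<^sub>R s)
     else if m = 1 then g (x + \<tau> *\<^sub>R s) \<bullet> s - g (x - \<tau> *\<^sub>R s) \<bullet> s
     else s \<bullet> (H (x + \<tau> *\<^sub>R s) *v s) + s \<bullet> (H (x - \<tau> *\<^sub>R s) *v s))"
  have inb: "x + \<sigma> *\<^sub>R s \<in> ball x e" if "\<bar>\<sigma>\<bar> \<le> t" for \<sigma>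
  proof -
    have "\<bar>\<sigma>\<bar> * norm s \<le> t * norm s" using that by (intro mult_right_mono) auto
    thus ?thesis using t by (simp add: dist_norm)
  qed
  have line: "((\<lambda>\<tau>. x + (c * \<tau>) *\<^sub>R s) has_derivative (\<lambda>k. (c * k) *\<^sub>R s)) (at \<tau>)" for c \<tau>
    by (auto intro!: derivative_eq_intros)
  have d\<phi>: "((\<lambda>\<tau>. \<phi> (x + (c * \<tau>) *\<^sub>R s)) has_derivative (\<lambda>k. g (x + (c * \<tau>) *\<^sub>R s) \<bullet> ((c * k) *\<^sub>R s))) (at \<tau>)"
    and dg: "((\<lambda>\<tau>. g (x + (c * \<tau>) *\<^sub>R s)) has_derivative (\<lambda>k. H (x + (c * \<tau>) *\<^sub>R s) *v ((c * k) *\<^sub>R s))) (at \<tau>)"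
    if "\<bar>c * \<tau>\<bar> \<le> t" for c \<tau>
    using C inb[OF that] has_derivative_compose[OF line[of c \<tau>]] unfolding C2_on_ball_def by blast+
  have D: "DERIV (df m) \<tau> :> df (Suc m) \<tau>" if "m < 2" "0 \<le> \<tau>" "\<tau> \<le> t" for m \<tau>
  proof -
    consider "m = 0" | "m = 1" using \<open>m < 2\<close> by (auto simp: less_2_cases_iff)
    thus ?thesis
    proof cases
      case 1
      have "((\<lambda>\<tau>. \<phi> (x + (1 * \<tau>) *\<^sub>R s) + \<phi> (x + (-1 * \<tau>) *\<^sub>R s)) has_derivative
         (\<lambda>k. g (x + (1 * \<tau>) *\<^sub>R s) \<bullet> ((1 * k) *\<^sub>R s) + g (x + (-1 * \<tau>) *\<^sub>R s) \<bullet> ((-1 * k) *\<^sub>R s))) (at \<tau>)"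
        using that by (intro has_derivative_add d\<phi>) auto
      moreover have "(\<lambda>k. g (x + (1 * \<tau>) *\<^sub>R s) \<bullet> ((1 * k) *\<^sub>R s) + g (x + (-1 * \<tau>) *\<^sub>R s) \<bullet> ((-1 * k) *\<^sub>R s)) =
          (*) (g (x + \<tau> *\<^sub>R s) \<bullet> s - g (x - \<tau> *\<^sub>R s) \<bullet> s)"
        by (simp add: fun_eq_iff algebra_simps)
      ultimately show ?thesis unfolding has_field_derivative_def df_def 1 by simp
    next
      case 2
      have "((\<lambda>\<tau>. g (x + (1 * \<tau>) *\<^sub>R s) \<bullet> s - g (x + (-1 * \<tau>) *\<^sub>R s) \<bullet> s) has_derivative
         (\<lambda>k. (H (x + (1 * \<tau>) *\<^sub>R s) *v ((1 * k) *\<^sub>R s)) \<bullet> s - (H (x + (-1 * \<tau>) *\<^sub>R s) *v ((-1 * k) *\<^sub>R s)) \<bullet> s)) (at \<tau>)"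
        using that by (intro has_derivative_diff has_derivative_inner_left dg) auto
      moreover have "(\<lambda>k. (H (x + (1 * \<tau>) *\<^sub>R s) *v ((1 * k) *\<^sub>R s)) \<bullet> s - (H (x + (-1 * \<tau>) *\<^sub>R s) *v ((-1 * k) *\<^sub>R s)) \<bullet> s) =
          (*) (s \<bullet> (H (x + \<tau> *\<^sub>R s) *v s) + s \<bullet> (H (x - \<tau> *\<^sub>R s) *v s))"
      proof
        fix k
        have "H y *v ((c * k) *\<^sub>R s) = (c * k) *\<^sub>R (H y *v s)" for y c by (rule matrix_vector_mult_scaleR)
        thus "(H (x + (1 * \<tau>) *\<^sub>R s) *v ((1 * k) *\<^sub>R s)) \<bullet> s - (H (x + (-1 * \<tau>) *\<^sub>R s) *v ((-1 * k) *\<^sub>R s)) \<bullet> s =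
          (s \<bullet> (H (x + \<tau> *\<^sub>R s) *v s) + s \<bullet> (H (x - \<tau> *\<^sub>R s) *v s)) * k"
          by (simp only: inner_scaleR_left) (simp add: inner_commute distrib_right)
      qed
      ultimately show ?thesis unfolding has_field_derivative_def df_def 2 by simp
    qed
  qed
  obtain \<tau> where "0 < \<tau>" "\<tau> < t"
    "df 0 t = (\<Sum>m<2. (df m 0 / fact m) * t ^ m) + (df 2 \<tau> / fact 2) * t ^ 2"
    using Maclaurin[OF t(1), of 2 df "df 0"] D by auto
  thus ?thesis using that[of \<tau>] by (simp add: df_def numeral_2_eq_2 algebra_simps)
qed

lemma C2_local_min_imp_nonneg:
  assumes C: "C2_on_ball \<phi> x e g H" and e: "e > 0" and min: "\<And>y. y \<in> ball x e \<Longrightarrow> \<phi> x \<le> \<phi> y"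
  shows "0 \<le> s \<bullet> (H x *v s)"
proof (rule ccontr)
  assume neg: "\<not> 0 \<le> s \<bullet> (H x *v s)"
  have "continuous_on (ball x e) (\<lambda>y. s \<bullet> (H y *v s))"
    using C unfolding C2_on_ball_def
    by (intro continuous_intros continuous_on_compose2[OF continuous_on_matrix_vector_mult_left[of UNIV s]]) auto
  hence "isCont (\<lambda>y. s \<bullet> (H y *v s)) x"
    using e by (simp add: continuous_on_eq_continuous_at)
  hence "\<forall>\<^sub>F y in at x. s \<bullet> (H y *v s) < 0"
    using neg by (intro order_tendstoD(2)[of _ "s \<bullet> (H x *v s)"]) (auto simp: isCont_def)
  then obtain d where d: "d > 0" "\<And>y. dist y x < d \<Longrightarrow> s \<bullet> (H y *v s) < 0"
    using neg unfolding eventually_at by (metis UNIV_I not_le)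
  define r where "r = min d e / 2"
  define t where "t = r / (norm s + 1)"
  have pos: "norm s + 1 > 0" using norm_ge_zero[of s] by linarith
  have r: "r > 0" "r < d" "r < e" using d e by (auto simp: r_def)
  have t: "t > 0" using r pos by (simp add: t_def)
  have tn: "t * norm s \<le> r" using r pos by (simp add: t_def field_simps)
  obtain \<tau> where \<tau>: "0 < \<tau>" "\<tau> < t"
    "\<phi> (x + t *\<^sub>R s) + \<phi> (x - t *\<^sub>R s) - 2 * \<phi> x =
      t\<^sup>2 / 2 * (s \<bullet> (H (x + \<tau> *\<^sub>R s) *v s) + s \<bullet> (H (x - \<tau> *\<^sub>R s) *v s))"
    using C2_second_difference[OF C t, of s] tn r by auto
  have "\<tau> * norm s \<le> t * norm s" using \<tau> by (intro mult_right_mono) auto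
  hence "s \<bullet> (H (x + \<tau> *\<^sub>R s) *v s) < 0" "s \<bullet> (H (x - \<tau> *\<^sub>R s) *v s) < 0"
    using tn r \<tau> by (auto intro!: d(2) simp: dist_norm)
  hence "\<phi> (x + t *\<^sub>R s) + \<phi> (x - t *\<^sub>R s) - 2 * \<phi> x < 0"
    unfolding \<tau>(3) using t by (intro mult_pos_neg) auto
  moreover have "\<phi> x \<le> \<phi> (x + t *\<^sub>R s)" "\<phi> x \<le> \<phi> (x - t *\<^sub>R s)"
    using tn r t by (auto intro!: min simp: dist_norm)
  ultimately show False by linarith
qed

text \<open>One step of the random walk that moves by \<open>\<plusminus>t\<close> times a random column of \<open>S\<close>; its generator is
  \<open>t\<^sup>2 / 2N\<close> times the constant-coefficient operator \<open>\<phi> \<mapsto> quad_sum S (D\<^sup>2\<phi>)\<close>.\<close>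

definition walk :: "real^'n^'n \<Rightarrow> real \<Rightarrow> (real^'n \<Rightarrow> 'b::real_vector) \<Rightarrow> real^'n \<Rightarrow> 'b" where
  "walk S t \<phi> x = (1 / (2 * real CARD('n))) *\<^sub>R
     (\<Sum>i\<in>UNIV. \<phi> (x + t *\<^sub>R column i S) + \<phi> (x + (- t) *\<^sub>R column i S))"

text \<open>\<open>walk\<close> is polymorphic in its values for this purpose: it also acts on
  vector fields and matrix fields, and so commutes with taking gradients and Hessians.\<close>

lemma C2_walk: "C2 \<phi> g H \<Longrightarrow> C2 (walk S t \<phi>) (walk S t g) (walk S t H)"
  unfolding walk_def[abs_def] by (intro C2_scaleR C2_sum C2_add C2_shift)

lemma C2_walks: "C2 \<phi> g H \<Longrightarrow> C2 ((walk S t ^^ n) \<phi>) ((walk S t ^^ n) g) ((walk S t ^^ n) H)"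
  by (induction n) (auto intro: C2_walk)

lemma walk_linear: "linear f \<Longrightarrow> f (walk S t \<phi> x) = walk S t (\<lambda>y. f (\<phi> y)) x"
  by (simp add: walk_def linear_cmul linear_sum linear_add)

text \<open>Used with f = \<open>quad_sum S\<close>: the operator applied to the Hessian of an
  iterate is the iterate of a scalar function.\<close>

lemma walks_linear: "linear f \<Longrightarrow> f ((walk S t ^^ n) \<phi> x) = (walk S t ^^ n) (\<lambda>y. f (\<phi> y)) x"
proof (induction n arbitrary: x)
  case (Suc n)
  have "f ((walk S t ^^ Suc n) \<phi> x) = walk S t (\<lambda>y. f ((walk S t ^^ n) \<phi> y)) x"
    using walk_linear[OF Suc.prems] by simp
  thus ?case using Suc by simp
qed simp

lemma walk_mono: "(\<And>y. \<phi> y \<le> (\<psi> y :: real)) \<Longrightarrow> walk S t \<phi> x \<le> walk S t \<psi> x"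
  unfolding walk_def by (intro scaleR_left_mono sum_mono add_mono) auto

lemma walks_mono: "(\<And>y. \<phi> y \<le> (\<psi> y :: real)) \<Longrightarrow> (walk S t ^^ n) \<phi> x \<le> (walk S t ^^ n) \<psi> x"
  by (induction n arbitrary: x) (auto intro: walk_mono)

lemma walk_affine: "walk S t (\<lambda>y. a * \<phi> y + b) x = a * walk S t \<phi> x + (b::real)"
  by (simp add: walk_def sum.distrib sum_distrib_left sum_divide_distrib divide_simps algebra_simps)

lemma walks_affine: "(walk S t ^^ n) (\<lambda>y. a * \<phi> y + b) x = a * (walk S t ^^ n) \<phi> x + (b::real)"
proof (induction n arbitrary: x)
  case (Suc n)
  have "(walk S t ^^ n) (\<lambda>y. a * \<phi> y + b) = (\<lambda>x. a * (walk S t ^^ n) \<phi> x + b)" using Suc by blast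
  thus ?case by (simp add: walk_affine)
qed simp

lemma walk_diff: "walk S t (\<lambda>y. \<phi> y - \<psi> y) x = walk S t \<phi> x - (walk S t \<psi> x :: real)"
  by (simp add: walk_def sum_subtractf sum.distrib algebra_simps)

lemma walks_diff: "(walk S t ^^ n) (\<lambda>y. \<phi> y - \<psi> y) x = (walk S t ^^ n) \<phi> x - ((walk S t ^^ n) \<psi> x :: real)"
proof (induction n arbitrary: x)
  case (Suc n)
  have "(walk S t ^^ n) (\<lambda>y. \<phi> y - \<psi> y) = (\<lambda>x. (walk S t ^^ n) \<phi> x - (walk S t ^^ n) \<psi> x)" using Suc by blast
  thus ?case by (simp add: walk_diff)
qed simp

lemma walks_Suc_right: "(walk S t ^^ Suc n) \<phi> = (walk S t ^^ n) (walk S t \<phi>)"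
  by (simp add: funpow_swap1)

lemma walk_square:
  "walk S t (\<lambda>y. (y - x) \<bullet> (y - x)) y = (y - x) \<bullet> (y - x) + t\<^sup>2 * (quad_sum S (mat 1) / CARD('n))"
  for S :: "real^'n^'n"
proof -
  have "(y + c *\<^sub>R s - x) \<bullet> (y + c *\<^sub>R s - x) = (y - x) \<bullet> (y - x) + 2 * c * ((y - x) \<bullet> s) + c\<^sup>2 * (s \<bullet> s)" for c and s :: "real^'n"
    by (simp add: inner_diff_left inner_diff_right inner_add_left inner_add_right inner_commute algebra_simps power2_eq_square)
  hence "walk S t (\<lambda>y. (y - x) \<bullet> (y - x)) y =
      (\<Sum>i\<in>UNIV. 2 * ((y - x) \<bullet> (y - x)) + 2 * (t\<^sup>2 * (column i S \<bullet> column i S))) / (2 * real CARD('n))"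
    by (simp add: walk_def power2_eq_square algebra_simps)
  thus ?thesis
    by (simp add: quad_sum_def sum.distrib sum_distrib_left[symmetric] add_divide_distrib)
qed

text \<open>The second moment of the walk: each step adds its mean squared length. It bounds how far
  the walk spreads in a given time.\<close>

lemma walks_square:
  "(walk S t ^^ n) (\<lambda>y. (y - x) \<bullet> (y - x)) y = (y - x) \<bullet> (y - x) + n * (t\<^sup>2 * (quad_sum S (mat 1) / CARD('n)))"
  for S :: "real^'n^'n"
proof (induction n arbitrary: y)
  case (Suc n)
  have "(walk S t ^^ n) (\<lambda>y. (y - x) \<bullet> (y - x)) = (\<lambda>y. 1 * ((y - x) \<bullet> (y - x)) + n * (t\<^sup>2 * (quad_sum S (mat 1) / CARD('n))))" using Suc by auto
  hence "(walk S t ^^ Suc n) (\<lambda>y. (y - x) \<bullet> (y - x)) y = 1 * walk S t (\<lambda>y. (y - x) \<bullet> (y - x)) y + n * (t\<^sup>2 * (quad_sum S (mat 1) / CARD('n)))"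
    by (simp only: funpow.simps o_apply walk_affine)
  thus ?case unfolding walk_square by (simp add: distrib_right add_divide_distrib)
qed simp

section \<open>Continuous functions of bounded support\<close>

lemma continuous_on_walk:
  fixes \<phi> :: "real^'n \<Rightarrow> 'b::real_normed_vector"
  assumes "continuous_on UNIV \<phi>" shows "continuous_on UNIV (walk S t \<phi>)"
  unfolding walk_def[abs_def]
  by (intro continuous_intros continuous_on_compose2[OF assms]) auto

lemma continuous_on_walks:
  fixes \<phi> :: "real^'n \<Rightarrow> 'b::real_normed_vector"
  assumes "continuous_on UNIV \<phi>" shows "continuous_on UNIV ((walk S t ^^ n) \<phi>)"
  using assms by (induction n) (auto intro: continuous_on_walk)

lemma bounded_support_walk:
  fixes \<phi> :: "real^'n \<Rightarrow> 'b::real_vector"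
  assumes "bounded {x. \<phi> x \<noteq> 0}" shows "bounded {x. walk S t \<phi> x \<noteq> 0}"
proof -
  have "{x. walk S t \<phi> x \<noteq> 0} \<subseteq> (\<Union>i. (+) (- (t *\<^sub>R column i S)) ` {x. \<phi> x \<noteq> 0} \<union> (+) (t *\<^sub>R column i S) ` {x. \<phi> x \<noteq> 0})"
  proof
    fix x assume "x \<in> {x. walk S t \<phi> x \<noteq> 0}"
    then obtain i where "\<phi> (x + t *\<^sub>R column i S) \<noteq> 0 \<or> \<phi> (x + (- t) *\<^sub>R column i S) \<noteq> 0"
      by (force simp: walk_def)
    thus "x \<in> (\<Union>i. (+) (- (t *\<^sub>R column i S)) ` {x. \<phi> x \<noteq> 0} \<union> (+) (t *\<^sub>R column i S) ` {x. \<phi> x \<noteq> 0})"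
      by (auto simp: image_iff intro!: exI[of _ i] intro: exI[of _ "x + t *\<^sub>R column i S"] exI[of _ "x - t *\<^sub>R column i S"])
  qed
  thus ?thesis
    using assms by (elim bounded_subset[rotated]) (auto intro!: bounded_UN bounded_translation bounded_translation_minus)
qed

lemma bounded_support_walks:
  fixes \<phi> :: "real^'n \<Rightarrow> 'b::real_vector"
  assumes "bounded {x. \<phi> x \<noteq> 0}" shows "bounded {x. (walk S t ^^ n) \<phi> x \<noteq> 0}"
  using assms by (induction n) (auto intro: bounded_support_walk)

lemma bounded_support_attains_max:
  fixes f :: "real^'n \<Rightarrow> real"
  assumes f: "continuous_on UNIV f" and b: "bounded {x. f x \<noteq> 0}"
  obtains x where "\<And>y. f y \<le> f x"
proof -
  obtain R where R: "\<And>x. f x \<noteq> 0 \<Longrightarrow> norm x \<le> R" using b by (auto simp: bounded_iff)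
  define R' where "R' = max R 0 + 1"
  have R'pos: "0 < R'" by (simp add: R'_def)
  have sub: "f x = 0" if "x \<notin> ball 0 R'" for x using R[of x] that by (fastforce simp: R'_def)
  have "continuous_on (cball 0 R') f" using f continuous_on_subset by blast
  then obtain x where x: "x \<in> cball 0 R'" "\<And>y. y \<in> cball 0 R' \<Longrightarrow> f y \<le> f x"
    using continuous_attains_sup[of "cball 0 R'" f] R'pos by (metis cball_eq_empty compact_cball not_less_iff_gr_or_eq)
  \<comment> \<open>A point of the ball at which f vanishes. It makes the maximum over the ball
    nonnegative, hence also at least the value 0 taken outside.\<close>
  let ?e = "R' *\<^sub>R axis undefined 1 :: real^'n"
  have "norm ?e = R'" using R'pos by (simp add: norm_axis_1)
  hence "f ?e = 0" "f ?e \<le> f x" by (auto intro!: sub x(2))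
  hence "f y \<le> f x" for y using x(2)[of y] sub[of y] by (cases "y \<in> cball 0 R'") auto
  thus ?thesis using that by blast
qed

lemma bounded_support_uniformly_continuous:
  fixes f :: "real^'n \<Rightarrow> real"
  assumes f: "continuous_on UNIV f" and b: "bounded {x. f x \<noteq> 0}" and e: "e > 0"
  obtains d where "d > 0" "\<And>x y. dist x y < d \<Longrightarrow> \<bar>f x - f y\<bar> < e"
proof -
  obtain R where R: "\<And>x. f x \<noteq> 0 \<Longrightarrow> norm x \<le> R" using b by (auto simp: bounded_iff)
  have "uniformly_continuous_on (cball 0 (R + 1)) f"
    by (intro compact_uniformly_continuous continuous_on_subset[OF f]) auto
  then obtain d where d: "d > 0" "\<And>x y. x \<in> cball 0 (R + 1) \<Longrightarrow> y \<in> cball 0 (R + 1) \<Longrightarrow> dist x y < d \<Longrightarrow> dist (f x) (f y) < e"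
    using e unfolding uniformly_continuous_on_def by (metis dist_commute)
  have "\<bar>f x - f y\<bar> < e" if xy: "dist x y < min d 1" for x y
  proof (cases "x \<in> cball 0 (R + 1) \<and> y \<in> cball 0 (R + 1)")
    case True
    thus ?thesis using d(2)[of x y] xy by (simp add: dist_real_def)
  next
    case False
    have "norm x \<le> norm y + dist x y" "norm y \<le> norm x + dist x y"
      using norm_triangle_ineq2[of x y] norm_triangle_ineq2[of y x] by (auto simp: dist_norm norm_minus_commute)
    hence "norm x > R" "norm y > R" using False xy by auto
    hence "f x = 0" "f y = 0" using R[of x] R[of y] by auto
    thus ?thesis using e by simp
  qed
  thus ?thesis using that[of "min d 1"] d by auto
qed

text \<open>Bounded support makes the second directional derivatives uniformly continuous, so d does
  not depend on x; only such a uniform estimate can be iterated along the walk.\<close>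

lemma walk_Taylor:
  fixes S :: "real^'n^'n"
  assumes C: "C2 \<phi> g H" and b: "bounded {x. H x \<noteq> 0}" and e: "e > 0"
  obtains d where "d > 0"
    "\<And>t x. 0 < t \<Longrightarrow> t < d \<Longrightarrow> \<bar>walk S t \<phi> x - \<phi> x - t\<^sup>2 / (2 * real CARD('n)) * quad_sum S (H x)\<bar> \<le> t\<^sup>2 / (2 * real CARD('n)) * e"
    "\<And>t x. 0 < t \<Longrightarrow> t < d \<Longrightarrow> \<bar>walk S t (\<lambda>y. quad_sum S (H y)) x - quad_sum S (H x)\<bar> \<le> e"
proof -
  let ?N = "real CARD('n)"
  define q where "q = (\<lambda>i y. column i S \<bullet> (H y *v column i S))"
  have cont: "continuous_on UNIV (q i)" for i
    using C unfolding C2_def q_def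
    by (intro continuous_intros continuous_on_compose2[OF continuous_on_matrix_vector_mult_left[of UNIV]]) auto
  have bnd: "bounded {x. q i x \<noteq> 0}" for i
    by (rule bounded_subset[OF b]) (auto simp: q_def)
  have "\<exists>d>0. \<forall>x y. dist x y < d \<longrightarrow> \<bar>q i x - q i y\<bar> < e / ?N" for i
    by (rule bounded_support_uniformly_continuous[OF cont[of i] bnd[of i], of "e / ?N"]) (use e in auto)
  then obtain d where d: "\<And>i. d i > 0" "\<And>i x y. dist x y < d i \<Longrightarrow> \<bar>q i x - q i y\<bar> < e / ?N"
    by metis
  \<comment> \<open>L bounds all column lengths, so for t < D a single step stays within the modulus
    d j of every column.\<close>
  define L where "L = (\<Sum>i\<in>UNIV. norm (column i S)) + 1"
  have Lc: "norm (column i S) \<le> L" for i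
    using member_le_sum[of i UNIV "\<lambda>i. norm (column i S)"] by (simp add: L_def)
  have Lpos: "L > 0" by (simp add: L_def add_nonneg_pos sum_nonneg)
  define D where "D = Min (range d) / L"
  have Dpos: "D > 0" using d Lpos by (simp add: D_def)
  have close: "\<bar>q j (x + \<sigma> *\<^sub>R column i S) - q j x\<bar> \<le> e / ?N" if "\<bar>\<sigma>\<bar> < D" for \<sigma> x i j
  proof -
    have "\<bar>\<sigma>\<bar> * norm (column i S) \<le> \<bar>\<sigma>\<bar> * L" by (intro mult_left_mono Lc) auto
    also have "\<dots> < D * L" using that Lpos by (intro mult_strict_right_mono) auto
    also have "\<dots> = Min (range d)" using Lpos by (simp add: D_def)
    also have "\<dots> \<le> d j" by simp
    finally show ?thesis using d(2)[of "x + \<sigma> *\<^sub>R column i S" x j] by (simp add: dist_norm less_imp_le)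
  qed
  have qs: "quad_sum S (H y) = (\<Sum>i\<in>UNIV. q i y)" for y by (simp add: quad_sum_def q_def)
  show ?thesis
  proof (rule that[of D])
    fix t :: real and x :: "real^'n" assume t: "0 < t" "t < D"
    define \<Delta> where "\<Delta> = (\<lambda>i. \<phi> (x + t *\<^sub>R column i S) + \<phi> (x + (- t) *\<^sub>R column i S) - 2 * \<phi> x)"
    have mean: "\<bar>(a + b) / 2 - c\<bar> \<le> E" if "\<bar>a - c\<bar> \<le> E" "\<bar>b - c\<bar> \<le> E" for a b c E :: real
      using that by (auto simp: abs_le_iff field_simps)
    have each: "\<bar>\<Delta> i - t\<^sup>2 * q i x\<bar> \<le> t\<^sup>2 * (e / ?N)" for i
    proof -
      obtain \<tau> where \<tau>: "0 < \<tau>" "\<tau> < t" "\<Delta> i = t\<^sup>2 / 2 * (q i (x + \<tau> *\<^sub>R column i S) + q i (x - \<tau> *\<^sub>R column i S))"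
        using C2_second_difference[OF C2_imp_C2_on_ball[OF C, of x "t * norm (column i S) + 1"] t(1), of "column i S"]
        by (auto simp: \<Delta>_def q_def)
      have "\<bar>q i (x + \<tau> *\<^sub>R column i S) - q i x\<bar> \<le> e / ?N" "\<bar>q i (x - \<tau> *\<^sub>R column i S) - q i x\<bar> \<le> e / ?N"
        using close[of \<tau> i x i] close[of "-\<tau>" i x i] \<tau> t by auto
      hence "\<bar>(q i (x + \<tau> *\<^sub>R column i S) + q i (x - \<tau> *\<^sub>R column i S)) / 2 - q i x\<bar> \<le> e / ?N" by (rule mean)
      hence "t\<^sup>2 * \<bar>(q i (x + \<tau> *\<^sub>R column i S) + q i (x - \<tau> *\<^sub>R column i S)) / 2 - q i x\<bar> \<le> t\<^sup>2 * (e / ?N)"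
        by (intro mult_left_mono) auto
      moreover have "\<Delta> i - t\<^sup>2 * q i x = t\<^sup>2 * ((q i (x + \<tau> *\<^sub>R column i S) + q i (x - \<tau> *\<^sub>R column i S)) / 2 - q i x)"
        unfolding \<tau>(3) by (simp add: algebra_simps)
      ultimately show ?thesis by (simp add: abs_mult)
    qed
    have "walk S t \<phi> x - \<phi> x - t\<^sup>2 / (2 * ?N) * quad_sum S (H x) = (\<Sum>i\<in>UNIV. \<Delta> i - t\<^sup>2 * q i x) / (2 * ?N)"
      by (simp add: walk_def \<Delta>_def qs sum_subtractf sum_distrib_left diff_divide_distrib sum_divide_distrib)
    moreover have "\<bar>\<Sum>i\<in>UNIV. \<Delta> i - t\<^sup>2 * q i x\<bar> \<le> (\<Sum>i\<in>(UNIV::'n set). t\<^sup>2 * (e / ?N))"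
      using each by (intro order_trans[OF sum_abs] sum_mono) auto
    ultimately show "\<bar>walk S t \<phi> x - \<phi> x - t\<^sup>2 / (2 * ?N) * quad_sum S (H x)\<bar> \<le> t\<^sup>2 / (2 * ?N) * e"
      by (simp add: divide_right_mono)
    have "\<bar>quad_sum S (H (x + \<sigma> *\<^sub>R column i S)) - quad_sum S (H x)\<bar> \<le> e" if "\<bar>\<sigma>\<bar> < D" for \<sigma> i
    proof -
      have "\<bar>\<Sum>j\<in>UNIV. q j (x + \<sigma> *\<^sub>R column i S) - q j x\<bar> \<le> (\<Sum>j\<in>(UNIV::'n set). e / ?N)"
        using close[OF that] by (intro order_trans[OF sum_abs] sum_mono) auto
      thus ?thesis by (simp add: qs sum_subtractf)
    qed
    note * = this
    define X where "X = (\<Sum>i\<in>UNIV. (quad_sum S (H (x + t *\<^sub>R column i S)) - quad_sum S (H x)) +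
          (quad_sum S (H (x + (-t) *\<^sub>R column i S)) - quad_sum S (H x)))"
    have eq: "walk S t (\<lambda>y. quad_sum S (H y)) x - quad_sum S (H x) = X / (2 * ?N)"
      by (simp add: X_def walk_def sum_subtractf sum.distrib field_simps)
    have "\<bar>X\<bar> \<le> (\<Sum>i\<in>(UNIV::'n set). e + e)"
      unfolding X_def
      using t by (intro order_trans[OF sum_abs] sum_mono order_trans[OF abs_triangle_ineq] add_mono *) auto
    thus "\<bar>walk S t (\<lambda>y. quad_sum S (H y)) x - quad_sum S (H x)\<bar> \<le> e"
      unfolding eq by (simp add: field_simps)
  qed (rule Dpos)
qed

section \<open>Mollification\<close>

text \<open>Only s = 0 is delicate: there the difference quotient is bounded by
  \<open>\<bar>h\<bar> ^ (n - 1)\<close>, which tends to 0 for n \<ge> 2.\<close>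

lemma max_zero_power_has_derivative:
  assumes "2 \<le> n"
  shows "((\<lambda>s. (max 0 s) ^ n) has_field_derivative n * (max 0 s) ^ (n - 1)) (at (s::real))"
proof -
  consider "s > 0" | "s < 0" | "s = 0" by linarith
  thus ?thesis
  proof cases
    case 1
    have "((\<lambda>s. s ^ n) has_field_derivative n * (max 0 s) ^ (n - 1)) (at s)"
      using 1 by (auto intro!: derivative_eq_intros)
    moreover have "\<forall>\<^sub>F t in nhds s. max 0 t ^ n = t ^ n"
      using eventually_nhds_in_open[of "{0<..}" s] 1 by (auto elim!: eventually_mono)
    ultimately show ?thesis by (subst DERIV_cong_ev[OF refl _ refl]) auto
  next
    case 2
    have "n * (max 0 s) ^ (n - 1) = 0" using 2 assms by (simp add: power_0_left)
    hence "((\<lambda>s. 0) has_field_derivative n * (max 0 s) ^ (n - 1)) (at s)" by (simp only: DERIV_const)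
    moreover have "\<forall>\<^sub>F t in nhds s. max 0 t ^ n = 0"
      using eventually_nhds_in_open[of "{..<0}" s] 2 assms by (auto elim!: eventually_mono)
    ultimately show ?thesis by (subst DERIV_cong_ev[OF refl _ refl]) auto
  next
    case 3
    have lim: "((\<lambda>h::real. \<bar>h\<bar> ^ (n - 1)) \<longlongrightarrow> 0) (at 0)"
      using assms by (intro tendsto_null_power tendsto_rabs_zero tendsto_ident_at) auto
    have "((\<lambda>h::real. max 0 h ^ n / h) \<longlongrightarrow> 0) (at 0)"
    proof (rule Lim_null_comparison[OF _ lim])
      have "norm (max 0 h ^ n / h) \<le> \<bar>h\<bar> ^ (n - 1)" for h :: real
        using assms by (cases n) (auto simp: max_def)
      thus "\<forall>\<^sub>F h in at 0. norm (max 0 h ^ n / h) \<le> \<bar>h\<bar> ^ (n - 1)" for h :: real by simp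
    qed
    thus ?thesis using 3 assms by (simp add: DERIV_def power_0_left)
  qed
qed

text \<open>The exponent 3 is the least integer for which the truncated power is twice continuously
  differentiable. The mass is normalised in \<open>mollify\<close>.\<close>

definition bump :: "real \<Rightarrow> real^'n \<Rightarrow> real" where
  "bump \<delta> z = (max 0 (\<delta>\<^sup>2 - z \<bullet> z)) ^ 3"

definition bump_grad :: "real \<Rightarrow> real^'n \<Rightarrow> real^'n" where
  "bump_grad \<delta> z = (- 6 * (max 0 (\<delta>\<^sup>2 - z \<bullet> z))\<^sup>2) *\<^sub>R z"

definition bump_hess :: "real \<Rightarrow> real^'n \<Rightarrow> real^'n^'n" where
  "bump_hess \<delta> z = (\<chi> i. (24 * max 0 (\<delta>\<^sup>2 - z \<bullet> z) * z $ i) *\<^sub>R z - (6 * (max 0 (\<delta>\<^sup>2 - z \<bullet> z))\<^sup>2) *\<^sub>R axis i 1)"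

lemma bump_inner_has_derivative:
  "((\<lambda>z::real^'n. \<delta>\<^sup>2 - z \<bullet> z) has_derivative (\<lambda>k. - 2 * (z \<bullet> k))) (at z)"
  by (auto intro!: derivative_eq_intros simp: inner_commute)

lemma max_zero_power_compose_has_derivative:
  assumes "2 \<le> n"
  shows "((\<lambda>z::real^'n. (max 0 (\<delta>\<^sup>2 - z \<bullet> z)) ^ n) has_derivative
    (\<lambda>k. n * (max 0 (\<delta>\<^sup>2 - z \<bullet> z)) ^ (n - 1) * (- 2 * (z \<bullet> k)))) (at z)"
  using has_derivative_compose[OF bump_inner_has_derivative
      max_zero_power_has_derivative[OF assms, unfolded has_field_derivative_def]] .

lemma bump_has_derivative: "(bump \<delta> has_derivative (\<lambda>k. bump_grad \<delta> z \<bullet> k)) (at z)"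
  using max_zero_power_compose_has_derivative[of 3 \<delta> z]
  by (simp add: bump_def[abs_def] bump_grad_def mult_ac)

text \<open>Stated by components, since \<open>convolution_has_derivative\<close> treats scalar
  kernels and is applied to each component of the gradient.\<close>

lemma bump_grad_has_derivative:
  "((\<lambda>z. bump_grad \<delta> z $ i) has_derivative (\<lambda>k. bump_hess \<delta> z $ i \<bullet> k)) (at (z::real^'n))"
proof -
  have nth: "((\<lambda>z::real^'n. z $ i) has_derivative (\<lambda>k. k $ i)) (at z)"
    by (rule bounded_linear_imp_has_derivative) (rule bounded_linear_vec_nth)
  define m where "m = (\<lambda>z::real^'n. max 0 (\<delta>\<^sup>2 - z \<bullet> z))"
  have d: "((\<lambda>z. (m z)\<^sup>2) has_derivative (\<lambda>k. 2 * m z * (- 2 * (z \<bullet> k)))) (at z)"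
    using max_zero_power_compose_has_derivative[of 2 \<delta> z] by (simp add: m_def)
  have "((\<lambda>z. (- 6 * (m z)\<^sup>2) * z $ i) has_derivative
      (\<lambda>k. (- 6 * (m z)\<^sup>2) * k $ i + (- 6 * (2 * m z * (- 2 * (z \<bullet> k)))) * z $ i)) (at z)"
    by (rule has_derivative_mult[OF has_derivative_mult_right[OF d] nth])
  moreover have "(\<lambda>k. (- 6 * (m z)\<^sup>2) * k $ i + (- 6 * (2 * m z * (- 2 * (z \<bullet> k)))) * z $ i) =
      (\<lambda>k. bump_hess \<delta> z $ i \<bullet> k)"
    by (simp add: fun_eq_iff bump_hess_def m_def inner_diff_left inner_axis')
  ultimately show ?thesis unfolding bump_grad_def by (simp add: m_def)
qed

lemma continuous_on_bump: "continuous_on S (bump \<delta>)"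
  unfolding bump_def[abs_def] by (intro continuous_intros)

lemma continuous_on_bump_grad: "continuous_on S (bump_grad \<delta>)"
  unfolding bump_grad_def[abs_def] by (intro continuous_intros)

lemma continuous_on_bump_hess: "continuous_on S (\<lambda>z. bump_hess \<delta> z)"
  unfolding bump_hess_def by (intro continuous_on_vec_lambda continuous_intros)

lemma bump_nonneg: "0 \<le> bump \<delta> z" by (simp add: bump_def)

lemma bump_outside:
  assumes "0 < \<delta>" "\<delta> \<le> norm z" shows "bump \<delta> z = 0" "bump_hess \<delta> z = 0"
proof -
  have "\<delta>\<^sup>2 \<le> (norm z)\<^sup>2" using assms by (intro power_mono) auto
  thus "bump \<delta> z = 0" "bump_hess \<delta> z = 0"
    by (auto simp: bump_def bump_hess_def dot_square_norm vec_eq_iff)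
qed

text \<open>Leibniz's rule with all derivatives on the kernel \<phi>, so that g may be merely
  continuous. \<open>blinfun_inner_right\<close> turns the linear map given by a gradient into a
  value that can be integrated.\<close>

lemma convolution_has_derivative:
  fixes \<phi> g :: "real^'n \<Rightarrow> real"
  assumes d: "\<And>x. (\<phi> has_derivative (\<lambda>k. d x \<bullet> k)) (at x)" and cd: "continuous_on UNIV d"
    and cg: "continuous_on UNIV g"
  shows "((\<lambda>x. integral (cbox a b) (\<lambda>t. g t * \<phi> (x - t))) has_derivative
     (\<lambda>k. integral (cbox a b) (\<lambda>t. g t *\<^sub>R d (x - t)) \<bullet> k)) (at x)"
proof -
  have c\<phi>: "continuous_on UNIV \<phi>"
    using d by (auto intro!: continuous_at_imp_continuous_on has_derivative_continuous)
  have c: "continuous_on (cbox a b) (\<lambda>t. g t *\<^sub>R d (x - t))"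
    by (intro continuous_intros continuous_on_compose2[OF cd] continuous_on_compose2[OF cg]) auto
  have "((\<lambda>x. integral (cbox a b) (\<lambda>t. g t * \<phi> (x - t))) has_derivative
     integral (cbox a b) (\<lambda>t. blinfun_inner_right (g t *\<^sub>R d (x - t)))) (at x within UNIV)"
  proof (rule leibniz_rule)
    fix x t
    have "((\<lambda>x. \<phi> (x + (- t))) has_derivative (\<lambda>k. d (x + (- t)) \<bullet> k)) (at x)"
      by (rule has_derivative_shift[OF d])
    hence "((\<lambda>x. \<phi> (x - t)) has_derivative (\<lambda>k. d (x - t) \<bullet> k)) (at x)" by simp
    from has_derivative_mult_right[OF this, of "g t"]
    have "((\<lambda>x. g t * \<phi> (x - t)) has_derivative (\<lambda>k. g t * (d (x - t) \<bullet> k))) (at x)" .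
    moreover have "(\<lambda>k. g t * (d (x - t) \<bullet> k)) = blinfun_apply (blinfun_inner_right (g t *\<^sub>R d (x - t)))"
      by (simp add: blinfun_inner_right.rep_eq fun_eq_iff)
    ultimately show "((\<lambda>x. g t * \<phi> (x - t)) has_derivative blinfun_apply (blinfun_inner_right (g t *\<^sub>R d (x - t)))) (at x)"
      by simp
    show "(\<lambda>t. g t * \<phi> (x - t)) integrable_on cbox a b"
      by (intro integrable_continuous continuous_intros continuous_on_compose2[OF c\<phi>] continuous_on_compose2[OF cg]) auto
  next
    show "continuous_on (UNIV \<times> cbox a b) (\<lambda>(x, t). blinfun_inner_right (g t *\<^sub>R d (x - t)))"
      unfolding case_prod_unfold
      by (intro bounded_linear.continuous_on[OF bounded_linear_blinfun_inner_right] continuous_intros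
          continuous_on_compose2[OF cd] continuous_on_compose2[OF cg]) auto
  qed auto
  moreover have "integral (cbox a b) (\<lambda>t. blinfun_inner_right (g t *\<^sub>R d (x - t))) =
      blinfun_inner_right (integral (cbox a b) (\<lambda>t. g t *\<^sub>R d (x - t)))"
    using integral_linear[OF integrable_continuous[OF c] bounded_linear_blinfun_inner_right]
    by (simp add: o_def)
  ultimately show ?thesis by (simp add: blinfun_inner_right.rep_eq)
qed

text \<open>The support of \<open>bump \<delta>\<close> is a ball; the enclosing box makes every
  integral one of a continuous function over a \<open>cbox\<close>.\<close>

definition bump_box :: "real \<Rightarrow> (real^'n) set" where
  "bump_box \<delta> = cbox (- (\<chi> i. \<delta>)) (\<chi> i. \<delta>)"

definition mollify :: "real \<Rightarrow> (real^'n \<Rightarrow> real) \<Rightarrow> real^'n \<Rightarrow> real" where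
  "mollify \<delta> g x = integral (bump_box \<delta>) (\<lambda>z. bump \<delta> z * g (x - z)) / integral (bump_box \<delta>) (bump \<delta> :: real^'n \<Rightarrow> real)"

lemma mem_bump_box: "norm z \<le> \<delta> \<Longrightarrow> z \<in> bump_box \<delta>"
  unfolding bump_box_def mem_box_cart
proof
  fix i assume "norm z \<le> \<delta>"
  hence "\<bar>z $ i\<bar> \<le> \<delta>" using component_le_norm_cart[of z i] by linarith
  thus "(- (\<chi> i. \<delta>)) $ i \<le> z $ i \<and> z $ i \<le> (\<chi> i. \<delta>) $ i" by auto
qed

lemma integral_bump_pos:
  assumes "0 < \<delta>" shows "0 < integral (bump_box \<delta>) (bump \<delta> :: real^'n \<Rightarrow> real)"
proof -
  let ?b = "bump \<delta> :: real^'n \<Rightarrow> real"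
  have int: "?b integrable_on bump_box \<delta>"
    unfolding bump_box_def by (intro integrable_continuous continuous_on_bump)
  have "integral (bump_box \<delta>) ?b \<noteq> 0"
  proof
    assume "integral (bump_box \<delta>) ?b = 0"
    hence "(?b has_integral 0) (cbox (- (\<chi> i. \<delta>)) (\<chi> i. \<delta>))"
      using int unfolding bump_box_def by (metis has_integral_integral)
    moreover have "(0::real^'n) \<in> box (- (\<chi> i. \<delta>)) (\<chi> i. \<delta>)" using assms by (simp add: mem_box_cart)
    ultimately have "?b 0 = 0"
      by (intro has_integral_0_cbox_imp_0[OF continuous_on_bump bump_nonneg])
        (auto intro: subsetD[OF box_subset_cbox])
    thus False using assms by (simp add: bump_def)
  qed
  moreover have "integral (bump_box \<delta>) ?b \<ge> 0" by (intro integral_nonneg int bump_nonneg)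
  ultimately show ?thesis by simp
qed

lemma bump_mult_integrable:
  assumes "continuous_on UNIV g" shows "(\<lambda>z. bump \<delta> z * g (x - z)) integrable_on bump_box \<delta>"
  unfolding bump_box_def
  by (intro integrable_continuous continuous_intros continuous_on_bump continuous_on_compose2[OF assms]) auto

lemma mollify_local_mono:
  fixes \<phi> \<psi> :: "real^'n \<Rightarrow> real"
  assumes \<delta>: "0 < \<delta>" and c: "continuous_on UNIV \<phi>" "continuous_on UNIV \<psi>"
    and le: "\<And>y. dist y x < \<delta> \<Longrightarrow> \<phi> y \<le> \<psi> y"
  shows "mollify \<delta> \<phi> x \<le> mollify \<delta> \<psi> x"
  unfolding mollify_def
proof (intro divide_right_mono integral_le bump_mult_integrable c)
  fix z :: "real^'n"
  show "bump \<delta> z * \<phi> (x - z) \<le> bump \<delta> z * \<psi> (x - z)"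
  proof (cases "norm z < \<delta>")
    case True
    thus ?thesis by (intro mult_left_mono le bump_nonneg) (simp add: dist_norm)
  qed (use \<delta> bump_outside[of \<delta> z] in simp)
qed (use integral_bump_pos[OF \<delta>, where 'n = 'n] in \<open>simp add: less_imp_le\<close>)

section \<open>Mollification as a linear operator commuting with translations\<close>

lemma mollify_const: "0 < \<delta> \<Longrightarrow> mollify \<delta> (\<lambda>y. c) x = c"
  using integral_bump_pos[of \<delta>, where 'n='a] by (simp add: mollify_def)

lemma mollify_add:
  assumes "continuous_on UNIV \<phi>" "continuous_on UNIV \<psi>"
  shows "mollify \<delta> (\<lambda>y. \<phi> y + \<psi> y) x = mollify \<delta> \<phi> x + mollify \<delta> \<psi> x"
  using bump_mult_integrable[OF assms(1)] bump_mult_integrable[OF assms(2)]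
  by (simp add: mollify_def distrib_left integral_add add_divide_distrib)

lemma mollify_scale: "mollify \<delta> (\<lambda>y. c * \<phi> y) x = c * mollify \<delta> \<phi> x"
  by (simp add: mollify_def mult.left_commute)

lemma mollify_sum:
  assumes "\<And>i. i \<in> I \<Longrightarrow> continuous_on UNIV (\<phi> i)"
  shows "mollify \<delta> (\<lambda>y. \<Sum>i\<in>I. \<phi> i y) x = (\<Sum>i\<in>I. mollify \<delta> (\<phi> i) x)"
  using assms
proof (induction I rule: infinite_finite_induct)
  case (insert i I)
  thus ?case by (simp add: mollify_add continuous_on_sum)
qed (auto simp: mollify_def)

lemma mollify_shift: "mollify \<delta> (\<lambda>y. \<phi> (y + a)) x = mollify \<delta> \<phi> (x + a)"
  by (simp add: mollify_def algebra_simps)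

text \<open>A walk is a linear combination of translations, and convolution commutes with
  both.\<close>

lemma mollify_walk:
  assumes c: "continuous_on UNIV \<phi>"
  shows "mollify \<delta> (walk S t \<phi>) x = walk S t (mollify \<delta> \<phi>) x"
proof -
  have "continuous_on UNIV (\<lambda>y. \<phi> (y + a))" for a
    by (intro continuous_on_compose2[OF c] continuous_intros) auto
  note cs = this
  show ?thesis unfolding walk_def real_scaleR_def
    by (simp only: mollify_scale) (subst mollify_sum, auto intro!: continuous_on_add cs simp: mollify_add cs mollify_shift
      simp del: scaleR_minus_left add_uminus_conv_diff)
qed

lemma mollify_walks:
  assumes c: "continuous_on UNIV \<phi>"
  shows "mollify \<delta> ((walk S t ^^ n) \<phi>) x = (walk S t ^^ n) (mollify \<delta> \<phi>) x"
proof (induction n arbitrary: x)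
  case (Suc n)
  have "mollify \<delta> ((walk S t ^^ n) \<phi>) = (walk S t ^^ n) (mollify \<delta> \<phi>)" using Suc by blast
  thus ?case using mollify_walk[OF continuous_on_walks[OF c]] by simp
qed simp

text \<open>The substitution t = x - z moves x from g, which is only continuous, to the
  differentiable kernel. The integrand vanishes outside either box, so both integrals equal the one
  over the whole space.\<close>

lemma mollify_eq_convolution:
  assumes \<delta>: "0 < \<delta>" and c: "continuous_on UNIV g" and supp: "{x. g x \<noteq> 0} \<subseteq> cbox a b"
  shows "integral (bump_box \<delta>) (\<lambda>z. bump \<delta> z * g (x - z)) = integral (cbox a b) (\<lambda>t. g t * bump \<delta> (x - t))"
proof -
  define F where "F = (\<lambda>z. bump \<delta> z * g (x - z))"
  define I where "I = integral (bump_box \<delta>) F"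
  have F0: "F z = 0" if "z \<notin> bump_box \<delta>" for z
    using mem_bump_box[of z \<delta>] bump_outside[OF \<delta>, of z] that by (force simp: F_def)
  have "(F has_integral I) (cbox (- (\<chi> i. \<delta>)) (\<chi> i. \<delta>))"
    using bump_mult_integrable[OF c, of \<delta> x] unfolding F_def I_def bump_box_def by (rule integrable_integral)
  from has_integral_affinity[OF this, of "-1" x]
  have "((\<lambda>t. F (x - t)) has_integral I) ((\<lambda>z. x - z) ` bump_box \<delta>)"
    by (simp add: bump_box_def)
  hence "((\<lambda>t. F (x - t)) has_integral I) UNIV"
  proof (rule has_integral_on_superset)
    fix t assume "t \<notin> (\<lambda>z. x - z) ` bump_box \<delta>"
    hence "x - t \<notin> bump_box \<delta>" by (metis (no_types) add_diff_cancel_left' diff_add_cancel image_eqI)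
    thus "F (x - t) = 0" by (rule F0)
  qed simp
  moreover have "(\<lambda>t. F (x - t)) = (\<lambda>t. if t \<in> cbox a b then g t * bump \<delta> (x - t) else 0)"
    using supp by (auto simp: F_def fun_eq_iff)
  ultimately have "((\<lambda>t. g t * bump \<delta> (x - t)) has_integral I) (cbox a b)"
    by (simp add: has_integral_restrict_UNIV)
  thus ?thesis by (simp add: I_def F_def integral_unique)
qed

text \<open>The last property carries the argument: an inequality between g and its walk averages is
  preserved by averaging with a nonnegative kernel that commutes with walks. It is quantified over
  S, t, n and e because a single W must serve all of them.\<close>

lemma mollification:
  fixes g :: "real^'n \<Rightarrow> real"
  assumes c: "continuous_on UNIV g" and supp: "bounded {x. g x \<noteq> 0}" and \<delta>: "0 < \<delta>"
    and lip: "\<And>x y. \<bar>g x - g y\<bar> \<le> k * dist x y" and k: "0 \<le> k"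
  obtains W D H where "C2 W D H" "\<And>x. H x \<in> SymMat" "bounded {x. W x \<noteq> 0}" "bounded {x. H x \<noteq> 0}"
    "\<And>x. \<bar>W x - g x\<bar> \<le> k * \<delta>"
    "\<And>S t n e x. \<forall>y. g y \<le> (walk S t ^^ n) g y + e \<Longrightarrow> W x \<le> (walk S t ^^ n) W x + e"
proof -
  obtain a where ab: "{x. g x \<noteq> 0} \<subseteq> cbox (- a) a"
    using bounded_subset_cbox_symmetric[OF supp] by blast
  define C where "C = integral (bump_box \<delta>) (bump \<delta> :: real^'n \<Rightarrow> real)"
  have C: "C > 0" using integral_bump_pos[OF \<delta>] by (simp add: C_def)
  define D where "D = (\<lambda>x. integral (cbox (-a) a) (\<lambda>t. g t *\<^sub>R bump_grad \<delta> (x - t)))"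
  define H where "H = (\<lambda>x. \<chi> i. integral (cbox (-a) a) (\<lambda>t. g t *\<^sub>R bump_hess \<delta> (x - t) $ i))"
  have W: "mollify \<delta> g x = (1 / C) *\<^sub>R integral (cbox (-a) a) (\<lambda>t. g t * bump \<delta> (x - t))" for x
    unfolding mollify_def mollify_eq_convolution[OF \<delta> c ab] C_def[symmetric] by simp
  have cg': "continuous_on (cbox (-a) a) (\<lambda>t. g t *\<^sub>R bump_grad \<delta> (x - t))" for x
    by (intro continuous_intros continuous_on_compose2[OF c] continuous_on_compose2[OF continuous_on_bump_grad[of UNIV]]) auto
  have ch: "continuous_on UNIV (\<lambda>z. bump_hess \<delta> z $ i)" for i
    by (intro continuous_intros continuous_on_bump_hess)
  have "C2 (\<lambda>x. integral (cbox (-a) a) (\<lambda>t. g t * bump \<delta> (x - t))) D H"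
    unfolding C2_def
  proof (intro conjI allI)
    fix y
    show "((\<lambda>x. integral (cbox (-a) a) (\<lambda>t. g t * bump \<delta> (x - t))) has_derivative (\<lambda>k. D y \<bullet> k)) (at y)"
      unfolding D_def by (rule convolution_has_derivative[OF bump_has_derivative continuous_on_bump_grad c])
    have "((\<lambda>x. D x $ i) has_derivative (\<lambda>k. (H y *v k) $ i)) (at y)" for i
    proof -
      have "D x $ i = integral (cbox (-a) a) (\<lambda>t. g t * bump_grad \<delta> (x - t) $ i)" for x
        unfolding D_def using integral_component_eq_cart[OF integrable_continuous[OF cg'[of x]], where k = i] by simp
      moreover have "(H y *v k) $ i = integral (cbox (-a) a) (\<lambda>t. g t *\<^sub>R bump_hess \<delta> (y - t) $ i) \<bullet> k" for k
        by (simp add: H_def matrix_vector_mul_component)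
      ultimately show ?thesis
        using convolution_has_derivative[OF bump_grad_has_derivative[of \<delta> i] ch[of i] c] by simp
    qed
    hence "((\<lambda>x. D x \<bullet> b) has_derivative (\<lambda>k. (H y *v k) \<bullet> b)) (at y)" if "b \<in> Basis" for b
      using that by (auto simp: Basis_vec_def inner_axis)
    thus "(D has_derivative (\<lambda>k. H y *v k)) (at y)"
      by (subst has_derivative_componentwise_within) auto
  next
    show "continuous_on UNIV H"
      unfolding H_def case_prod_unfold
      by (intro continuous_on_vec_lambda integral_continuous_on_param, unfold case_prod_unfold,
          intro continuous_intros continuous_on_compose2[OF ch] continuous_on_compose2[OF c]) auto
  qed
  from C2_scaleR[OF this, of "1 / C"]
  have C2W: "C2 (mollify \<delta> g) (\<lambda>x. (1 / C) *\<^sub>R D x) (\<lambda>x. (1 / C) *\<^sub>R H x)"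
    unfolding W[abs_def] real_scaleR_def by (simp add: real_scaleR_def)
  have sym: "H x \<in> SymMat" for x
  proof -
    have "H x $ i $ j = integral (cbox (-a) a) (\<lambda>t. g t * bump_hess \<delta> (x - t) $ i $ j)" for i j
    proof -
      have "(\<lambda>t. g t *\<^sub>R bump_hess \<delta> (x - t) $ i) integrable_on cbox (-a) a"
        by (intro integrable_continuous continuous_intros continuous_on_compose2[OF ch] continuous_on_compose2[OF c]) auto
      from integral_component_eq_cart[OF this, where k = j] show ?thesis by (simp add: H_def)
    qed
    note ent = this
    have "bump_hess \<delta> z $ i $ j = bump_hess \<delta> z $ j $ i" for z :: "real^'n" and i j
      by (simp add: bump_hess_def axis_def)
    hence "H x $ i $ j = H x $ j $ i" for i j
      unfolding ent by (intro integral_cong) metis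
    thus ?thesis by (simp add: SymMat_def transpose_def vec_eq_iff)
  qed
  obtain B where B: "\<And>x. x \<in> cbox (-a) a \<Longrightarrow> norm x \<le> B"
    using bounded_cbox[of "-a" a] by (auto simp: bounded_iff)
  have far: "norm (x - t) \<ge> \<delta>" if "norm x > B + \<delta>" "t \<in> cbox (-a) a" for x t
    using norm_triangle_ineq2[of x t] B[OF that(2)] that(1) by linarith
  have W0: "mollify \<delta> g x = 0" "H x = 0" if "norm x > B + \<delta>" for x
  proof -
    have "integral (cbox (-a) a) (\<lambda>t. g t * bump \<delta> (x - t)) = 0"
      by (rule integral_eq_0_iff[THEN iffD2] integral_cong[THEN trans, of _ _ "\<lambda>_. 0"])
        (use bump_outside[OF \<delta> far[OF that]] in auto)
    thus "mollify \<delta> g x = 0" by (simp add: W)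
    have "integral (cbox (-a) a) (\<lambda>t. g t *\<^sub>R bump_hess \<delta> (x - t) $ i) = 0" for i
      by (rule integral_cong[THEN trans, of _ _ "\<lambda>_. 0"]) (use bump_outside[OF \<delta> far[OF that]] in auto)
    thus "H x = 0" by (simp add: H_def vec_eq_iff)
  qed
  have bW: "bounded {x. mollify \<delta> g x \<noteq> 0}" "bounded {x. (1 / C) *\<^sub>R H x \<noteq> 0}"
    using W0 by (auto simp: bounded_iff intro!: exI[of _ "B + \<delta>"] simp: not_less[symmetric])
  have close: "\<bar>mollify \<delta> g x - g x\<bar> \<le> k * \<delta>" for x
  proof -
    have lip': "\<bar>g y - g x\<bar> \<le> k * \<delta>" if "dist y x < \<delta>" for y
      using lip[of y x] mult_left_mono[of "dist y x" \<delta> k] k that by linarith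
    have "mollify \<delta> g x \<le> mollify \<delta> (\<lambda>_. g x + k * \<delta>) x" "mollify \<delta> (\<lambda>_. g x - k * \<delta>) x \<le> mollify \<delta> g x"
      by (rule mollify_local_mono[OF \<delta>]; use lip' c in \<open>fastforce intro: continuous_intros\<close>)+
    thus ?thesis using \<delta> by (simp add: mollify_const)
  qed
  have sub: "mollify \<delta> g x \<le> (walk S t ^^ n) (mollify \<delta> g) x + e"
    if "\<forall>y. g y \<le> (walk S t ^^ n) g y + e" for S t n e x
  proof -
    have "mollify \<delta> g x \<le> mollify \<delta> (\<lambda>x. (walk S t ^^ n) g x + e) x"
      by (rule mollify_local_mono[OF \<delta> c]) (auto intro!: continuous_intros continuous_on_walks c that[rule_format])
    also have "\<dots> = (walk S t ^^ n) (mollify \<delta> g) x + e"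
      using \<delta> by (simp add: mollify_add continuous_on_walks c mollify_const mollify_walks)
    finally show ?thesis .
  qed
  have sym': "(1 / C) *\<^sub>R H x \<in> SymMat" for x
    using sym[of x] by (auto simp: SymMat_def transpose_def vec_eq_iff)
  show ?thesis
    using that[OF C2W sym' bW close sub] .
qed

section \<open>Viscosity inequalities for mollifications\<close>

lemma superjet_of_max:
  assumes C: "C2 \<phi> D H" and max: "\<And>y. g y - \<phi> y \<le> g x - \<phi> x"
  shows "(g x, H x) \<in> superjet g x"
proof -
  have "C2 (\<lambda>y. \<phi> y + (g x - \<phi> x)) (\<lambda>y. D y + 0) (\<lambda>y. H y + 0)"
    by (rule C2_add[OF C C2_const])
  hence "C2_on_ball (\<lambda>y. \<phi> y + (g x - \<phi> x)) x 1 D H" using C2_imp_C2_on_ball by force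
  moreover have "g y \<le> \<phi> y + (g x - \<phi> x)" for y using max[of y] by linarith
  ultimately show ?thesis unfolding superjet_def
    by (intro CollectI exI[of _ "\<lambda>y. \<phi> y + (g x - \<phi> x)"] exI[of _ 1] exI[of _ D] exI[of _ H]) auto
qed

lemma bounded_support_diff:
  fixes f g :: "real^'n \<Rightarrow> real"
  assumes "bounded {x. f x \<noteq> 0}" "bounded {x. g x \<noteq> 0}"
  shows "bounded {x. f x - g x \<noteq> 0}"
  by (rule bounded_subset[of "{x. f x \<noteq> 0} \<union> {x. g x \<noteq> 0}"]) (use assms in auto)

text \<open>A discrete maximum principle: where \<open>g\<close> minus the last iterate is maximal, that iterate is a test
  function for \<open>g\<close>, which bounds the last increment of the iteration from below.\<close>

lemma viscosity_le_walks:
  fixes g :: "real^'n \<Rightarrow> real"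
  assumes g: "continuous_on UNIV g" "bounded {x. g x \<noteq> 0}"
    and visc: "\<And>x r A. (r, A) \<in> superjet g x \<Longrightarrow> m \<le> quad_sum S A"
    and G: "C2 G D H" "bounded {x. G x \<noteq> 0}"
    and inc: "\<And>x. t\<^sup>2 / (2 * real CARD('n)) * (quad_sum S (H x) - \<omega>) \<le> walk S t G x - G x"
    and osc: "\<And>x. walk S t (\<lambda>y. quad_sum S (H y)) x - \<omega> \<le> quad_sum S (H x)"
    and le: "\<And>x. g x \<le> G x + M"
  shows "g x \<le> (walk S t ^^ n) G x + M - n * (t\<^sup>2 / (2 * real CARD('n)) * (m - 2 * \<omega>))"
proof (induction n arbitrary: x)
  case 0
  show ?case using le by simp
next
  case (Suc n)
  define \<kappa> where "\<kappa> = t\<^sup>2 / (2 * real CARD('n))"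
  define \<l> where "\<l> = (\<lambda>y. quad_sum S (H y))"
  let ?G = "\<lambda>k. (walk S t ^^ k) G"
  have \<kappa>: "\<kappa> \<ge> 0" by (simp add: \<kappa>_def)
  have "continuous_on UNIV (\<lambda>y. g y - ?G (Suc n) y)"
    by (intro continuous_intros g continuous_on_walks C2_imp_continuous_on[OF G(1)])
  moreover have "bounded {y. g y - ?G (Suc n) y \<noteq> 0}"
    by (intro bounded_support_diff g bounded_support_walks G)
  ultimately obtain x0 where x0: "\<And>y. g y - ?G (Suc n) y \<le> g x0 - ?G (Suc n) x0"
    using bounded_support_attains_max by blast
  have "m \<le> quad_sum S ((walk S t ^^ Suc n) H x0)"
    by (rule visc, rule superjet_of_max[OF C2_walks[OF G(1)] x0])
  also have "\<dots> = (walk S t ^^ Suc n) \<l> x0"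
    unfolding \<l>_def by (rule walks_linear[OF linear_quad_sum])
  finally have m: "m \<le> (walk S t ^^ Suc n) \<l> x0" .
  \<comment> \<open>The test function is the iterate of order n + 1, but the increment from n to n +
    1 is the n-fold walk of \<open>walk S t G - G\<close>. The hypothesis \<open>osc\<close> removes
    the extra step at the cost of \<omega>; \<open>inc\<close> costs a second \<omega>.\<close>
  have "(walk S t ^^ Suc n) \<l> x0 - \<omega> = (walk S t ^^ n) (\<lambda>y. 1 * walk S t \<l> y + (- \<omega>)) x0"
    unfolding walks_affine walks_Suc_right by simp
  also have "\<dots> \<le> (walk S t ^^ n) \<l> x0"
    using osc by (intro walks_mono) (simp add: \<l>_def)
  finally have m': "m - \<omega> \<le> (walk S t ^^ n) \<l> x0" using m by linarith
  have "\<kappa> * (m - 2 * \<omega>) \<le> \<kappa> * ((walk S t ^^ n) \<l> x0 - \<omega>)"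
    using m' \<kappa> by (intro mult_left_mono) auto
  also have "\<dots> = \<kappa> * (walk S t ^^ n) \<l> x0 + (- \<kappa> * \<omega>)" by (simp add: algebra_simps)
  also have "\<dots> = (walk S t ^^ n) (\<lambda>y. \<kappa> * \<l> y + (- \<kappa> * \<omega>)) x0" unfolding walks_affine ..
  also have "\<dots> \<le> (walk S t ^^ n) (\<lambda>y. walk S t G y - G y) x0"
  proof (rule walks_mono)
    fix y
    have "\<kappa> * \<l> y + (- \<kappa> * \<omega>) = \<kappa> * (\<l> y - \<omega>)" by (simp add: right_diff_distrib)
    thus "\<kappa> * \<l> y + (- \<kappa> * \<omega>) \<le> walk S t G y - G y" using inc[of y] by (simp add: \<l>_def \<kappa>_def)
  qed
  also have "\<dots> = ?G (Suc n) x0 - ?G n x0" unfolding walks_diff walks_Suc_right ..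
  finally have "?G n x0 + \<kappa> * (m - 2 * \<omega>) \<le> ?G (Suc n) x0" by linarith
  moreover have "g x0 \<le> ?G n x0 + M - n * (\<kappa> * (m - 2 * \<omega>))" using Suc by (simp add: \<kappa>_def)
  \<comment> \<open>The induction hypothesis is combined with the increment at x0 only; maximality
    of x0 carries the result to every x.\<close>
  ultimately have "g x \<le> ?G (Suc n) x + M - (n * (\<kappa> * (m - 2 * \<omega>)) + \<kappa> * (m - 2 * \<omega>))"
    using x0[of x] by linarith
  moreover have "Suc n * (\<kappa> * (m - 2 * \<omega>)) = n * (\<kappa> * (m - 2 * \<omega>)) + \<kappa> * (m - 2 * \<omega>)"
    by (simp add: distrib_right)
  ultimately show ?case unfolding \<kappa>_def by linarith
qed

text \<open>Near x uniform continuity suffices, elsewhere the global maximum is beaten by the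
  quadratic. A quadratic is wanted because its walk averages are known exactly.\<close>

lemma bounded_support_quadratic_majorant:
  fixes f :: "real^'n \<Rightarrow> real"
  assumes f: "continuous_on UNIV f" "bounded {x. f x \<noteq> 0}" and \<epsilon>: "\<epsilon> > 0"
  obtains K where "K > 0" "\<And>y. f y \<le> f x + \<epsilon> + K * ((y - x) \<bullet> (y - x))"
proof -
  obtain x1 where x1: "\<And>y. f y \<le> f x1" using bounded_support_attains_max[OF f] by blast
  obtain d where d: "d > 0" "\<And>x y. dist x y < d \<Longrightarrow> \<bar>f x - f y\<bar> < \<epsilon>"
    using bounded_support_uniformly_continuous[OF f \<epsilon>] by blast
  define K where "K = (f x1 - f x + 1) / d\<^sup>2"
  have pos: "f x1 - f x + 1 > 0" using x1[of x] by linarith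
  hence K: "K > 0" using d by (simp add: K_def)
  have "f y \<le> f x + \<epsilon> + K * ((y - x) \<bullet> (y - x))" for y
  proof (cases "dist y x < d")
    case True
    hence "f y \<le> f x + \<epsilon>" using d(2)[of y x] by linarith
    moreover have "0 \<le> K * ((y - x) \<bullet> (y - x))" using K by simp
    ultimately show ?thesis by linarith
  next
    case False
    hence "d\<^sup>2 \<le> (norm (y - x))\<^sup>2" using d by (intro power_mono) (auto simp: dist_norm)
    hence "K * d\<^sup>2 \<le> K * ((y - x) \<bullet> (y - x))"
      using K by (intro mult_left_mono) (auto simp: power2_norm_eq_inner)
    moreover have "K * d\<^sup>2 = f x1 - f x + 1" using d by (simp add: K_def)
    ultimately show ?thesis using x1[of y] \<epsilon> by linarith
  qed
  thus ?thesis using K that by blast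
qed

text \<open>Suppose the bound fails at x and let the walk run from x for total time \<tau>. The
  averaged inequality for g makes W gain about \<open>\<tau> * m\<close>, while Taylor expansion of
  W allows only about \<open>\<tau> * quad_sum S (H x)\<close>. The rates differ by 8 \<epsilon>, of
  which the errors consume 5 \<epsilon>.\<close>

lemma mollification_inherits_viscosity_bound:
  fixes g :: "real^'n \<Rightarrow> real"
  assumes g: "continuous_on UNIV g" "bounded {x. g x \<noteq> 0}"
    and lip: "\<And>x y. \<bar>g x - g y\<bar> \<le> k * dist x y" and k: "0 \<le> k"
    and visc: "\<And>x r A. (r, A) \<in> superjet g x \<Longrightarrow> m \<le> quad_sum S A"
    and W: "C2 W D H" "bounded {x. H x \<noteq> 0}"
    and sub: "\<And>t n e x. \<forall>y. g y \<le> (walk S t ^^ n) g y + e \<Longrightarrow> W x \<le> (walk S t ^^ n) W x + e"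
  shows "m \<le> quad_sum S (H x)"
proof (rule ccontr)
  assume "\<not> m \<le> quad_sum S (H x)"
  let ?N = "real CARD('n)"
  have N: "?N > 0" by simp
  define \<l> where "\<l> = (\<lambda>y. quad_sum S (H y))"
  define \<epsilon> where "\<epsilon> = (m - \<l> x) / 8"
  have \<epsilon>: "\<epsilon> > 0" "m = \<l> x + 8 * \<epsilon>" using \<open>\<not> m \<le> quad_sum S (H x)\<close> by (auto simp: \<epsilon>_def \<l>_def field_simps)
  have c\<l>: "continuous_on UNIV \<l>"
    unfolding \<l>_def using W(1) unfolding C2_def
    by (intro continuous_on_compose2[OF linear_continuous_on[of "quad_sum S" UNIV] ])
      (auto intro: linear_conv_bounded_linear[THEN iffD1] linear_quad_sum)
  have b\<l>: "bounded {x. \<l> x \<noteq> 0}"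
    by (rule bounded_subset[OF W(2)]) (auto simp: \<l>_def quad_sum_def)
  obtain K where K: "K > 0" "\<And>y. \<l> y \<le> \<l> x + \<epsilon> + K * ((y - x) \<bullet> (y - x))"
    using bounded_support_quadratic_majorant[OF c\<l> b\<l> \<epsilon>(1)] by blast
  define \<beta> where "\<beta> = quad_sum S (mat 1) / ?N"
  have \<beta>: "\<beta> \<ge> 0" using N by (simp add: \<beta>_def quad_sum_def sum_nonneg)
  \<comment> \<open>The order of choices matters: \<tau> depends on W only and is short enough that
    the spread of the walk costs at most \<epsilon>; \<delta> depends on \<tau>, making the
    approximation error 2 k \<delta> small against \<tau>; the step t is chosen last.\<close>
  define \<tau> where "\<tau> = \<epsilon> / (2 * ?N * \<beta> * K + 1)"
  have pos: "2 * ?N * \<beta> * K + 1 > 0" using N \<beta> K by (simp add: add_nonneg_pos)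
  have \<tau>: "\<tau> > 0" "K * (2 * ?N * \<tau> * \<beta>) \<le> \<epsilon>"
    using \<epsilon> pos by (auto simp: \<tau>_def field_simps)
  define \<delta> where "\<delta> = \<epsilon> * \<tau> / (2 * k + 1)"
  have \<delta>: "\<delta> > 0" "2 * (k * \<delta>) \<le> \<epsilon> * \<tau>"
    using \<epsilon> \<tau> k by (auto simp: \<delta>_def field_simps)
  \<comment> \<open>A second, independent mollification: the discrete maximum principle needs
    iterates that are test functions, which those of g itself are not.\<close>
  obtain G DG HG where G: "C2 G DG HG" "bounded {x. G x \<noteq> 0}" "bounded {x. HG x \<noteq> 0}"
    "\<And>x. \<bar>G x - g x\<bar> \<le> k * \<delta>"
    by (rule mollification[OF g \<delta>(1) lip k]) (rule that)
  have e2: "\<epsilon> / 2 > 0" using \<epsilon> by simp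
  obtain d1 where d1: "d1 > 0"
    "\<And>t x. 0 < t \<Longrightarrow> t < d1 \<Longrightarrow> \<bar>walk S t G x - G x - t\<^sup>2 / (2 * ?N) * quad_sum S (HG x)\<bar> \<le> t\<^sup>2 / (2 * ?N) * (\<epsilon> / 2)"
    "\<And>t x. 0 < t \<Longrightarrow> t < d1 \<Longrightarrow> \<bar>walk S t (\<lambda>y. quad_sum S (HG y)) x - quad_sum S (HG x)\<bar> \<le> \<epsilon> / 2"
    by (rule walk_Taylor[OF G(1,3) e2, of S]) (rule that)
  obtain d2 where d2: "d2 > 0"
    "\<And>t x. 0 < t \<Longrightarrow> t < d2 \<Longrightarrow> \<bar>walk S t W x - W x - t\<^sup>2 / (2 * ?N) * quad_sum S (H x)\<bar> \<le> t\<^sup>2 / (2 * ?N) * \<epsilon>"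
    by (rule walk_Taylor[OF W(1,2) \<epsilon>(1), of S]) (rule that)
  define d where "d = min d1 d2"
  have dpos: "d > 0" using d1 d2 by (simp add: d_def)
  obtain n :: nat where n: "2 * ?N * \<tau> / d\<^sup>2 < n" using reals_Archimedean2 by blast
  have "2 * ?N * \<tau> / d\<^sup>2 > 0" using N \<tau> dpos by simp
  hence npos: "real n > 0" using n by linarith
  \<comment> \<open>With this step, n steps have total time n t^2 / (2 N) = \<tau>, and n is so
    large that t < d.\<close>
  define t where "t = sqrt (2 * ?N * \<tau> / n)"
  have t2: "t\<^sup>2 = 2 * ?N * \<tau> / n" using N \<tau> npos by (simp add: t_def)
  have t: "t > 0" using N \<tau> npos by (simp add: t_def)
  have "t\<^sup>2 < d\<^sup>2" using n npos dpos by (simp add: t2 field_simps)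
  hence "t < d" using dpos by (simp add: power2_less_imp_less)
  hence td: "t < d1" "t < d2" by (auto simp: d_def)
  define \<kappa> where "\<kappa> = t\<^sup>2 / (2 * ?N)"
  have \<kappa>: "\<kappa> > 0" "n * \<kappa> = \<tau>" using t N npos \<tau>(1) by (auto simp: \<kappa>_def t2)
  have "g y \<le> (walk S t ^^ n) G y + k * \<delta> - n * (t\<^sup>2 / (2 * real CARD('n)) * (m - 2 * (\<epsilon> / 2)))" for y
  proof (rule viscosity_le_walks[OF g visc G(1,2)])
    fix y
    show "t\<^sup>2 / (2 * real CARD('n)) * (quad_sum S (HG y) - \<epsilon> / 2) \<le> walk S t G y - G y"
      using d1(2)[OF t td(1), of y] unfolding right_diff_distrib by linarith
    show "walk S t (\<lambda>y. quad_sum S (HG y)) y - \<epsilon> / 2 \<le> quad_sum S (HG y)"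
      using d1(3)[OF t td(1), of y] by linarith
    show "g y \<le> G y + k * \<delta>" using G(4)[of y] by linarith
  qed
  moreover have "n * (t\<^sup>2 / (2 * real CARD('n)) * (m - 2 * (\<epsilon> / 2))) = \<tau> * (m - \<epsilon>)"
    unfolding \<kappa>(2)[symmetric] \<kappa>_def by simp
  ultimately have gG: "g y \<le> (walk S t ^^ n) G y + k * \<delta> - \<tau> * (m - \<epsilon>)" for y by simp
  have "(walk S t ^^ n) G y \<le> (walk S t ^^ n) (\<lambda>y. 1 * g y + k * \<delta>) y" for y
    using G(4) by (intro walks_mono) (simp add: abs_le_iff algebra_simps)
  hence "(walk S t ^^ n) G y \<le> (walk S t ^^ n) g y + k * \<delta>" for y unfolding walks_affine by simp
  hence "g y \<le> (walk S t ^^ n) g y + (2 * (k * \<delta>) - \<tau> * (m - \<epsilon>))" for y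
    using gG[of y] by (smt (verit))
  hence low: "W x \<le> (walk S t ^^ n) W x + (2 * (k * \<delta>) - \<tau> * (m - \<epsilon>))" by (intro sub allI)
  \<comment> \<open>The increments are telescoped. The operator of W may grow away from x; its
    quadratic majorant turns this growth into the second moment of the walk, at most 2 N \<tau>
    \<beta> over all n steps.\<close>
  have "(walk S t ^^ j) W x - W x \<le> j * (\<kappa> * (\<l> x + 3 * \<epsilon>))" if "j \<le> n" for j
    using that
  proof (induction j)
    case (Suc j)
    have "(walk S t ^^ Suc j) W x - (walk S t ^^ j) W x = (walk S t ^^ j) (\<lambda>y. walk S t W y - W y) x"
      unfolding walks_diff walks_Suc_right ..
    also have "\<dots> \<le> (walk S t ^^ j) (\<lambda>y. (\<kappa> * K) * ((y - x) \<bullet> (y - x)) + \<kappa> * (\<l> x + 2 * \<epsilon>)) x"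
    proof (rule walks_mono)
      fix y
      have "walk S t W y - W y \<le> \<kappa> * (\<l> y + \<epsilon>)"
        using d2(2)[OF t td(2), of y] unfolding \<kappa>_def \<l>_def distrib_left by linarith
      also have "\<dots> \<le> \<kappa> * (\<l> x + \<epsilon> + K * ((y - x) \<bullet> (y - x)) + \<epsilon>)"
        using K(2)[of y] \<kappa> by (intro mult_left_mono) auto
      finally show "walk S t W y - W y \<le> (\<kappa> * K) * ((y - x) \<bullet> (y - x)) + \<kappa> * (\<l> x + 2 * \<epsilon>)"
        by (simp add: algebra_simps)
    qed
    also have "\<dots> = \<kappa> * (K * (j * (t\<^sup>2 * \<beta>))) + \<kappa> * (\<l> x + 2 * \<epsilon>)"
      unfolding walks_affine walks_square \<beta>_def by simp
    also have "\<dots> \<le> \<kappa> * \<epsilon> + \<kappa> * (\<l> x + 2 * \<epsilon>)"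
    proof -
      have "j * (t\<^sup>2 * \<beta>) \<le> n * (t\<^sup>2 * \<beta>)" using Suc.prems \<beta> by (intro mult_right_mono) auto
      also have "\<dots> = 2 * ?N * \<tau> * \<beta>" using npos by (simp add: t2)
      finally have "K * (j * (t\<^sup>2 * \<beta>)) \<le> \<epsilon>"
        using \<tau>(2) K(1) by (meson mult_left_mono less_imp_le order_trans)
      thus ?thesis using \<kappa> by simp
    qed
    finally have "(walk S t ^^ Suc j) W x - (walk S t ^^ j) W x \<le> \<kappa> * (\<l> x + 3 * \<epsilon>)"
      by (simp add: algebra_simps)
    moreover have "(walk S t ^^ j) W x - W x \<le> j * (\<kappa> * (\<l> x + 3 * \<epsilon>))" using Suc by simp
    ultimately show ?case by (simp add: distrib_right)
  qed simp
  from this[of n] have "(walk S t ^^ n) W x - W x \<le> \<tau> * (\<l> x + 3 * \<epsilon>)"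
    using \<kappa>(2) by (simp flip: mult.assoc)
  with low \<delta>(2) have "0 \<le> \<tau> * (\<l> x + 3 * \<epsilon>) + \<epsilon> * \<tau> - \<tau> * (m - \<epsilon>)" by linarith
  also have "\<dots> = - 3 * (\<epsilon> * \<tau>)" unfolding \<epsilon>(2) by (simp add: algebra_simps)
  finally show False using \<epsilon>(1) \<tau>(1) by (simp add: mult_le_0_iff)
qed

section \<open>Semicontinuity and jets\<close>

text \<open>Without a maximum, every x has some Y x with u < u (Y x) near x. Among the centres of a
  finite cover, the one with largest u (Y x) is refuted by the centre whose ball contains Y
  x.\<close>

lemma usc_on_attains_max:
  assumes "compact S" "S \<noteq> {}" and u: "usc_on S u"
  obtains x where "x \<in> S" "\<And>y. y \<in> S \<Longrightarrow> u y \<le> u x"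
proof (rule ccontr)
  assume "\<not> thesis"
  with that have "\<forall>x\<in>S. \<exists>y\<in>S. u x < u y" by (meson not_le)
  then obtain Y where Y: "\<And>x. x \<in> S \<Longrightarrow> Y x \<in> S \<and> u x < u (Y x)" by metis
  have "\<forall>x\<in>S. \<exists>d>0. \<forall>y\<in>S. dist y x < d \<longrightarrow> u y < u (Y x)"
    using u Y unfolding usc_on_def by blast
  then obtain d where d: "\<And>x. x \<in> S \<Longrightarrow> d x > 0" "\<And>x y. x \<in> S \<Longrightarrow> y \<in> S \<Longrightarrow> dist y x < d x \<Longrightarrow> u y < u (Y x)"
    by metis
  have "S \<subseteq> (\<Union>x\<in>S. ball x (d x))" using d(1) by force
  then obtain F where F: "F \<subseteq> S" "finite F" "S \<subseteq> (\<Union>x\<in>F. ball x (d x))"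
    by (rule compactE_image[OF assms(1), rotated]) auto
  have "F \<noteq> {}" using F(3) assms(2) by auto
  hence "Max ((\<lambda>x. u (Y x)) ` F) \<in> (\<lambda>x. u (Y x)) ` F" using F(2) by (intro Max_in) auto
  then obtain x where "x \<in> F" "u (Y x) = Max ((\<lambda>x. u (Y x)) ` F)" by auto
  hence x: "x \<in> F" "\<And>y. y \<in> F \<Longrightarrow> u (Y y) \<le> u (Y x)" using F(2) by auto
  have "Y x \<in> S" using Y x F by blast
  then obtain z where "z \<in> F" "dist (Y x) z < d z" using F(3) by (auto simp: dist_commute)
  hence "u (Y x) < u (Y z)" using d(2) F(1) \<open>Y x \<in> S\<close> by blast
  thus False using x(2)[OF \<open>z \<in> F\<close>] by linarith
qed

lemma lsc_onD: "lsc_on S v \<Longrightarrow> x \<in> S \<Longrightarrow> t < v x \<Longrightarrow> \<exists>d>0. \<forall>y\<in>S. dist y x < d \<longrightarrow> t < v y"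
  unfolding lsc_on_def by simp

lemma usc_onD: "usc_on S u \<Longrightarrow> x \<in> S \<Longrightarrow> u x < t \<Longrightarrow> \<exists>d>0. \<forall>y\<in>S. dist y x < d \<longrightarrow> u y < t"
  unfolding usc_on_def by simp

lemma usc_on_uminus: "usc_on S (\<lambda>x. - v x) \<longleftrightarrow> lsc_on S v"
proof -
  have all_uminus: "(\<forall>t. P (- t)) \<longleftrightarrow> (\<forall>t. P t)" for P :: "real \<Rightarrow> bool"
    by (metis minus_minus)
  have "lsc_on S v \<longleftrightarrow> (\<forall>x\<in>S. \<forall>t. - t < v x \<longrightarrow> (\<exists>d>0. \<forall>y\<in>S. dist y x < d \<longrightarrow> - t < v y))"
    unfolding lsc_on_def by (simp only: all_uminus[of "\<lambda>t. t < v _ \<longrightarrow> (\<exists>d>0. \<forall>y\<in>S. dist y _ < d \<longrightarrow> t < v y)"])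
  thus ?thesis unfolding usc_on_def by (simp add: minus_less_iff)
qed

lemma lsc_on_attains_min:
  assumes "compact S" "S \<noteq> {}" and "lsc_on S v"
  obtains x where "x \<in> S" "\<And>y. y \<in> S \<Longrightarrow> v x \<le> v y"
  using usc_on_attains_max[of S "\<lambda>x. - v x"] assms by (auto simp: usc_on_uminus)

lemma usc_on_add:
  assumes "usc_on S u" "usc_on S v" shows "usc_on S (\<lambda>x. u x + v x)"
  unfolding usc_on_def
proof (intro ballI allI impI)
  fix x t assume x: "x \<in> S" and t: "u x + v x < t"
  define e where "e = (t - (u x + v x)) / 2"
  have e: "e > 0" "u x + e + (v x + e) = t" using t by (auto simp: e_def field_simps)
  obtain d1 where d1: "d1 > 0" "\<And>y. y \<in> S \<Longrightarrow> dist y x < d1 \<Longrightarrow> u y < u x + e"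
    using assms(1) x e unfolding usc_on_def by (metis less_add_same_cancel1)
  obtain d2 where d2: "d2 > 0" "\<And>y. y \<in> S \<Longrightarrow> dist y x < d2 \<Longrightarrow> v y < v x + e"
    using assms(2) x e unfolding usc_on_def by (metis less_add_same_cancel1)
  have "u y + v y < t" if "y \<in> S" "dist y x < min d1 d2" for y
    using d1(2)[of y] d2(2)[of y] that e by auto
  thus "\<exists>d>0. \<forall>y\<in>S. dist y x < d \<longrightarrow> u y + v y < t" using d1(1) d2(1) by (intro exI[of _ "min d1 d2"]) auto
qed

lemma continuous_on_imp_usc_on:
  assumes "continuous_on S u" shows "usc_on S u"
  unfolding usc_on_def
proof (intro ballI allI impI)
  fix x t assume "x \<in> S" "u x < t"
  then obtain d where "d > 0" "\<forall>y\<in>S. dist y x < d \<longrightarrow> dist (u y) (u x) < t - u x"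
    using assms unfolding continuous_on_iff by (metis diff_gt_0_iff_gt)
  moreover have "u y < t" if "dist (u y) (u x) < t - u x" for y
    using that unfolding dist_real_def by linarith
  ultimately show "\<exists>d>0. \<forall>y\<in>S. dist y x < d \<longrightarrow> u y < t" by blast
qed

lemma lsc_on_add:
  assumes "lsc_on S u" "lsc_on S v" shows "lsc_on S (\<lambda>x. u x + v x)"
proof -
  have "usc_on S (\<lambda>x. - u x + - v x)" using assms by (intro usc_on_add) (auto simp: usc_on_uminus)
  moreover have "(\<lambda>x. - u x + - v x) = (\<lambda>x. - (u x + v x))" by auto
  ultimately show ?thesis by (metis usc_on_uminus)
qed

lemma lsc_on_min:
  assumes "lsc_on S u" "lsc_on S v" shows "lsc_on S (\<lambda>x. min (u x) (v x))"
  unfolding lsc_on_def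
proof (intro ballI allI impI)
  fix x t assume x: "x \<in> S" and t: "t < min (u x) (v x)"
  obtain d1 where d1: "d1 > 0" "\<And>y. y \<in> S \<Longrightarrow> dist y x < d1 \<Longrightarrow> t < u y"
    using lsc_onD[OF assms(1) x, of t] t by auto
  obtain d2 where d2: "d2 > 0" "\<And>y. y \<in> S \<Longrightarrow> dist y x < d2 \<Longrightarrow> t < v y"
    using lsc_onD[OF assms(2) x, of t] t by auto
  show "\<exists>d>0. \<forall>y\<in>S. dist y x < d \<longrightarrow> t < min (u y) (v y)"
    using d1 d2 by (intro exI[of _ "min d1 d2"]) auto
qed

lemma continuous_on_imp_lsc_on: "continuous_on S u \<Longrightarrow> lsc_on S u"
  using continuous_on_imp_usc_on[of S "\<lambda>x. - u x"] by (simp add: usc_on_uminus continuous_on_minus)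

lemma usc_on_subset: "usc_on S u \<Longrightarrow> T \<subseteq> S \<Longrightarrow> usc_on T u"
  unfolding usc_on_def by (meson subsetD)

lemma lsc_on_subset: "lsc_on S u \<Longrightarrow> T \<subseteq> S \<Longrightarrow> lsc_on T u"
  unfolding lsc_on_def by (meson subsetD)

section \<open>Superjets of touching minorants and of sums\<close>

lemma superjet_le:
  assumes "(s, A) \<in> superjet f x" "d > 0" "\<And>y. y \<in> ball x d \<Longrightarrow> u y \<le> f y" "u x = f x"
  shows "(s, A) \<in> superjet u x"
proof -
  obtain \<phi> e g H where *: "s = \<phi> x" "A = H x" "e > 0" "C2_on_ball \<phi> x e g H"
    "\<forall>y\<in>ball x e. f y \<le> \<phi> y" "f x = \<phi> x"
    using assms(1) unfolding superjet_def by blast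
  have "\<forall>y\<in>ball x (min d e). u y \<le> \<phi> y" using * assms(3) by force
  thus ?thesis unfolding superjet_def
    using * assms(2,4) C2_on_ball_mono[OF *(4), of "min d e"]
    by (intro CollectI exI[of _ \<phi>] exI[of _ "min d e"] exI[of _ g] exI[of _ H]) auto
qed

lemma superjet_add_C2:
  assumes "(s, A) \<in> superjet f x" and C: "C2 q Dq Hq"
  shows "(s + q x, A + Hq x) \<in> superjet (\<lambda>y. f y + q y) x"
proof -
  obtain \<phi> e g H where *: "s = \<phi> x" "A = H x" "e > 0" "C2_on_ball \<phi> x e g H"
    "\<forall>y\<in>ball x e. f y \<le> \<phi> y" "f x = \<phi> x"
    using assms(1) unfolding superjet_def by blast
  show ?thesis unfolding superjet_def
    using * C2_on_ball_add[OF *(4) C2_imp_C2_on_ball[OF C]]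
    by (intro CollectI exI[of _ "\<lambda>y. \<phi> y + q y"] exI[of _ e] exI[of _ "\<lambda>y. g y + Dq y"] exI[of _ "\<lambda>y. H y + Hq y"]) auto
qed

lemma superjet_fst: "(s, A) \<in> superjet f x \<Longrightarrow> s = f x"
  unfolding superjet_def by auto

lemma subjet_fst: "(s, A) \<in> subjet f x \<Longrightarrow> s = f x"
  unfolding subjet_def by auto

lemma C2_quadratic: "C2 (\<lambda>x. a * ((x - b) \<bullet> (x - b))) (\<lambda>x. (2 * a) *\<^sub>R (x - b)) (\<lambda>x. mat (2 * a))"
  unfolding C2_def
  by (auto intro!: derivative_eq_intros continuous_intros simp: mat_mult_vec inner_commute algebra_simps)

text \<open>The kernel is a cone instead of the usual paraboloid: this gives the least k-Lipschitz
  majorant of f, and the mollification error is measured by a Lipschitz constant.\<close>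

definition supconv :: "real \<Rightarrow> (real^'n \<Rightarrow> real) \<Rightarrow> real^'n \<Rightarrow> real" where
  "supconv k f x = (SUP y. f y - k * dist x y)"

text \<open>Beyond distance B / k the cone outweighs the range of f, so the supremum is that of an
  upper semicontinuous function on a compact ball.\<close>

lemma supconv_attained:
  fixes f :: "real^'n \<Rightarrow> real"
  assumes f: "usc_on UNIV f" "\<And>y. 0 \<le> f y" "\<And>y. f y \<le> B" and k: "k > 0"
  obtains y where "supconv k f x = f y - k * dist x y" "\<And>z. f z - k * dist x z \<le> supconv k f x"
proof -
  let ?F = "\<lambda>z. f z + - (k * dist x z)"
  have B: "B \<ge> 0" using f(2)[of x] f(3)[of x] by linarith
  have uscF: "usc_on (cball x (B / k + 1)) ?F"
    by (intro usc_on_add usc_on_subset[OF f(1)] continuous_on_imp_usc_on continuous_intros) auto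
  have "x \<in> cball x (B / k + 1)" using B k by simp
  hence ne: "cball x (B / k + 1) \<noteq> {}" by blast
  obtain y where y: "\<And>z. z \<in> cball x (B / k + 1) \<Longrightarrow> ?F z \<le> ?F y"
    by (rule usc_on_attains_max[OF compact_cball ne uscF]) (rule that)
  have all: "?F z \<le> ?F y" for z
  proof (cases "z \<in> cball x (B / k + 1)")
    case False
    hence "k * dist x z \<ge> k * (B / k + 1)" using k by (intro mult_left_mono) auto
    also have "k * (B / k + 1) = B + k" using k by (simp add: distrib_left)
    finally have "?F z \<le> 0" using f(3)[of z] k by linarith
    also have "0 \<le> ?F x" using f(2) by simp
    also have "\<dots> \<le> ?F y" using B k by (intro y) auto
    finally show ?thesis .
  qed (use y in auto)
  have "supconv k f x = f y - k * dist x y"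
    unfolding supconv_def using all by (intro cSup_eq_maximum) auto
  with all show ?thesis by (intro that[of y]) auto
qed

lemma supconv_ge:
  fixes f :: "real^'n \<Rightarrow> real"
  assumes "usc_on UNIV f" "\<And>y. 0 \<le> f y" "\<And>y. f y \<le> B" "k > 0"
  shows "f z - k * dist x z \<le> supconv k f x"
proof (rule supconv_attained[OF assms, of x])
  assume "\<And>z. f z - k * dist x z \<le> supconv k f x"
  thus ?thesis .
qed

text \<open>A test function at x, translated by x - y and raised by a constant, touches f from above
  at the point y that attains the supremum. The Hessian is unchanged, and the position of y is
  harmless because the inequality used for jets of f holds everywhere.\<close>

lemma superjet_supconv:
  fixes f :: "real^'n \<Rightarrow> real"
  assumes f: "usc_on UNIV f" "\<And>y. 0 \<le> f y" "\<And>y. f y \<le> B" and k: "k > 0"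
    and jet: "(s, A) \<in> superjet (supconv k f) x"
  obtains y where "(f y, A) \<in> superjet f y"
proof -
  obtain y where y: "supconv k f x = f y - k * dist x y"
    by (rule supconv_attained[OF f k]) (rule that)
  obtain \<phi> e g H where *: "A = H x" "e > 0" "C2_on_ball \<phi> x e g H"
    "\<forall>z\<in>ball x e. supconv k f z \<le> \<phi> z" "supconv k f x = \<phi> x"
    using jet unfolding superjet_def by blast
  define a where "a = x - y"
  have "C2_on_ball (\<lambda>z. \<phi> (z + a) + k * dist x y) (x - a) e (\<lambda>z. g (z + a) + 0) (\<lambda>z. H (z + a) + 0)"
    by (rule C2_on_ball_add[OF C2_on_ball_shift[OF *(3)] C2_imp_C2_on_ball[OF C2_const]])
  hence C: "C2_on_ball (\<lambda>z. \<phi> (z + a) + k * dist x y) y e (\<lambda>z. g (z + a)) (\<lambda>z. H (z + a))"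
    by (simp add: a_def)
  have "f z \<le> \<phi> (z + a) + k * dist x y" if "z \<in> ball y e" for z
  proof -
    have "z + a \<in> ball x e" using that by (simp add: a_def dist_norm algebra_simps)
    moreover have "f z - k * dist (z + a) z \<le> supconv k f (z + a)"
      by (rule supconv_ge[OF f k])
    moreover have "dist (z + a) z = dist x y" by (simp add: a_def dist_norm)
    ultimately show ?thesis using *(4) by fastforce
  qed
  moreover have "f y = \<phi> (y + a) + k * dist x y" using y *(5) by (simp add: a_def)
  moreover have "A = H (y + a)" using * by (simp add: a_def)
  ultimately have "(f y, A) \<in> superjet f y"
    unfolding superjet_def using C *(2)
    by (intro CollectI exI[of _ "\<lambda>z. \<phi> (z + a) + k * dist x y"] exI[of _ e] exI[of _ "\<lambda>z. g (z + a)"] exI[of _ "\<lambda>z. H (z + a)"]) auto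
  thus ?thesis using that by blast
qed

lemma supconv_Lipschitz:
  fixes f :: "real^'n \<Rightarrow> real"
  assumes f: "usc_on UNIV f" "\<And>y. 0 \<le> f y" "\<And>y. f y \<le> B" and k: "k > 0"
  shows "\<bar>supconv k f x - supconv k f z\<bar> \<le> k * dist x z"
proof -
  have "supconv k f x \<le> supconv k f z + k * dist x z" for x z
  proof -
    obtain y where y: "supconv k f x = f y - k * dist x y"
      by (rule supconv_attained[OF f k]) (rule that)
    have "f y - k * dist z y \<le> supconv k f z"
      by (rule supconv_ge[OF f k])
    moreover have "k * dist z y \<le> k * (dist x z + dist x y)"
      using dist_triangle[of z y x] k by (intro mult_left_mono) (auto simp: dist_commute)
    ultimately show ?thesis using y by (simp add: distrib_left)
  qed
  from this[of x z] this[of z x] show ?thesis by (simp add: dist_commute abs_le_iff)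
qed

text \<open>A Dini-type argument: the sup-convolutions decrease to f as k grows, and compactness of
  E makes the strict inequality uniform.\<close>

lemma supconv_less:
  fixes f :: "real^'n \<Rightarrow> real"
  assumes f: "usc_on UNIV f" "\<And>y. 0 \<le> f y" "\<And>y. f y \<le> B"
    and E: "compact E" "lsc_on E \<psi>" "\<And>x. x \<in> E \<Longrightarrow> f x < \<psi> x"
  obtains k where "k > 0" "\<And>x. x \<in> E \<Longrightarrow> supconv k f x < \<psi> x"
proof -
  have B: "B \<ge> 0" using f(2)[of 0] f(3)[of 0] by linarith
  have "\<exists>d>0. \<exists>t>0. (\<forall>y. dist y x < 2 * d \<longrightarrow> f y < t) \<and> (\<forall>y\<in>E. dist y x < d \<longrightarrow> t < \<psi> y)" if x: "x \<in> E" for x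
  proof -
    obtain t where t: "f x < t" "t < \<psi> x" using dense[OF E(3)[OF x]] by blast
    obtain d1 where d1: "d1 > 0" "\<And>y. dist y x < d1 \<Longrightarrow> f y < t"
      using usc_onD[OF f(1), of x t] t by auto
    obtain d2 where d2: "d2 > 0" "\<And>y. y \<in> E \<Longrightarrow> dist y x < d2 \<Longrightarrow> t < \<psi> y"
      using lsc_onD[OF E(2) x, of t] t by auto
    have "t > 0" using t f(2)[of x] by linarith
    moreover have "min d1 d2 / 2 > 0" using d1(1) d2(1) by simp
    moreover have "\<forall>y. dist y x < 2 * (min d1 d2 / 2) \<longrightarrow> f y < t" using d1(2) by simp
    moreover have "\<forall>y\<in>E. dist y x < min d1 d2 / 2 \<longrightarrow> t < \<psi> y"
    proof (intro ballI impI d2(2))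
      fix y assume "dist y x < min d1 d2 / 2"
      thus "dist y x < d2" using d1(1) d2(1) by linarith
    qed
    ultimately show ?thesis by blast
  qed
  then obtain d t where dt: "\<And>x. x \<in> E \<Longrightarrow> d x > 0" "\<And>x. x \<in> E \<Longrightarrow> t x > 0"
    "\<And>x y. x \<in> E \<Longrightarrow> dist y x < 2 * d x \<Longrightarrow> f y < t x"
    "\<And>x y. x \<in> E \<Longrightarrow> y \<in> E \<Longrightarrow> dist y x < d x \<Longrightarrow> t x < \<psi> y"
    by metis
  have "E \<subseteq> (\<Union>x\<in>E. ball x (d x))" using dt(1) by force
  then obtain F where F: "F \<subseteq> E" "finite F" "E \<subseteq> (\<Union>x\<in>F. ball x (d x))"
    by (rule compactE_image[OF E(1), rotated]) auto
  \<comment> \<open>This k exceeds every B / d x, so a maximiser at distance at least d x from z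
    yields a value at most 0, which is below t x.\<close>
  define k where "k = 1 + (\<Sum>x\<in>F. B / d x)"
  have nn: "0 \<le> B / d x" if "x \<in> F" for x using that F dt(1)[of x] B by auto
  have k: "k > 0" using nn by (simp add: k_def add_pos_nonneg sum_nonneg)
  have kd: "B \<le> k * d x" if "x \<in> F" for x
  proof -
    have "B / d x \<le> k" using member_le_sum[of x F "\<lambda>x. B / d x"] F nn that by (simp add: k_def)
    thus ?thesis using dt(1)[of x] F that by (auto simp: divide_le_eq)
  qed
  have "supconv k f z < \<psi> z" if z: "z \<in> E" for z
  proof -
    obtain x where x: "x \<in> F" "dist z x < d x" using F(3) z by (auto simp: dist_commute)
    hence xE: "x \<in> E" using F by auto
    obtain y where y: "supconv k f z = f y - k * dist z y"
      by (rule supconv_attained[OF f k]) (rule that)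
    have "supconv k f z < t x"
    proof (cases "dist z y < d x")
      case True
      hence "dist y x < 2 * d x" using dist_triangle[of y x z] x by (simp add: dist_commute)
      hence "f y < t x" using dt(3) xE by blast
      moreover have "k * dist z y \<ge> 0" using k by simp
      ultimately show ?thesis using y by linarith
    next
      case False
      hence "k * d x \<le> k * dist z y" using k by (intro mult_left_mono) auto
      thus ?thesis using y f(3)[of y] kd[OF x(1)] dt(2)[OF xE] by linarith
    qed
    thus ?thesis using dt(4)[OF xE z x(2)] by linarith
  qed
  thus ?thesis using k that by blast
qed

section \<open>Comparison\<close>

text \<open>Here \<open>w\<close> is cut off by a steep paraboloid \<open>p\<close>, so that \<open>f = max (w - p) 0\<close> is bounded with compact
  support; its mollified sup-convolution plus \<open>p\<close> touches \<open>v\<close> from below near \<open>x0\<close>. As \<open>p \<ge> w x0 - \<theta>\<close>, only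
  jets of \<open>w\<close> at points where \<open>w \<ge> w x0 - \<theta>\<close> enter.\<close>

lemma Monge_Ampere_strict_comparison:
  fixes w v :: "real^'n \<Rightarrow> real"
  assumes r: "r > 0" and w: "usc_on (cball x0 r) w" and v: "lsc_on (cball x0 r) v"
    and \<theta>: "\<theta> > 0" and C: "C > 0" and \<epsilon>: "\<epsilon> > 0"
    and touch: "\<And>x. x \<in> cball x0 r \<Longrightarrow> w x \<le> v x + M - \<epsilon> * ((x - x0) \<bullet> (x - x0))" "w x0 = v x0 + M"
    and sub: "\<And>x s A. x \<in> ball x0 r \<Longrightarrow> w x0 - \<theta> \<le> w x \<Longrightarrow> (s, A) \<in> superjet w x \<Longrightarrow>
        A \<in> SymMat \<and> psd A \<and> C \<le> det A"
    and super: "\<And>x s A. x \<in> ball x0 r \<Longrightarrow> v x \<le> v x0 + \<theta> \<Longrightarrow> (s, A) \<in> subjet v x \<Longrightarrow>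
        A \<in> SymMat \<Longrightarrow> psd A \<Longrightarrow> det A < C"
  shows False
proof -
  define c where "c = root CARD('n) C"
  have c: "c > 0" "c ^ CARD('n) = C" using C by (auto simp: c_def)
  have x0r: "x0 \<in> cball x0 r" using r by simp
  obtain xm where xm: "\<And>y. y \<in> cball x0 r \<Longrightarrow> w y \<le> w xm"
    by (rule usc_on_attains_max[OF compact_cball _ w]) (use x0r in blast, rule that)
  define B where "B = w xm - w x0 + \<theta>"
  have B: "B > 0" using xm[OF x0r] \<theta> by (simp add: B_def)
  \<comment> \<open>The summand 4 B / r^2 makes p exceed w from distance r / 2 on, so f vanishes
    there; the summand c gives \<open>(2 * K) ^ N \<ge> C\<close>, so p is itself a
    subsolution.\<close>
  define K where "K = 4 * B / r\<^sup>2 + c"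
  have K: "K > 0" "c \<le> 2 * K" using B c r by (auto simp: K_def add_pos_pos)
  have Kr: "B < K * (r / 2)\<^sup>2"
  proof -
    have "K * (r / 2)\<^sup>2 = B + c * (r / 2)\<^sup>2" using r by (simp add: K_def field_simps)
    thus ?thesis using c r by simp
  qed
  define p where "p = (\<lambda>x. K * ((x - x0) \<bullet> (x - x0)) + (w x0 - \<theta>))"
  have C2p: "C2 p (\<lambda>x. (2 * K) *\<^sub>R (x - x0) + 0) (\<lambda>x. mat (2 * K) + 0)"
    unfolding p_def by (rule C2_add[OF C2_quadratic C2_const])
  have p_ge: "w x0 - \<theta> \<le> p x" for x using K by (simp add: p_def)
  have contp: "continuous_on X p" for X by (rule C2_imp_continuous_on[OF C2p])
  define f where "f = (\<lambda>x. if x \<in> cball x0 r then max (w x - p x) 0 else 0)"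
  have f0: "0 \<le> f x" for x by (simp add: f_def)
  have fB: "f x \<le> B" for x
    using xm[of x] p_ge[of x] B by (auto simp: f_def B_def)
  have fx0: "f x0 = \<theta>" using \<theta> r by (simp add: f_def p_def)
  have f_far: "f x = 0" if "r / 2 \<le> dist x0 x" for x
  proof -
    have "(r / 2)\<^sup>2 \<le> (dist x0 x)\<^sup>2" using that r by (intro power_mono) auto
    also have "\<dots> = (x - x0) \<bullet> (x - x0)" by (metis dist_commute dist_norm power2_norm_eq_inner)
    finally have "K * (r / 2)\<^sup>2 \<le> K * ((x - x0) \<bullet> (x - x0))" using K by (intro mult_left_mono) auto
    hence "x \<in> cball x0 r \<Longrightarrow> w x - p x \<le> 0" using Kr xm[of x] unfolding p_def B_def by linarith
    thus ?thesis by (simp add: f_def)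
  qed
  have f_usc: "usc_on UNIV f"
    unfolding usc_on_def
  proof (intro ballI allI impI)
    fix x t assume t: "f x < t"
    hence t0: "t > 0" using f0[of x] by linarith
    show "\<exists>d>0. \<forall>y\<in>UNIV. dist y x < d \<longrightarrow> f y < t"
    proof (cases "dist x0 x < r")
      case True
      hence x: "x \<in> cball x0 r" by simp
      have "usc_on (cball x0 r) (\<lambda>x. w x + - p x)"
        by (intro usc_on_add w continuous_on_imp_usc_on continuous_intros contp)
      moreover have "w x + - p x < t" using t x by (simp add: f_def)
      ultimately obtain d where d: "d > 0" "\<forall>y\<in>cball x0 r. dist y x < d \<longrightarrow> w y + - p y < t"
        using usc_onD[OF _ x] by blast
      have "f y < t" if "dist y x < d" for y using that d t0 by (auto simp: f_def)
      thus ?thesis using d(1) by blast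
    next
      case False
      have "f y < t" if "dist y x < r / 2" for y
      proof -
        have "r / 2 \<le> dist x0 y" using False that dist_triangle[of x0 x y] by linarith
        thus ?thesis using f_far t0 by simp
      qed
      thus ?thesis using r by (intro exI[of _ "r / 2"]) auto
    qed
  qed
  \<comment> \<open>On the ball f + p is the maximum of the subsolutions w and p; for f alone the
    bound is lowered by the contribution of the Hessian 2 K I of p. Where f = 0 it is minimal, so a
    function touching it from above has a nonnegative Hessian.\<close>
  have f_jet: "CARD('n) * c - 2 * K * quad_sum S (mat 1) \<le> quad_sum S A"
    if jet: "(s, A) \<in> superjet f x" and S: "\<bar>det S\<bar> = 1" for s A x and S :: "real^'n^'n"
  proof -
    have mat2K: "quad_sum S (mat (2 * K)) = 2 * K * quad_sum S (mat 1)"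
      by (simp add: quad_sum_def mat_mult_vec sum_distrib_left)
    show ?thesis
    proof (cases "f x = 0")
      case True
      obtain \<phi> e g H where *: "A = H x" "e > 0" "C2_on_ball \<phi> x e g H"
        "\<forall>y\<in>ball x e. f y \<le> \<phi> y" "f x = \<phi> x"
        using jet unfolding superjet_def by blast
      have "\<phi> x \<le> \<phi> y" if "y \<in> ball x e" for y
        using bspec[OF *(4) that] *(5) True f0[of y] by linarith
      hence "0 \<le> z \<bullet> (A *v z)" for z
        unfolding *(1) by (rule C2_local_min_imp_nonneg[OF *(3,2)])
      hence "0 \<le> quad_sum S A" by (simp add: quad_sum_def sum_nonneg)
      moreover have "CARD('n) * c \<le> quad_sum S (mat (2 * K))"
      proof (intro psd_quad_sum_ge SymMat_mat psd_mat S)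
        show "c ^ CARD('n) \<le> det (mat (2 * K) :: real^'n^'n)"
          unfolding det_mat using K c by (intro power_mono) auto
      qed (use K c in auto)
      ultimately show ?thesis by (simp add: mat2K)
    next
      case False
      hence near: "dist x0 x < r / 2" using f_far[of x] by (meson not_le)
      have inb: "y \<in> cball x0 r" if "y \<in> ball x (r / 2)" for y
        using that near dist_triangle[of x0 y x] by simp
      have xin: "x \<in> ball x0 r" "x \<in> cball x0 r" using near r by auto
      have "f x = w x - p x" using False xin(2) by (auto simp: f_def max_def split: if_splits)
      hence wx: "w x = f x + p x" by simp
      have "(s + p x, A + (mat (2 * K) + 0)) \<in> superjet w x"
      proof (rule superjet_le[OF superjet_add_C2[OF jet C2p]])
        show "r / 2 > 0" using r by simp
        show "w y \<le> f y + p y" if "y \<in> ball x (r / 2)" for y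
          using inb[OF that] by (simp add: f_def)
      qed (rule wx)
      moreover have "w x0 - \<theta> \<le> w x" using wx p_ge[of x] f0[of x] by linarith
      ultimately have "A + mat (2 * K) \<in> SymMat \<and> psd (A + mat (2 * K)) \<and> C \<le> det (A + mat (2 * K))"
        using sub[OF xin(1)] by simp
      hence "CARD('n) * c \<le> quad_sum S (A + mat (2 * K))"
        using c S by (intro psd_quad_sum_ge) auto
      thus ?thesis by (simp add: quad_sum_add mat2K)
    qed
  qed
  obtain d1 where d1: "d1 > 0" "\<And>y. y \<in> cball x0 r \<Longrightarrow> dist y x0 < d1 \<Longrightarrow> v x0 - \<theta> / 4 < v y"
    using lsc_onD[OF v x0r, of "v x0 - \<theta> / 4"] \<theta> by auto
  obtain d2 where d2: "d2 > 0" "\<And>y. y \<in> cball x0 r \<Longrightarrow> dist y x0 < d2 \<Longrightarrow> w y < w x0 + \<theta> / 4"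
    using usc_onD[OF w x0r, of "w x0 + \<theta> / 4"] \<theta> by auto
  \<comment> \<open>Up to radius d3 the terms K \<sigma>^2 and \<epsilon> \<sigma>^2 are at most
    \<theta> / 4 and \<theta> / 2, so p too obeys the touching inequality and may replace w in the
    maximum.\<close>
  define d3 where "d3 = sqrt (\<theta> / (4 * K + 2 * \<epsilon>))"
  have d3: "d3 > 0" "(4 * K + 2 * \<epsilon>) * d3\<^sup>2 = \<theta>" using \<theta> K \<epsilon> by (auto simp: d3_def add_pos_pos)
  define \<sigma> where "\<sigma> = min (min (d1 / 2) (d2 / 2)) (min d3 (r / 2))"
  have \<sigma>: "\<sigma> > 0" "\<sigma> < d1" "\<sigma> < d2" "\<sigma> < r" "\<sigma> \<le> d3" using d1 d2 d3 r by (auto simp: \<sigma>_def)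
  have "(4 * K + 2 * \<epsilon>) * \<sigma>\<^sup>2 \<le> (4 * K + 2 * \<epsilon>) * d3\<^sup>2"
    using \<sigma> K \<epsilon> by (intro mult_left_mono power_mono) auto
  hence "4 * (K * \<sigma>\<^sup>2) + 2 * (\<epsilon> * \<sigma>\<^sup>2) \<le> \<theta>" using d3(2) by (simp add: algebra_simps)
  moreover have "0 \<le> K * \<sigma>\<^sup>2" "0 \<le> \<epsilon> * \<sigma>\<^sup>2" using K \<epsilon> by auto
  ultimately have K\<sigma>: "K * \<sigma>\<^sup>2 \<le> \<theta> / 4" and \<epsilon>\<sigma>: "\<epsilon> * \<sigma>\<^sup>2 \<le> \<theta> / 2" by linarith+
  \<comment> \<open>The drop in the touching inequality on the sphere of radius \<sigma>.
    Sup-convolution costs \<gamma> / 4, mollification \<gamma> / 8 there and \<gamma> / 8 at x0: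
    half of \<gamma> altogether, so the contact point stays off the sphere.\<close>
  define \<gamma> where "\<gamma> = \<epsilon> * \<sigma>\<^sup>2"
  have \<gamma>: "\<gamma> > 0" "\<gamma> \<le> \<theta> / 2" using \<epsilon> \<sigma> \<epsilon>\<sigma> by (auto simp: \<gamma>_def)
  have sq: "(x - x0) \<bullet> (x - x0) = (dist x x0)\<^sup>2" for x by (simp add: dist_norm power2_norm_eq_inner)
  have inball: "f x + p x \<le> v x + M - \<epsilon> * ((x - x0) \<bullet> (x - x0))" "f x + p x \<le> w x0 + \<theta> / 4"
    if x: "x \<in> cball x0 \<sigma>" for x
  proof -
    have xr: "x \<in> cball x0 r" "dist x x0 < d1" "dist x x0 < d2" using x \<sigma> by (auto simp: dist_commute)
    have "(dist x x0)\<^sup>2 \<le> \<sigma>\<^sup>2" using x by (intro power_mono) (auto simp: dist_commute)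
    hence 1: "K * (dist x x0)\<^sup>2 \<le> K * \<sigma>\<^sup>2" "\<epsilon> * (dist x x0)\<^sup>2 \<le> \<epsilon> * \<sigma>\<^sup>2" using K \<epsilon> by auto
    have p1: "p x \<le> v x + M - \<epsilon> * ((x - x0) \<bullet> (x - x0))"
      using d1(2)[OF xr(1,2)] 1 K\<sigma> \<epsilon>\<sigma> touch(2) unfolding p_def sq by linarith
    have p2: "p x \<le> w x0 + \<theta> / 4" using 1 K\<sigma> \<theta> unfolding p_def sq by linarith
    have "f x + p x = max (w x) (p x)" using xr(1) by (simp add: f_def max_def)
    thus "f x + p x \<le> v x + M - \<epsilon> * ((x - x0) \<bullet> (x - x0))" "f x + p x \<le> w x0 + \<theta> / 4"
      using touch(1)[OF xr(1)] p1 p2 d2(2)[OF xr(1,3)] by auto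
  qed
  \<comment> \<open>Two barriers for one sup-convolution: the first keeps the contact point y inside
    the ball, the second gives v y \<le> v x0 + \<theta>, so that \<open>super\<close> applies at
    y.\<close>
  define \<psi> where "\<psi> = (\<lambda>x. min (v x + (M - \<epsilon> * ((x - x0) \<bullet> (x - x0)) + \<gamma> / 4)) (w x0 + \<theta> / 2) + - p x)"
  have v\<sigma>: "lsc_on (cball x0 \<sigma>) v" using \<sigma> by (intro lsc_on_subset[OF v]) auto
  have "lsc_on (cball x0 \<sigma>) \<psi>"
    unfolding \<psi>_def by (intro lsc_on_add lsc_on_min v\<sigma> continuous_on_imp_lsc_on continuous_intros contp)
  moreover have "f x < \<psi> x" if "x \<in> cball x0 \<sigma>" for x
    using inball[OF that] \<gamma> \<theta> by (simp add: \<psi>_def)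
  ultimately obtain k where k: "k > 0" "\<And>x. x \<in> cball x0 \<sigma> \<Longrightarrow> supconv k f x < \<psi> x"
    using supconv_less[OF f_usc f0 fB compact_cball, of x0 \<sigma> \<psi>] by blast
  define g where "g = supconv k f"
  note F = f_usc f0 fB k(1)
  have lip: "\<bar>g x - g y\<bar> \<le> k * dist x y" for x y
    unfolding g_def by (rule supconv_Lipschitz[OF F])
  have gf: "f x \<le> g x" for x using supconv_ge[OF F, of x x] by (simp add: g_def)
  have contg: "continuous_on UNIV g"
  proof -
    have "k-lipschitz_on UNIV g" using lip k(1) by (auto simp: lipschitz_on_def dist_real_def)
    thus ?thesis by (rule lipschitz_on_continuous_on)
  qed
  have suppg: "bounded {x. g x \<noteq> 0}"
  proof (rule bounded_subset[OF bounded_cball[of x0 "r / 2 + B / k"]], rule subsetI)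
    fix x assume "x \<in> {x. g x \<noteq> 0}"
    hence gpos: "g x > 0" using gf[of x] f0[of x] by auto
    obtain y where y: "supconv k f x = f y - k * dist x y"
      by (rule supconv_attained[OF F]) (rule that)
    have "0 \<le> k * dist x y" using k by simp
    hence "f y > 0" and "k * dist x y < B" using y gpos fB[of y] by (auto simp: g_def)
    moreover have "dist x0 y < r / 2" using \<open>f y > 0\<close> f_far[of y] by (metis less_irrefl not_le)
    ultimately have "dist x0 y < r / 2" and "dist x y < B / k" using k by (auto simp: field_simps)
    thus "x \<in> cball x0 (r / 2 + B / k)" using dist_triangle[of x0 x y] by (simp add: dist_commute)
  qed
  have g_visc: "CARD('n) * c - 2 * K * quad_sum S (mat 1) \<le> quad_sum S A"
    if "(s, A) \<in> superjet g x" "\<bar>det S\<bar> = 1" for s A x and S :: "real^'n^'n"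
    using superjet_supconv[OF F that(1)[unfolded g_def]] f_jet[OF _ that(2)] by blast
  define \<delta> where "\<delta> = \<gamma> / (8 * k)"
  have \<delta>: "\<delta> > 0" "k * \<delta> = \<gamma> / 8" using \<gamma> k by (auto simp: \<delta>_def)
  obtain W D H where W: "C2 W D H" "\<And>x. H x \<in> SymMat" "bounded {x. H x \<noteq> 0}"
    "\<And>x. \<bar>W x - g x\<bar> \<le> k * \<delta>"
    "\<And>S t n e x. \<forall>y. g y \<le> (walk S t ^^ n) g y + e \<Longrightarrow> W x \<le> (walk S t ^^ n) W x + e"
    by (rule mollification[OF contg suppg \<delta>(1) lip less_imp_le[OF k(1)]]) (rule that)
  \<comment> \<open>One W satisfies the linear inequalities for all S simultaneously; with the
    Hessian of p added back, they combine to the determinant inequality.\<close>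
  have HS: "CARD('n) * c \<le> quad_sum S (H x + mat (2 * K))" if S: "\<bar>det S\<bar> = 1" for x S
  proof -
    have "CARD('n) * c - 2 * K * quad_sum S (mat 1) \<le> quad_sum S (H x)"
      by (rule mollification_inherits_viscosity_bound[OF contg suppg lip less_imp_le[OF k(1)] g_visc[OF _ S] W(1,3,5)])
    moreover have "quad_sum S (mat (2 * K)) = 2 * K * quad_sum S (mat 1)"
      by (simp add: quad_sum_def mat_mult_vec sum_distrib_left)
    ultimately show ?thesis by (simp add: quad_sum_add)
  qed
  have Hsym: "H x + mat (2 * K) \<in> SymMat" for x by (intro SymMat_add SymMat_mat W(2))
  have Hpsd: "psd (H x + mat (2 * K))" "C \<le> det (H x + mat (2 * K))" for x
    using quad_sum_ge_imp_pos_def[OF Hsym c(1) HS] c(2) by auto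
  define \<Phi> where "\<Phi> = (\<lambda>x. W x + p x)"
  have C2\<Phi>: "C2 \<Phi> (\<lambda>x. D x + ((2 * K) *\<^sub>R (x - x0) + 0)) (\<lambda>x. H x + (mat (2 * K) + 0))"
    unfolding \<Phi>_def by (rule C2_add[OF W(1) C2p])
  have lsc\<Phi>: "lsc_on (cball x0 \<sigma>) (\<lambda>x. v x + - \<Phi> x)"
    by (intro lsc_on_add v\<sigma> continuous_on_imp_lsc_on continuous_intros C2_imp_continuous_on[OF C2\<Phi>])
  have x0\<sigma>: "x0 \<in> cball x0 \<sigma>" using \<sigma> by simp
  hence "cball x0 \<sigma> \<noteq> {}" by blast
  then obtain y where y: "y \<in> cball x0 \<sigma>" "\<And>z. z \<in> cball x0 \<sigma> \<Longrightarrow> v y + - \<Phi> y \<le> v z + - \<Phi> z"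
    by (rule lsc_on_attains_min[OF compact_cball _ lsc\<Phi>]) (rule that)
  have "W x0 \<ge> \<theta> - \<gamma> / 8" using W(4)[of x0] gf[of x0] fx0 \<delta> by linarith
  hence "v x0 + - \<Phi> x0 \<le> - M + \<gamma> / 8" using touch(2) by (simp add: \<Phi>_def p_def)
  hence vy: "v y - \<Phi> y \<le> - M + \<gamma> / 8" using y(2)[OF x0\<sigma>] by simp
  have Wy: "W y + p y \<le> g y + p y + \<gamma> / 8" using W(4)[of y] \<delta>(2) by linarith
  have gy: "g y + p y < v y + M - \<epsilon> * (dist y x0)\<^sup>2 + \<gamma> / 4" "g y + p y < w x0 + \<theta> / 2"
    using k(2)[OF y(1)] by (auto simp: \<psi>_def g_def sq)
  have "dist y x0 \<noteq> \<sigma>"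
  proof
    assume "dist y x0 = \<sigma>"
    hence "W y + p y < v y + M - \<gamma> + \<gamma> / 4 + \<gamma> / 8" using gy(1) Wy by (simp add: \<gamma>_def)
    thus False using vy \<gamma>(1) unfolding \<Phi>_def by linarith
  qed
  hence y\<sigma>: "dist y x0 < \<sigma>" using y(1) by (simp add: dist_commute)
  have vle: "v y \<le> v x0 + \<theta>" using vy Wy gy(2) \<gamma> touch(2) unfolding \<Phi>_def by linarith
  have "(v y, H y + mat (2 * K)) \<in> subjet v y"
  proof -
    let ?e = "\<sigma> - dist y x0"
    have "C2 (\<lambda>x. \<Phi> x + (v y - \<Phi> y)) (\<lambda>x. D x + ((2 * K) *\<^sub>R (x - x0) + 0) + 0) (\<lambda>x. H x + (mat (2 * K) + 0) + 0)"
      by (rule C2_add[OF C2\<Phi> C2_const])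
    from C2_imp_C2_on_ball[OF this, of y ?e]
    have CC: "C2_on_ball (\<lambda>x. \<Phi> x + (v y - \<Phi> y)) y ?e (\<lambda>x. D x + (2 * K) *\<^sub>R (x - x0)) (\<lambda>x. H x + mat (2 * K))"
      by simp
    have "\<Phi> z + (v y - \<Phi> y) \<le> v z" if "z \<in> ball y ?e" for z
    proof -
      have "z \<in> cball x0 \<sigma>" using that dist_triangle[of x0 z y] by (simp add: dist_commute)
      from y(2)[OF this] show ?thesis by linarith
    qed
    thus ?thesis unfolding subjet_def using CC y\<sigma>
      by (intro CollectI exI[of _ "\<lambda>x. \<Phi> x + (v y - \<Phi> y)"] exI[of _ ?e]
          exI[of _ "\<lambda>x. D x + (2 * K) *\<^sub>R (x - x0)"] exI[of _ "\<lambda>x. H x + mat (2 * K)"]) auto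
  qed
  moreover have "y \<in> ball x0 r" using y\<sigma> \<sigma> by (simp add: dist_commute)
  ultimately have "det (H y + mat (2 * K)) < C" using super vle Hsym Hpsd(1) by blast
  thus False using Hpsd(2)[of y] by linarith
qed

lemma Q_comparison:
  fixes \<Omega> :: "(real^'n) set" and h u v :: "real^'n \<Rightarrow> real"
  assumes \<Omega>: "bounded \<Omega>" "open \<Omega>" and h: "continuous_on \<Omega> h" "\<And>x. x \<in> \<Omega> \<Longrightarrow> h x \<ge> 0"
    and u: "usc_on (closure \<Omega>) u" and v: "lsc_on (closure \<Omega>) v"
    and sub: "Q_subsolution \<Omega> h u" and super: "Q_supersolution \<Omega> h v"
    and bd: "\<And>x. x \<in> frontier \<Omega> \<Longrightarrow> u x \<le> v x" and x1: "x1 \<in> \<Omega>"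
  shows "u x1 \<le> v x1"
proof (rule ccontr)
  assume "\<not> u x1 \<le> v x1"
  hence gap: "u x1 - v x1 > 0" by simp
  obtain R where R: "R > 0" "\<And>x. x \<in> closure \<Omega> \<Longrightarrow> norm x \<le> R"
    using bounded_closure[OF \<Omega>(1)] unfolding bounded_pos by blast
  have R2: "x \<bullet> x \<le> R\<^sup>2" if "x \<in> closure \<Omega>" for x
    using R(2)[OF that] by (simp add: dot_square_norm power_mono)
  \<comment> \<open>The perturbation lowers u at x1 by at most \<epsilon> R^2, half of the gap, so
    the maximum of \<phi> remains positive.\<close>
  define \<epsilon> where "\<epsilon> = (u x1 - v x1) / (2 * R\<^sup>2)"
  have \<epsilon>: "\<epsilon> > 0" "2 * (\<epsilon> * R\<^sup>2) = u x1 - v x1" using gap R by (auto simp: \<epsilon>_def)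
  define \<phi> where "\<phi> = (\<lambda>x. u x + \<epsilon> * (x \<bullet> x - R\<^sup>2) + - v x)"
  have usc\<phi>: "usc_on (closure \<Omega>) \<phi>"
    unfolding \<phi>_def
  proof (intro usc_on_add u)
    show "usc_on (closure \<Omega>) (\<lambda>x. \<epsilon> * (x \<bullet> x - R\<^sup>2))"
      by (intro continuous_on_imp_usc_on continuous_intros)
    show "usc_on (closure \<Omega>) (\<lambda>x. - v x)" using v by (simp add: usc_on_uminus)
  qed
  have x1c: "x1 \<in> closure \<Omega>" using x1 closure_subset by blast
  hence "closure \<Omega> \<noteq> {}" by (metis empty_iff)
  moreover have "compact (closure \<Omega>)" using \<Omega>(1) by (simp add: compact_closure)
  ultimately obtain x0 where x0: "x0 \<in> closure \<Omega>" "\<And>y. y \<in> closure \<Omega> \<Longrightarrow> \<phi> y \<le> \<phi> x0"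
    using usc_on_attains_max[OF _ _ usc\<phi>] by metis
  define M where "M = \<phi> x0"
  have "\<epsilon> * (x1 \<bullet> x1 - R\<^sup>2) \<ge> - (\<epsilon> * R\<^sup>2)" using \<epsilon>(1) by (simp add: right_diff_distrib)
  hence "\<phi> x1 > 0" using \<epsilon>(2) gap unfolding \<phi>_def by linarith
  hence M: "M > 0" using x0(2)[OF x1c] by (simp add: M_def)
  have nonpos: "\<epsilon> * (x \<bullet> x - R\<^sup>2) \<le> 0" if "x \<in> closure \<Omega>" for x
    using R2[OF that] \<epsilon>(1) by (simp add: mult_le_0_iff)
  have "x0 \<notin> frontier \<Omega>"
  proof
    assume "x0 \<in> frontier \<Omega>"
    hence "\<phi> x0 \<le> 0" using bd[of x0] nonpos[OF x0(1)] unfolding \<phi>_def by linarith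
    thus False using M by (simp add: M_def)
  qed
  hence x0\<Omega>: "x0 \<in> \<Omega>" using x0(1) \<Omega>(2) by (simp add: frontier_def interior_open)
  \<comment> \<open>Of the curvature 2 \<epsilon> I, one half is given up to make x0 a strict
    maximum; the remaining \<epsilon> I makes the subsolution strict.\<close>
  define q where "q = (\<lambda>x. \<epsilon> * ((x - 0) \<bullet> (x - 0)) + (- \<epsilon> / 2) * ((x - x0) \<bullet> (x - x0)) + - (\<epsilon> * R\<^sup>2))"
  have C2q: "C2 q (\<lambda>x. (2 * \<epsilon>) *\<^sub>R (x - 0) + (2 * (- \<epsilon> / 2)) *\<^sub>R (x - x0) + 0) (\<lambda>x. mat (2 * \<epsilon>) + mat (2 * (- \<epsilon> / 2)) + 0)"
    unfolding q_def by (intro C2_add C2_quadratic C2_const)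
  have Hq: "mat (2 * \<epsilon>) + mat (2 * (- \<epsilon> / 2)) + 0 = (mat \<epsilon> :: real^'n^'n)"
    by (simp add: mat_def vec_eq_iff)
  have q_eq: "q x = \<epsilon> * (x \<bullet> x - R\<^sup>2) - \<epsilon> / 2 * ((x - x0) \<bullet> (x - x0))" for x
    by (simp add: q_def right_diff_distrib)
  have q0: "q x \<le> 0" if "x \<in> closure \<Omega>" for x
  proof -
    have "0 \<le> \<epsilon> / 2 * ((x - x0) \<bullet> (x - x0))" using \<epsilon> by simp
    thus ?thesis using nonpos[OF that] unfolding q_eq by linarith
  qed
  define w where "w = (\<lambda>x. u x + q x)"
  have w_le: "w x \<le> v x + M - \<epsilon> / 2 * ((x - x0) \<bullet> (x - x0))" if "x \<in> closure \<Omega>" for x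
    using x0(2)[OF that] unfolding M_def[symmetric] unfolding w_def q_eq \<phi>_def by linarith
  have w_x0: "w x0 = v x0 + M" unfolding w_def q_eq M_def \<phi>_def by simp
  have jet: "A - mat \<epsilon> \<in> SymMat" "psd (A - mat \<epsilon>)" "w x \<le> q x"
      "h x \<le> (q x - w x) ^ (CARD('n) + 2) * det (A - mat \<epsilon>)"
    if "x \<in> \<Omega>" "(s, A) \<in> superjet w x" for x s A
  proof -
    have s: "s = w x" using superjet_fst that(2) by blast
    have "(s + (- 1) *\<^sub>R q x, A + (- 1) *\<^sub>R mat \<epsilon>) \<in> superjet (\<lambda>y. w y + (- 1) *\<^sub>R q y) x"
      using superjet_add_C2[OF that(2) C2_scaleR[OF C2q, of "-1"]] unfolding Hq .
    hence "(w x - q x, A - mat \<epsilon>) \<in> superjet u x" by (simp add: s w_def)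
    hence "Fop h x (w x - q x) (A - mat \<epsilon>) \<ge> 0 \<and> (w x - q x, A - mat \<epsilon>) \<in> Qcone"
      using sub that(1) unfolding Q_subsolution_def by blast
    thus "A - mat \<epsilon> \<in> SymMat" "psd (A - mat \<epsilon>)" "w x \<le> q x"
      "h x \<le> (q x - w x) ^ (CARD('n) + 2) * det (A - mat \<epsilon>)"
      by (auto simp: mem_Qcone Fop_def)
  qed
  have usc_w: "usc_on (closure \<Omega>) w"
    unfolding w_def by (intro usc_on_add u continuous_on_imp_usc_on C2_imp_continuous_on[OF C2q])
  obtain r0 where r0: "r0 > 0" "cball x0 r0 \<subseteq> \<Omega>"
    using \<Omega>(2) x0\<Omega> open_contains_cball by blast
  \<comment> \<open>The sign condition on u is known only where the superjet is nonempty, and x0 may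
    have an empty one. A steep paraboloid centred at x0 touches w from above at some z in the ball
    with w z \<ge> w x0, and the jet condition at z gives w z \<le> q z \<le> 0.\<close>
  have w0: "w x0 \<le> 0"
  proof -
    have wr: "usc_on (cball x0 r0) w" using r0 closure_subset by (intro usc_on_subset[OF usc_w]) blast
    have ne: "cball x0 r0 \<noteq> {}" using r0 by simp
    obtain xm where xm: "\<And>y. y \<in> cball x0 r0 \<Longrightarrow> w y \<le> w xm"
      by (rule usc_on_attains_max[OF compact_cball ne wr]) (rule that)
    define K where "K = (\<bar>w xm - w x0\<bar> + 1) / r0\<^sup>2"
    have K: "K > 0" "w xm - w x0 < K * r0\<^sup>2" using r0 by (auto simp: K_def add_nonneg_pos)
    have "usc_on (cball x0 r0) (\<lambda>x. w x + - (K * ((x - x0) \<bullet> (x - x0))))"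
      by (intro usc_on_add wr continuous_on_imp_usc_on continuous_intros)
    then obtain z where z: "z \<in> cball x0 r0" "\<And>y. y \<in> cball x0 r0 \<Longrightarrow>
        w y + - (K * ((y - x0) \<bullet> (y - x0))) \<le> w z + - (K * ((z - x0) \<bullet> (z - x0)))"
      by (rule usc_on_attains_max[OF compact_cball ne]) (rule that)
    have zx: "w x0 + K * ((z - x0) \<bullet> (z - x0)) \<le> w z" using z(2)[of x0] r0 by simp
    have "dist z x0 \<noteq> r0"
    proof
      assume "dist z x0 = r0"
      hence "(z - x0) \<bullet> (z - x0) = r0\<^sup>2" by (simp add: dist_norm power2_norm_eq_inner[symmetric])
      thus False using zx K(2) xm[OF z(1)] by simp
    qed
    hence zr: "dist x0 z < r0" using z(1) by (simp add: dist_commute)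
    let ?P = "\<lambda>x. K * ((x - x0) \<bullet> (x - x0)) + (w z - K * ((z - x0) \<bullet> (z - x0)))"
    have "C2 ?P (\<lambda>x. (2 * K) *\<^sub>R (x - x0) + 0) (\<lambda>x. mat (2 * K) + 0)"
      by (rule C2_add[OF C2_quadratic C2_const])
    hence CC: "C2_on_ball ?P z (r0 - dist x0 z) (\<lambda>x. (2 * K) *\<^sub>R (x - x0)) (\<lambda>x. mat (2 * K))"
      using C2_imp_C2_on_ball by force
    have "w y \<le> ?P y" if "y \<in> ball z (r0 - dist x0 z)" for y
    proof -
      have "y \<in> cball x0 r0" using that dist_triangle[of x0 y z] by simp
      from z(2)[OF this] show ?thesis by linarith
    qed
    hence "(w z, mat (2 * K)) \<in> superjet w z"
      unfolding superjet_def using CC zr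
      by (intro CollectI exI[of _ ?P] exI[of _ "r0 - dist x0 z"] exI[of _ "\<lambda>x. (2 * K) *\<^sub>R (x - x0)"]
          exI[of _ "\<lambda>x. mat (2 * K)"]) auto
    moreover have z\<Omega>: "z \<in> \<Omega>" using z(1) r0(2) by blast
    ultimately have "w z \<le> q z" using jet(3) by blast
    also have "q z \<le> 0" using z\<Omega> closure_subset by (intro q0) blast
    finally have "w z \<le> 0" .
    moreover have "0 \<le> K * ((z - x0) \<bullet> (z - x0))" using K by simp
    ultimately show ?thesis using zx by linarith
  qed
  \<comment> \<open>Since v x0 = w x0 - 2 \<theta>, the condition w \<ge> w x0 - \<theta> gives - u
    \<le> b and the condition v \<le> v x0 + \<theta> gives - v \<ge> b: both sides meet at the same
    b.\<close>
  define \<theta> where "\<theta> = M / 2"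
  define b where "b = \<theta> - w x0"
  define c1 where "c1 = b ^ (CARD('n) + 2)"
  have \<theta>: "\<theta> > 0" using M by (simp add: \<theta>_def)
  have b: "b > 0" using \<theta> w0 by (simp add: b_def)
  have c1: "c1 > 0" using b by (simp add: c1_def)
  \<comment> \<open>The strict gain of the subsolution is c1 times \<open>\<epsilon> ^ N\<close>,
    that is 2 \<eta>. With C in the middle, one \<eta> is left on either side for the oscillation of
    h.\<close>
  define \<eta> where "\<eta> = c1 * \<epsilon> ^ CARD('n) / 2"
  have \<eta>: "\<eta> > 0" using c1 \<epsilon> by (simp add: \<eta>_def)
  define C where "C = (h x0 + \<eta>) / c1"
  have C: "C > 0" "c1 * C = h x0 + \<eta>" using h(2)[OF x0\<Omega>] \<eta> c1 by (auto simp: C_def)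
  obtain r1 where r1: "r1 > 0" "\<And>x. x \<in> \<Omega> \<Longrightarrow> dist x x0 < r1 \<Longrightarrow> dist (h x) (h x0) < \<eta>"
    using h(1) x0\<Omega> \<eta> unfolding continuous_on_iff by metis
  define r where "r = min r0 r1"
  have r: "r > 0" "ball x0 r \<subseteq> \<Omega>" "cball x0 r \<subseteq> closure \<Omega>"
  proof -
    show "r > 0" using r0 r1 by (simp add: r_def)
    have "cball x0 r \<subseteq> \<Omega>" using r0(2) by (auto simp: r_def)
    thus "ball x0 r \<subseteq> \<Omega>" "cball x0 r \<subseteq> closure \<Omega>"
      using closure_subset ball_subset_cball by blast+
  qed
  have hr: "h x < h x0 + \<eta>" "h x0 - \<eta> < h x" if "x \<in> ball x0 r" for x
    using r1(2)[of x] r(2) that by (auto simp: r_def dist_commute dist_real_def abs_less_iff subset_iff)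
  show False
  proof (rule Monge_Ampere_strict_comparison[OF r(1) usc_on_subset[OF usc_w r(3)] lsc_on_subset[OF v r(3)]
        \<theta> C(1) half_gt_zero[OF \<epsilon>(1)] w_le w_x0])
    fix x assume "x \<in> cball x0 r" thus "x \<in> closure \<Omega>" using r(3) by blast
  next
    fix x s A assume x: "x \<in> ball x0 r" and wx: "w x0 - \<theta> \<le> w x" and sA: "(s, A) \<in> superjet w x"
    have x\<Omega>: "x \<in> \<Omega>" using x r(2) by blast
    note J = jet[OF x\<Omega> sA]
    have "q x \<le> 0" using x\<Omega> closure_subset by (intro q0) blast
    hence "q x - w x \<le> b" using wx by (simp add: b_def)
    hence "(q x - w x) ^ (CARD('n) + 2) * det (A - mat \<epsilon>) \<le> c1 * det (A - mat \<epsilon>)"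
      unfolding c1_def using J(3) psd_det_nonneg[OF J(1,2)] by (intro mult_right_mono power_mono) auto
    hence "h x \<le> c1 * det (A - mat \<epsilon>)" using J(4) by linarith
    moreover have "c1 * (det (A - mat \<epsilon>) + \<epsilon> ^ CARD('n)) \<le> c1 * det (A - mat \<epsilon> + mat \<epsilon>)"
      using psd_det_add_mat[OF J(1,2), of \<epsilon>] \<epsilon>(1) c1 by (intro mult_left_mono) auto
    ultimately have "h x + 2 * \<eta> \<le> c1 * det A" by (simp add: \<eta>_def distrib_left)
    hence "c1 * C \<le> c1 * det A" using C(2) hr(2)[OF x] by linarith
    hence "C \<le> det A" using c1 by simp
    moreover have "A - mat \<epsilon> + mat \<epsilon> \<in> SymMat" by (intro SymMat_add J(1) SymMat_mat)
    moreover have "psd (A - mat \<epsilon> + mat \<epsilon>)" using \<epsilon>(1) by (intro psd_add J(2) psd_mat) auto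
    ultimately show "A \<in> SymMat \<and> psd A \<and> C \<le> det A" by simp
  next
    fix x s A assume x: "x \<in> ball x0 r" and vx: "v x \<le> v x0 + \<theta>" and sA: "(s, A) \<in> subjet v x"
      and A: "A \<in> SymMat" "psd A"
    have x\<Omega>: "x \<in> \<Omega>" using x r(2) by blast
    have s: "s = v x" using subjet_fst sA by blast
    have bv: "b \<le> - v x" using vx w_x0 unfolding b_def \<theta>_def by linarith
    show "det A < C"
    proof (rule ccontr)
      assume "\<not> det A < C"
      hence dA: "C \<le> det A" by simp
      \<comment> \<open>Interior points of the cone exclude the second alternative for
        supersolutions; det A \<ge> C > 0 and v x \<le> - b < 0 provide such a point.\<close>
      have "(v x, A) \<in> top_of_set RS interior_of Qcone"
        using bv b A dA C(1) by (intro mem_interior_Qcone) auto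
      hence "Fop h x (v x) A \<le> 0"
        using super x\<Omega> sA unfolding Q_supersolution_def s by blast
      hence "(- v x) ^ (CARD('n) + 2) * det A \<le> h x" by (simp add: Fop_def)
      moreover have "c1 * C \<le> (- v x) ^ (CARD('n) + 2) * det A"
        unfolding c1_def using bv b dA C(1) by (intro mult_mono power_mono zero_le_power) linarith+
      ultimately show False using hr(1)[OF x] C(2) by linarith
    qed
  qed
qed

theorem theorem6p14:
  fixes \<Omega> :: "(real^'n) set" and h :: "real^'n \<Rightarrow> real"
  assumes "bounded \<Omega>" and "open \<Omega>" and "connected \<Omega>"
    and "continuous_on \<Omega> h" and "\<forall>x\<in>\<Omega>. h x \<ge> 0"
  shows "proper_elliptic_map \<Omega> (Theta h) \<and> hausdorff_continuous \<Omega> (Theta h) \<and>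
    (\<forall>x\<in>\<Omega>. top_of_set RS frontier_of (Theta h x) \<subseteq>
       {(r, A). (r, A) \<in> RS \<and> (- r) ^ (CARD('n) + 2) * det A = h x}) \<and>
    (\<forall>u v. usc_on (closure \<Omega>) u \<longrightarrow> lsc_on (closure \<Omega>) v \<longrightarrow>
       Q_subsolution \<Omega> h u \<longrightarrow> Q_supersolution \<Omega> h v \<longrightarrow>
       (\<forall>x\<in>frontier \<Omega>. u x \<le> v x) \<longrightarrow> (\<forall>x\<in>\<Omega>. u x \<le> v x))"
proof (intro conjI ballI allI impI)
  show "proper_elliptic_map \<Omega> (Theta h)" by (rule proper_elliptic_map_Theta)
  show "hausdorff_continuous \<Omega> (Theta h)" by (rule hausdorff_continuous_Theta[OF assms(4)])
  show "top_of_set RS frontier_of (Theta h x) \<subseteq>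
       {(r, A). (r, A) \<in> RS \<and> (- r) ^ (CARD('n) + 2) * det A = h x}" if "x \<in> \<Omega>" for x
    using assms(5) that by (intro frontier_Theta) blast
  show "u x \<le> v x" if "usc_on (closure \<Omega>) u" "lsc_on (closure \<Omega>) v" "Q_subsolution \<Omega> h u"
    "Q_supersolution \<Omega> h v" "\<forall>x\<in>frontier \<Omega>. u x \<le> v x" "x \<in> \<Omega>" for u v x
    using Q_comparison[OF assms(1,2,4) _ that(1-4) _ that(6)] assms(5) that(5) by blast
qed

end
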